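(* Let $H$ be a split graph that is neither a complete graph nor an empty (edgeless) graph, with independence number $\alpha$ and clique number $\omega$. Then, for all $p\in[0,1]$, $$\mathrm{ed}_{\mathrm{Forb}(H)}(p)=\min\left\{\frac{p}{\omega-1},\frac{1-p}{\alpha-1}\right\}.$$
   Context: All graphs are finite and simple. A split graph is a graph whose vertex set can be partitioned into one clique and one independent set. For two graphs $G,G'$ on the same labeled vertex set of size $n$, the normalized edit distance is $\mathrm{Dist}(G,G')=|E(G)\triangle E(G')|/\binom{n}{2}$. A hereditary property is a set of graphs closed under isomorphism and under taking induced subgraphs. For a hereditary property $\mathcal{H}$ and a graph $G$, $\mathrm{Dist}(G,\mathcal{H})=\min\{\mathrm{Dist}(G,G'): V(G')=V(G),\ G'\in\mathcal{H}\}$. The edit distance function of a hereditary property $\mathcal{H}$ is the function of $p\in[0,1]$ given by $$\mathrm{ed}_{\mathcal{H}}(p)=\lim_{n\to\infty}\max\left\{\mathrm{Dist}(G,\mathcal{H}) : |V(G)|=n,\ |E(G)|=\left\lfloor p\tbinom{n}{2}\right\rfloor\right\}$$ (the limit is known to exist for nontrivial, i.e. infinite, hereditary properties). For a graph $H$, $\mathrm{Forb}(H)$ denotes the hereditary property of all graphs that have no induced copy of $H$. *)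

theory Defs
  imports Complex_Main "HOL-Library.Ramsey"
begin

text \<open>A graph is a pair of a vertex set and a set of two-element vertex subsets.\<close>

type_synonym 'a ugraph = "'a set \<times> 'a set set"

abbreviation verts :: "'a ugraph \<Rightarrow> 'a set" where "verts \<equiv> fst"

abbreviation edges :: "'a ugraph \<Rightarrow> 'a set set" where "edges \<equiv> snd"

definition ugraph :: "'a ugraph \<Rightarrow> bool" where
  "ugraph G \<longleftrightarrow> finite (verts G) \<and> edges G \<subseteq> nsets (verts G) 2"

definition complete_graph :: "'a ugraph \<Rightarrow> bool" where
  "complete_graph G \<longleftrightarrow> edges G = nsets (verts G) 2"

definition edgeless_graph :: "'a ugraph \<Rightarrow> bool" where
  "edgeless_graph G \<longleftrightarrow> edges G = {}"

definition clique :: "'a ugraph \<Rightarrow> 'a set \<Rightarrow> bool" where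
  "clique G K \<longleftrightarrow> K \<subseteq> verts G \<and> nsets K 2 \<subseteq> edges G"

definition independent :: "'a ugraph \<Rightarrow> 'a set \<Rightarrow> bool" where
  "independent G S \<longleftrightarrow> S \<subseteq> verts G \<and> nsets S 2 \<inter> edges G = {}"

definition clique_number :: "'a ugraph \<Rightarrow> nat" where
  "clique_number G = Max (card ` {K. clique G K})"

definition independence_number :: "'a ugraph \<Rightarrow> nat" where
  "independence_number G = Max (card ` {S. independent G S})"

definition split_graph :: "'a ugraph \<Rightarrow> bool" where
  "split_graph G \<longleftrightarrow> ugraph G \<and>
     (\<exists>K S. K \<union> S = verts G \<and> K \<inter> S = {} \<and> clique G K \<and> independent G S)"

definition graph_iso :: "'a ugraph \<Rightarrow> 'b ugraph \<Rightarrow> bool" where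
  "graph_iso G G' \<longleftrightarrow>
     (\<exists>f. bij_betw f (verts G) (verts G') \<and> edges G' = (\<lambda>e. f ` e) ` edges G)"

definition induced_subgraph :: "'a ugraph \<Rightarrow> 'a set \<Rightarrow> 'a ugraph" where
  "induced_subgraph G W = (W, edges G \<inter> nsets W 2)"

definition hereditary :: "'a ugraph set \<Rightarrow> bool" where
  "hereditary \<H> \<longleftrightarrow> (\<forall>G\<in>\<H>. ugraph G) \<and>
     (\<forall>G\<in>\<H>. \<forall>G'. ugraph G' \<and> graph_iso G G' \<longrightarrow> G' \<in> \<H>) \<and>
     (\<forall>G\<in>\<H>. \<forall>W\<subseteq>verts G. induced_subgraph G W \<in> \<H>)"

text \<open>Vertices of the graphs in a property are natural numbers, which represents every finite graph
  up to isomorphism; the forbidden graph may have vertices of any type.\<close>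

definition Forb :: "'a ugraph \<Rightarrow> nat ugraph set" where
  "Forb H = {G. ugraph G \<and> \<not> (\<exists>W\<subseteq>verts G. graph_iso H (induced_subgraph G W))}"

definition graph_dist :: "'a ugraph \<Rightarrow> 'a ugraph \<Rightarrow> real" where
  "graph_dist G G' = real (card (sym_diff (edges G) (edges G'))) / real (card (verts G) choose 2)"

definition property_dist :: "'a ugraph \<Rightarrow> 'a ugraph set \<Rightarrow> real" where
  "property_dist G \<H> = Min (graph_dist G ` {G' \<in> \<H>. verts G' = verts G})"

definition max_edit_dist :: "nat ugraph set \<Rightarrow> real \<Rightarrow> nat \<Rightarrow> real" where
  "max_edit_dist \<H> p n =
     Max ((\<lambda>G. property_dist G \<H>) `
       {G. ugraph G \<and> card (verts G) = n \<and>
           int (card (edges G)) = \<lfloor>p * real (n choose 2)\<rfloor>})"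

text \<open>The value is meaningful where the limit exists, since \<open>lim\<close> is a total operator.\<close>

definition edit_distance_function :: "nat ugraph set \<Rightarrow> real \<Rightarrow> real" where
  "edit_distance_function \<H> p = lim (max_edit_dist \<H> p)"

lemma graph_iso_sym:
  assumes "ugraph G" "graph_iso G G'"
  shows "graph_iso G' G"
proof -
  obtain f where f: "bij_betw f (verts G) (verts G')" "edges G' = (\<lambda>e. f ` e) ` edges G"
    using assms(2) by (auto simp: graph_iso_def)
  let ?g = "inv_into (verts G) f"
  have "?g ` f ` e = e" if "e \<in> edges G" for e
    using assms(1) f(1) that
    by (intro inv_into_image_cancel) (auto simp: ugraph_def nsets_def bij_betw_def)
  then have "edges G = (\<lambda>e. ?g ` e) ` edges G'"
    by (simp add: f(2) image_image)
  with bij_betw_inv_into[OF f(1)] show ?thesis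
    unfolding graph_iso_def by blast
qed

lemma graph_iso_trans:
  assumes "graph_iso G G'" "graph_iso G' G''"
  shows "graph_iso G G''"
proof -
  obtain f where f: "bij_betw f (verts G) (verts G')" "edges G' = (\<lambda>e. f ` e) ` edges G"
    using assms(1) by (auto simp: graph_iso_def)
  obtain g where g: "bij_betw g (verts G') (verts G'')" "edges G'' = (\<lambda>e. g ` e) ` edges G'"
    using assms(2) by (auto simp: graph_iso_def)
  have "edges G'' = (\<lambda>e. (g \<circ> f) ` e) ` edges G"
    by (simp add: f(2) g(2) image_image image_comp)
  with bij_betw_trans[OF f(1) g(1)] show ?thesis
    unfolding graph_iso_def by blast
qed

lemma graph_iso_induced:
  assumes "graph_iso G G'" "ugraph G" "W \<subseteq> verts G"
  shows "\<exists>W'\<subseteq>verts G'. graph_iso (induced_subgraph G W) (induced_subgraph G' W')"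
proof -
  obtain f where f: "bij_betw f (verts G) (verts G')" "edges G' = (\<lambda>e. f ` e) ` edges G"
    using assms(1) by (auto simp: graph_iso_def)
  have inj: "inj_on f (verts G)" and img: "f ` verts G = verts G'"
    using f(1) by (auto simp: bij_betw_def)
  have "f ` e \<in> nsets (f ` W) 2 \<longleftrightarrow> e \<in> nsets W 2" if "e \<in> edges G" for e
  proof -
    have e: "e \<subseteq> verts G" "finite e" "card e = 2"
      using assms(2) that by (auto simp: ugraph_def nsets_def)
    then have "card (f ` e) = 2"
      by (simp add: card_image[OF inj_on_subset[OF inj]])
    moreover have "f ` e \<subseteq> f ` W \<longleftrightarrow> e \<subseteq> W"
      using inj_on_image_mem_iff[OF inj _ assms(3)] e(1) unfolding image_subset_iff by blast
    ultimately show ?thesis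
      using e by (simp add: nsets_def)
  qed
  then have "edges G' \<inter> nsets (f ` W) 2 = (\<lambda>e. f ` e) ` (edges G \<inter> nsets W 2)"
    unfolding f(2) by blast
  moreover have "bij_betw f W (f ` W)"
    by (rule inj_on_imp_bij_betw[OF inj_on_subset[OF inj assms(3)]])
  ultimately have "graph_iso (induced_subgraph G W) (induced_subgraph G' (f ` W))"
    unfolding graph_iso_def induced_subgraph_def fst_conv snd_conv by (intro exI[of _ f] conjI)
  moreover have "f ` W \<subseteq> verts G'"
    using image_mono[OF assms(3), of f] img by simp
  ultimately show ?thesis
    by (intro exI[of _ "f ` W"] conjI)
qed

lemma hereditary_Forb: "hereditary (Forb H)"
proof -
  have iso: "G' \<in> Forb H" if G: "G \<in> Forb H" and G': "ugraph G'" and i: "graph_iso G G'" for G G'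
  proof (rule ccontr)
    assume "G' \<notin> Forb H"
    then obtain W where W: "W \<subseteq> verts G'" "graph_iso H (induced_subgraph G' W)"
      using G' by (auto simp: Forb_def)
    have "graph_iso G' G"
      using G graph_iso_sym[OF _ i] by (simp add: Forb_def)
    from graph_iso_induced[OF this G' W(1)]
    obtain W' where "W' \<subseteq> verts G" "graph_iso (induced_subgraph G' W) (induced_subgraph G W')"
      by blast
    with graph_iso_trans[OF W(2)] have "W' \<subseteq> verts G" "graph_iso H (induced_subgraph G W')"
      by blast+
    then show False
      using G by (auto simp: Forb_def)
  qed
  have ind: "induced_subgraph G W \<in> Forb H" if G: "G \<in> Forb H" and W: "W \<subseteq> verts G" for G W
  proof -
    have "ugraph (induced_subgraph G W)"
      using G W finite_subset by (auto simp: Forb_def ugraph_def induced_subgraph_def)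
    moreover have "induced_subgraph (induced_subgraph G W) W' = induced_subgraph G W'"
      if "W' \<subseteq> W" for W'
      using that by (auto simp: induced_subgraph_def nsets_def)
    moreover have "verts (induced_subgraph G W) = W"
      by (simp add: induced_subgraph_def)
    moreover have "\<not> graph_iso H (induced_subgraph G W')" if "W' \<subseteq> W" for W'
      using G W that unfolding Forb_def by blast
    ultimately show ?thesis
      unfolding Forb_def by simp
  qed
  show ?thesis
    unfolding hereditary_def using iso ind by (simp add: Forb_def)
qed

end

theory Submission
  imports Defs "HOL-Analysis.Function_Topology" "HOL-Analysis.Convex" "HOL-Computational_Algebra.Primes"
begin

text \<open>
  Upper bound: colour the vertices with \<open>\<omega> - 1\<close> colours such that at most a \<open>1 / (\<omega> - 1)\<close> fraction of the
  edges is monochromatic and delete those edges, which destroys all cliques of size \<open>\<omega>\<close>; or do the same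
  with \<open>\<alpha> - 1\<close> colours in the complement.

  Lower bound: let \<open>G\<close> be quasirandom of density \<open>p\<close> and let \<open>G'\<close> have no induced copy of \<open>H\<close>. A weak regularity
  partition of \<open>G'\<close> makes every pair of vertices white, black or gray, according to whether the density of
  \<open>G'\<close> between their cells is near 0, near 1 or neither, and \<open>G'\<close> differs from \<open>G\<close> on about a fraction \<open>p\<close> of
  the white and \<open>1 - p\<close> of the black pairs. If this is too cheap, then many \<open>m\<close>-tuples of vertices have
  the same cheap pattern of types, hence so do many blow-ups of them, and Ramsey's theorem turns the parts
  of a blow-up into white (independent) or black (complete) clusters. An optimization over vertex weights
  shows that \<open>H\<close> embeds into every cheap coloured pattern of clusters, so a positive
  proportion of the tuples of vertices are compatible with \<open>H\<close>, and the counting lemma yields an induced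
  copy of \<open>H\<close> in \<open>G'\<close>.
\<close>

section \<open>Embedding split graphs into weighted white clusters\<close>

text \<open>Weak regularity fixes its error before the number of cells is known, and a single pair
  of cells may be far smaller than this error, so vertices cannot be chosen inside prescribed cells.
  Patterns are therefore read off from tuples of vertices: the proportion of tuples compatible with
  the forbidden graph depends only on that graph and on the allowed loss, not on the partition, and
  the error of the counting lemma can be chosen below it. The price is that Ramsey's theorem decides
  which parts of a blow-up become white and which black, so the embedding has to succeed for every
  colouring of the clusters. The cost hardly notices this: among m clusters, the m diagonal entries
  are negligible against m^2 pairs. The delicate embedding concerns white clusters with
  \<open>a < b\<close>. The weights guarantee only \<open>b\<close> gray neighbours of the heaviest
  cluster, while \<open>K\<close> may have \<open>b + 1\<close> vertices; the missing room is gained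
  from the way in which \<open>S\<close> is nonadjacent to \<open>K\<close>.\<close>

lemma finite_ex_maximizer:
  fixes f :: "'a \<Rightarrow> 'b::linorder"
  assumes "finite A" "A \<noteq> {}"
  obtains j where "j \<in> A" "\<And>k. k \<in> A \<Longrightarrow> f k \<le> f j"
proof -
  have "Max (f ` A) \<in> f ` A" using assms by (intro Max_in) auto
  then obtain j where "j \<in> A" "Max (f ` A) = f j" by blast
  then show thesis using assms by (intro that[of j]) (auto simp flip: \<open>Max (f ` A) = f j\<close>)
qed

lemma inj_on_extend:
  assumes fin: "finite K" "finite C" and T: "T \<subseteq> K" "inj_on g T"
    and card: "card (K - T) \<le> card (C - g ` T)"
  obtains g' where "inj_on g' K" "\<And>t. t \<in> T \<Longrightarrow> g' t = g t" "g' ` (K - T) \<subseteq> C - g ` T"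
proof -
  obtain f where f: "f ` (K - T) \<subseteq> C - g ` T" "inj_on f (K - T)"
    using card_le_inj[of "K - T" "C - g ` T"] fin card by auto
  let ?g = "\<lambda>k. if k \<in> T then g k else f k"
  have "inj_on ?g (T \<union> (K - T))"
  proof (subst inj_on_Un, intro conjI)
    show "inj_on ?g T" using T(2) by (simp add: inj_on_def)
    show "inj_on ?g (K - T)" using f(2) by (simp add: inj_on_def)
    show "?g ` (T - (K - T)) \<inter> ?g ` (K - T - T) = {}" using f(1) by auto
  qed
  then have "inj_on ?g K" using T(1) by (simp add: Un_absorb1)
  with f show thesis
    by (intro that[of ?g]) auto
qed

text \<open>Here \<open>a + 1\<close> and \<open>b + 1\<close> are the independence number and the clique number.\<close>

locale split_pattern =
  fixes K S :: "'h set" and adj :: "'h \<Rightarrow> 'h \<Rightarrow> bool" and a b :: nat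
  assumes fin: "finite K" "finite S"
    and disj: "K \<inter> S = {}"
    and sym: "adj u v \<longleftrightarrow> adj v u"
    and K_adj: "u \<in> K \<Longrightarrow> v \<in> K \<Longrightarrow> u \<noteq> v \<Longrightarrow> adj u v"
    and S_nadj: "u \<in> S \<Longrightarrow> v \<in> S \<Longrightarrow> u \<noteq> v \<Longrightarrow> \<not> adj u v"
    and clique_le: "C \<subseteq> K \<union> S \<Longrightarrow> (\<And>u v. u \<in> C \<Longrightarrow> v \<in> C \<Longrightarrow> u \<noteq> v \<Longrightarrow> adj u v) \<Longrightarrow> card C \<le> b + 1"
    and clique_ex: "\<exists>C\<subseteq>K \<union> S. (\<forall>u\<in>C. \<forall>v\<in>C. u \<noteq> v \<longrightarrow> adj u v) \<and> card C = b + 1"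
    and indep_le: "C \<subseteq> K \<union> S \<Longrightarrow> (\<And>u v. u \<in> C \<Longrightarrow> v \<in> C \<Longrightarrow> u \<noteq> v \<Longrightarrow> \<not> adj u v) \<Longrightarrow> card C \<le> a + 1"
    and indep_ex: "\<exists>C\<subseteq>K \<union> S. (\<forall>u\<in>C. \<forall>v\<in>C. u \<noteq> v \<longrightarrow> \<not> adj u v) \<and> card C = a + 1"
    and pos: "a \<ge> 1" "b \<ge> 1"
begin

text \<open>Every point of \<open>D\<close> stands for an independent set (white cluster); pairs in \<open>B\<close> are completely
  joined (black), all other pairs can host any bipartite pattern (gray).\<close>

definition embeds :: "'c set \<Rightarrow> ('c \<Rightarrow> 'c \<Rightarrow> bool) \<Rightarrow> bool" where
  "embeds D B \<longleftrightarrow> (\<exists>\<phi>. \<phi> ` (K \<union> S) \<subseteq> D \<and>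
     (\<forall>u\<in>K \<union> S. \<forall>v\<in>K \<union> S. u \<noteq> v \<longrightarrow>
        (\<phi> u = \<phi> v \<longrightarrow> \<not> adj u v) \<and> (B (\<phi> u) (\<phi> v) \<longrightarrow> adj u v)))"

text \<open>A clique meets the independent set \<open>S\<close> in at most one vertex. Together with
  \<open>card_K_le\<close> this leaves only the sizes \<open>b\<close> and \<open>b + 1\<close>;
  \<open>S\<close> is treated symmetrically.\<close>

lemma card_K_ge: "card K \<ge> b"
proof -
  obtain C where C: "C \<subseteq> K \<union> S" "\<forall>u\<in>C. \<forall>v\<in>C. u \<noteq> v \<longrightarrow> adj u v" "card C = b + 1"
    using clique_ex by blast
  have "card (C \<inter> S) \<le> 1"
    using C S_nadj fin card_le_Suc0_iff_eq[of "C \<inter> S"] by (metis IntE One_nat_def finite_Int)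
  moreover have "C = (C \<inter> K) \<union> (C \<inter> S)" using C by blast
  then have "card C \<le> card (C \<inter> K) + card (C \<inter> S)" by (metis card_Un_le)
  moreover have "card (C \<inter> K) \<le> card K" using fin by (simp add: card_mono)
  ultimately show ?thesis using C by linarith
qed

lemma card_K_le: "card K \<le> b + 1"
  by (rule clique_le) (use K_adj in auto)

lemma card_S_ge: "card S \<ge> a"
proof -
  obtain C where C: "C \<subseteq> K \<union> S" "\<forall>u\<in>C. \<forall>v\<in>C. u \<noteq> v \<longrightarrow> \<not> adj u v" "card C = a + 1"
    using indep_ex by blast
  have "card (C \<inter> K) \<le> 1"
    using C K_adj fin card_le_Suc0_iff_eq[of "C \<inter> K"] by (metis IntE One_nat_def finite_Int)
  moreover have "C = (C \<inter> K) \<union> (C \<inter> S)" using C by blast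
  then have "card C \<le> card (C \<inter> K) + card (C \<inter> S)" by (metis card_Un_le)
  moreover have "card (C \<inter> S) \<le> card S" using fin by (simp add: card_mono)
  ultimately show ?thesis using C by linarith
qed

lemma card_S_le: "card S \<le> a + 1"
  by (rule indep_le) (use S_nadj in auto)

lemma exists_nonneighbour:
  assumes "card K = b + 1" "s \<in> S"
  shows "\<exists>k\<in>K. \<not> adj k s"
proof (rule ccontr)
  assume "\<not> ?thesis"
  then have "card (insert s K) \<le> b + 1"
    using assms K_adj sym by (intro clique_le) auto
  moreover have "s \<notin> K" using assms disj by blast
  ultimately show False using assms fin by simp
qed

text \<open>Clique vertices occupy distinct clusters and every \<open>s\<close> joins the cluster of
  a nonneighbour \<open>\<kappa> s\<close>, the only clique vertex it meets there. What remains are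
  black pairs: none may lie between clusters used by \<open>S\<close>, and one between
  \<open>s\<close> and \<open>k\<close> requires an edge.\<close>

lemma embeds_via:
  assumes g: "inj_on g K" "g ` K \<subseteq> D"
    and \<kappa>: "\<And>s. s \<in> S \<Longrightarrow> \<kappa> s \<in> K \<and> \<not> adj (\<kappa> s) s"
    and symB: "\<And>c d. B c d \<Longrightarrow> B d c"
    and SS: "\<And>s s'. s \<in> S \<Longrightarrow> s' \<in> S \<Longrightarrow> \<not> B (g (\<kappa> s)) (g (\<kappa> s'))"
    and SK: "\<And>s k. s \<in> S \<Longrightarrow> k \<in> K \<Longrightarrow> B (g (\<kappa> s)) (g k) \<Longrightarrow> adj k s"
  shows "embeds D B"
  unfolding embeds_def
proof (intro exI[of _ "\<lambda>u. if u \<in> K then g u else g (\<kappa> u)"] conjI ballI impI)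
  show "(\<lambda>u. if u \<in> K then g u else g (\<kappa> u)) ` (K \<union> S) \<subseteq> D"
    using g \<kappa> disj by auto
next
  fix u v
  assume uv: "u \<in> K \<union> S" "v \<in> K \<union> S" "u \<noteq> v"
    and eq: "(if u \<in> K then g u else g (\<kappa> u)) = (if v \<in> K then g v else g (\<kappa> v))"
  consider "u \<in> K" "v \<in> K" | "u \<in> K" "v \<in> S" "v \<notin> K" | "u \<in> S" "u \<notin> K" "v \<in> K" | "u \<in> S" "v \<in> S"
    using uv by blast
  then show "\<not> adj u v"
  proof cases
    case 1 then show ?thesis using eq g uv by (auto dest: inj_onD)
  next
    case 2 then show ?thesis using eq g \<kappa>[of v] by (auto dest: inj_onD)
  next
    case 3 then show ?thesis using eq g \<kappa>[of u] sym by (auto dest: inj_onD)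
  next
    case 4 then show ?thesis using S_nadj uv by blast
  qed
next
  fix u v
  assume uv: "u \<in> K \<union> S" "v \<in> K \<union> S" "u \<noteq> v"
    and BB: "B (if u \<in> K then g u else g (\<kappa> u)) (if v \<in> K then g v else g (\<kappa> v))"
  consider "u \<in> K" "v \<in> K" | "u \<in> K" "v \<in> S" "v \<notin> K" | "u \<in> S" "u \<notin> K" "v \<in> K"
    | "u \<in> S" "u \<notin> K" "v \<in> S" "v \<notin> K"
    using uv by blast
  then show "adj u v"
  proof cases
    case 1 then show ?thesis using K_adj uv by auto
  next
    case 2 then show ?thesis using SK[of v u] symB BB by auto
  next
    case 3 then show ?thesis using SK[of u v] sym symB BB by auto
  next
    case 4 then show ?thesis using SS BB by auto
  qed
qed

text \<open>\<open>T\<close> hits the nonneighbourhood of every \<open>s\<close>. Placing it on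
  \<open>U\<close>, whose clusters lie in no black pair inside \<open>C\<close>, puts all of
  \<open>S\<close> on \<open>U\<close> as well, so black pairs only occur between clique
  vertices.\<close>

lemma embeds_hitting:
  assumes fC: "finite C" and C: "C \<subseteq> D" "card K \<le> card C"
    and U: "U \<subseteq> C" "\<And>c d. c \<in> U \<Longrightarrow> d \<in> C \<Longrightarrow> \<not> B c d"
    and T: "T \<subseteq> K" "card T \<le> card U" "\<And>s. s \<in> S \<Longrightarrow> \<exists>k\<in>T. \<not> adj k s"
    and symB: "\<And>c d. B c d \<Longrightarrow> B d c"
  shows "embeds D B"
proof -
  have fT: "finite T" "finite U"
    using finite_subset[OF T(1) fin(1)] finite_subset[OF U(1) fC] by auto
  obtain g0 where g0: "g0 ` T \<subseteq> U" "inj_on g0 T"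
    using card_le_inj[OF fT T(2)] by blast
  have "card (K - T) = card K - card T" using fT T by (simp add: card_Diff_subset)
  moreover have "card (C - g0 ` T) = card C - card T"
    using fT g0 U fC by (subst card_Diff_subset) (auto simp: card_image)
  ultimately have "card (K - T) \<le> card (C - g0 ` T)" using C by simp
  then obtain g where
    g: "inj_on g K" "\<And>t. t \<in> T \<Longrightarrow> g t = g0 t" "g ` (K - T) \<subseteq> C - g0 ` T"
    using inj_on_extend[OF fin(1) fC T(1) g0(2)] by blast
  have gC: "g ` K \<subseteq> C" 
  proof -
    have "g ` K = g0 ` T \<union> g ` (K - T)" 
    proof -
      have "g ` T = g0 ` T" using g(2) by (rule image_cong[OF refl])
      moreover have "K = T \<union> (K - T)" using T(1) by blast
      ultimately show ?thesis by (metis image_Un)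
    qed
    then show ?thesis using g(3) g0(1) U(1) by blast
  qed
  obtain \<kappa> where \<kappa>: "\<And>s. s \<in> S \<Longrightarrow> \<kappa> s \<in> T \<and> \<not> adj (\<kappa> s) s"
    using T(3) by metis
  have gU: "g (\<kappa> s) \<in> U" if "s \<in> S" for s using \<kappa>[OF that] g g0 by auto
  show ?thesis
  proof (rule embeds_via[OF g(1)])
    show "g ` K \<subseteq> D" using gC C by blast
    show "\<And>s. s \<in> S \<Longrightarrow> \<kappa> s \<in> K \<and> \<not> adj (\<kappa> s) s" using \<kappa> T by blast
    show "\<And>s s'. s \<in> S \<Longrightarrow> s' \<in> S \<Longrightarrow> \<not> B (g (\<kappa> s)) (g (\<kappa> s'))" using gU U by blast
    show "\<And>s k. s \<in> S \<Longrightarrow> k \<in> K \<Longrightarrow> B (g (\<kappa> s)) (g k) \<Longrightarrow> adj k s" using gU U gC by blast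
  qed (use symB in auto)
qed

text \<open>All of \<open>S\<close> shares the centre \<open>i\<close> and the clique is spread over
  its gray neighbours, so adjacency between \<open>K\<close> and \<open>S\<close> is
  unconstrained.\<close>

lemma embeds_star:
  assumes "finite \<Gamma>" "\<Gamma> \<subseteq> D" "i \<in> D" "i \<notin> \<Gamma>" "card K \<le> card \<Gamma>"
    and "\<And>j. j \<in> \<Gamma> \<Longrightarrow> \<not> B i j" "\<not> B i i"
    and symB: "\<And>c d. B c d \<Longrightarrow> B d c"
  shows "embeds D B"
proof -
  obtain g where g: "g ` K \<subseteq> \<Gamma>" "inj_on g K"
    using card_le_inj[OF fin(1) assms(1,5)] by blast
  show ?thesis
    unfolding embeds_def
  proof (intro exI[of _ "\<lambda>u. if u \<in> K then g u else i"] conjI ballI impI)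
    show "(\<lambda>u. if u \<in> K then g u else i) ` (K \<union> S) \<subseteq> D" using g assms by auto
  next
    fix u v assume uv: "u \<in> K \<union> S" "v \<in> K \<union> S" "u \<noteq> v"
      and eq: "(if u \<in> K then g u else i) = (if v \<in> K then g v else i)"
    have gK: "g w \<noteq> i" if "w \<in> K" for w using g(1) assms(4) that by blast
    show "\<not> adj u v"
    proof (cases "u \<in> K \<or> v \<in> K")
      case True
      then show ?thesis using uv eq gK inj_on_eq_iff[OF g(2)] by (auto split: if_splits)
    next
      case False
      then show ?thesis using uv S_nadj by blast
    qed
  next
    fix u v assume uv: "u \<in> K \<union> S" "v \<in> K \<union> S" "u \<noteq> v"
      and BB: "B (if u \<in> K then g u else i) (if v \<in> K then g v else i)"
    have gK: "\<not> B i (g w)" "\<not> B (g w) i" if "w \<in> K" for w using g(1) assms(6) symB that by blast+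
    show "adj u v"
    proof (cases "u \<in> K \<and> v \<in> K")
      case True
      then show ?thesis using uv K_adj by blast
    next
      case False
      then show ?thesis using BB gK assms(7) by (auto split: if_splits)
    qed
  qed
qed


section \<open>White clusters carrying weights\<close>

context
  fixes D :: "'c set" and B :: "'c \<Rightarrow> 'c \<Rightarrow> bool" and x :: "'c \<Rightarrow> real"
  assumes fD: "finite D" and x_pos: "\<And>i. i \<in> D \<Longrightarrow> x i > 0" and x_sum: "sum x D = 1"
    and symB: "\<And>c d. B c d \<Longrightarrow> B d c" and irrB: "\<And>c. \<not> B c c"
    and deg: "\<And>i. i \<in> D \<Longrightarrow> b * x i + a * (\<Sum>j | j \<in> D \<and> B i j. x j) < 1"
    and cS: "card S = a + 1"
begin

text \<open>The weighted black degree. The left side of the hypothesis \<open>deg\<close> is the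
  cost seen from cluster \<open>i\<close>: \<open>b\<close> for a pair inside a white cluster,
  \<open>a\<close> for a black pair. The bound is supplied by \<open>quad_core\<close>.\<close>

definition "bdeg i = (\<Sum>j | j \<in> D \<and> B i j. x j)"
definition "gray i = {j \<in> D. j \<noteq> i \<and> \<not> B i j}"

lemma D_ne: "D \<noteq> {}" using x_sum by auto

lemma deg': "i \<in> D \<Longrightarrow> b * x i + a * bdeg i < 1"
  using deg by (simp add: bdeg_def)

lemma fin_gray: "finite (gray i)" using fD by (simp add: gray_def)

lemma sum_gray: "i \<in> D \<Longrightarrow> sum x (gray i) = 1 - x i - bdeg i"
proof -
  assume i: "i \<in> D"
  have D: "D = insert i (gray i \<union> {j \<in> D. B i j})" using i irrB by (auto simp: gray_def)
  have "sum x D = x i + sum x (gray i \<union> {j \<in> D. B i j})"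
    by (subst D, subst sum.insert) (use fD irrB in \<open>auto simp: gray_def\<close>)
  also have "sum x (gray i \<union> {j \<in> D. B i j}) = sum x (gray i) + bdeg i"
    unfolding bdeg_def by (rule sum.union_disjoint) (use fD in \<open>auto simp: gray_def\<close>)
  finally show ?thesis using x_sum by simp
qed

lemma bdeg_nonneg: "bdeg i \<ge> 0"
  unfolding bdeg_def using x_pos by (intro sum_nonneg) (auto intro: less_imp_le)

text \<open>Greedy choice. As \<open>b \<le> a\<close>, a cluster and its black neighbours together
  weigh less than \<open>1 / b\<close>. At most \<open>b\<close> such sets cannot cover total weight
  1, so a gray clique with at most \<open>b\<close> members extends.\<close>

lemma gray_clique:
  assumes "b \<le> a" "n \<le> b + 1"
  shows "\<exists>C\<subseteq>D. card C = n \<and> (\<forall>c\<in>C. \<forall>d\<in>C. \<not> B c d)"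
  using assms(2)
proof (induction n)
  case 0
  then show ?case by (intro exI[of _ "{}"]) auto
next
  case (Suc n)
  then obtain C where C: "C \<subseteq> D" "card C = n" "\<forall>c\<in>C. \<forall>d\<in>C. \<not> B c d" by auto
  have fC: "finite C" using C fD finite_subset by blast
  have "\<exists>d\<in>D. \<forall>c\<in>C. d \<noteq> c \<and> \<not> B c d"
  proof (rule ccontr)
    assume neg: "\<not> ?thesis"
    then have Cne: "C \<noteq> {}" using D_ne by auto
    have "1 = (\<Sum>j\<in>D. x j)" using x_sum by simp
    also have "\<dots> \<le> (\<Sum>j\<in>D. \<Sum>c\<in>C. if j = c \<or> B c j then x j else 0)"
    proof (rule sum_mono)
      fix j assume j: "j \<in> D"
      then obtain c where c: "c \<in> C" "j = c \<or> B c j" using neg by blast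
      have "x j = (if j = c \<or> B c j then x j else 0)" using c by simp
      also have "\<dots> \<le> (\<Sum>c\<in>C. if j = c \<or> B c j then x j else 0)"
        by (rule member_le_sum) (use c fC x_pos j in \<open>auto intro: less_imp_le\<close>)
      finally show "x j \<le> (\<Sum>c\<in>C. if j = c \<or> B c j then x j else 0)" .
    qed
    also have "\<dots> = (\<Sum>c\<in>C. \<Sum>j\<in>D. if j = c \<or> B c j then x j else 0)"
      by (rule sum.swap)
    also have "\<dots> = (\<Sum>c\<in>C. x c + bdeg c)"
    proof (rule sum.cong[OF refl])
      fix c assume c: "c \<in> C"
      have "(\<Sum>j\<in>D. if j = c \<or> B c j then x j else 0) = sum x {j \<in> D. j = c \<or> B c j}"
        using fD by (simp add: sum.inter_filter)
      also have "{j \<in> D. j = c \<or> B c j} = insert c {j \<in> D. B c j}" using c C by auto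
      also have "sum x \<dots> = x c + bdeg c"
        unfolding bdeg_def using fD irrB by (subst sum.insert) auto
      finally show "(\<Sum>j\<in>D. if j = c \<or> B c j then x j else 0) = x c + bdeg c" .
    qed
    also have "\<dots> < (\<Sum>c\<in>C. 1 / b)"
    proof (rule sum_strict_mono)
      fix c assume c: "c \<in> C"
      then have "c \<in> D" using C by auto
      then have "b * x c + a * bdeg c < 1" by (rule deg')
      moreover have "b * bdeg c \<le> a * bdeg c" using assms(1) bdeg_nonneg by (intro mult_right_mono) auto
      ultimately have "b * (x c + bdeg c) < 1" by (simp add: algebra_simps)
      then show "x c + bdeg c < 1 / b" using pos by (simp add: field_simps)
    qed (use fC Cne in auto)
    also have "\<dots> \<le> 1" using C Suc.prems pos by (simp add: field_simps)
    finally show False by simp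
  qed
  then obtain d where d: "d \<in> D" "\<forall>c\<in>C. d \<noteq> c \<and> \<not> B c d" by blast
  show ?case
  proof (intro exI[of _ "insert d C"] conjI)
    show "card (insert d C) = Suc n" using d C fC by (subst card_insert_disjoint) auto
    show "\<forall>c\<in>insert d C. \<forall>e\<in>insert d C. \<not> B c e" using d C symB irrB by blast
  qed (use d C in auto)
qed

text \<open>A gray clique of \<open>b + 1\<close> clusters suffices. If \<open>K\<close> has
  \<open>b + 1\<close> vertices, it fills the clique and every \<open>s\<close> joins a
  nonneighbour; if \<open>K\<close> has \<open>b\<close>, one cluster is left over for
  \<open>S\<close>.\<close>

lemma embeds_low:
  assumes "b \<le> a" shows "embeds D B"
proof -
  obtain C where C: "C \<subseteq> D" "card C = b + 1" "\<forall>c\<in>C. \<forall>d\<in>C. \<not> B c d"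
    using gray_clique[OF assms order.refl] by blast
  have fC: "finite C" using C fD finite_subset by blast
  show ?thesis
  proof (cases "card K = b + 1")
    case True
    show ?thesis
      by (rule embeds_hitting[OF fC C(1), where U = C and T = K]) (use True C exists_nonneighbour symB in auto)
  next
    case False
    then have K: "card K = b" using card_K_le card_K_ge by simp
    obtain i where i: "i \<in> C" using C by fastforce
    show ?thesis
      by (rule embeds_star[of "C - {i}" _ i]) (use i K C fC symB irrB in auto)
  qed
qed


text \<open>When \<open>x i\<close> is maximal, the gray neighbours of \<open>i\<close> weigh at
  most \<open>x i\<close> each, so this bound forces at least \<open>b\<close> of them.\<close>

lemma gray_gt: "i \<in> D \<Longrightarrow> (real b - 1) * x i < sum x (gray i)"
proof -
  assume i: "i \<in> D"
  have "bdeg i \<le> a * bdeg i" using pos bdeg_nonneg[of i] by (simp add: mult_le_cancel_right1)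
  then show ?thesis using deg'[OF i] sum_gray[OF i] by (simp add: algebra_simps)
qed

text \<open>A vertex of largest weight with more than \<open>b\<close> gray neighbours is the centre of a gray star hosting
  all of \<open>S\<close>. In the two lemmas below it has exactly \<open>b\<close> of them, which leaves little weight for black
  pairs among these.\<close>

lemma embeds_two:
  assumes a1: "a = 1" and ab: "a < b" and cK: "card K = b + 1"
    and i: "i \<in> D" "\<And>j. j \<in> D \<Longrightarrow> x j \<le> x i" "card (gray i) = b"
  shows "embeds D B"
proof -
  have Gne: "gray i \<noteq> {}" using i(3) pos by auto
  \<comment> \<open>The heaviest gray neighbour \<open>j\<close> becomes the centre of a second gray
    star.\<close>
  obtain j where j: "j \<in> gray i" "\<And>k. k \<in> gray i \<Longrightarrow> x k \<le> x j"
    using finite_ex_maximizer[OF fin_gray Gne] by blast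
  have jD: "j \<in> D" "j \<noteq> i" "\<not> B i j" "\<not> B j i" using j symB by (auto simp: gray_def)
  have b2: "real b \<ge> 2" using ab a1 by simp
  have "sum x (gray i) \<le> real b * x j"
    using sum_bounded_above[of "gray i" x "x j"] j i(3) by simp
  then have 1: "(real b - 1) * x i < real b * x j" using gray_gt[OF i(1)] by linarith
  have "sum x (gray j) \<le> card (gray j) * x i"
    using sum_bounded_above[of "gray j" x "x i"] i(2) by (simp add: gray_def)
  then have 2: "(real b - 1) * x j < card (gray j) * x i" using gray_gt[OF jD(1)] by linarith
  \<comment> \<open>Since \<open>(b - 1)^2 = b * (b - 2) + 1\<close>, chaining the two estimates
    leaves at least \<open>b - 1\<close> gray neighbours of \<open>j\<close>.\<close>
  have "(real b - 1) * ((real b - 1) * x i) < (real b - 1) * (real b * x j)"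
    using 1 b2 by (intro mult_strict_left_mono) auto
  also have "\<dots> = real b * ((real b - 1) * x j)" by (simp add: algebra_simps)
  also have "\<dots> < real b * (card (gray j) * x i)" using 2 b2 by (intro mult_strict_left_mono) auto
  finally have "(real b - 1) * (real b - 1) * x i < real b * card (gray j) * x i" by (simp add: algebra_simps)
  then have "(real b - 1) * (real b - 1) < real b * card (gray j)"
    using x_pos[OF i(1)] by (simp add: mult_less_cancel_right)
  then have "real b * (real b - 2) < real b * card (gray j)" by (simp add: algebra_simps)
  then have "real b - 2 < card (gray j)" using b2 by (simp add: mult_less_cancel_left)
  then have tj: "card (gray j) \<ge> b - 1" by linarith
  have "card S = 2" using cS a1 by simp
  then obtain s1' s2' where S': "S = {s1', s2'}" "s1' \<noteq> s2'" by (meson card_2_iff)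
  define N where "N s = {k \<in> K. \<not> adj k s}" for s
  have "\<exists>s1 s2. S = {s1, s2} \<and> s1 \<noteq> s2 \<and> card (N s2) \<le> card (N s1)"
    using S' by (metis insert_commute linear)
  then obtain s1 s2 where S: "S = {s1, s2}" "s1 \<noteq> s2" "card (N s2) \<le> card (N s1)" by blast
  have fN: "finite (N s)" for s unfolding N_def using fin by simp
  \<comment> \<open>A common nonneighbour would form an independent set of size 3 with
    \<open>s1\<close> and \<open>s2\<close>, while \<open>a = 1\<close>. Disjointness makes the
    smaller set \<open>N s2\<close> fit into the star at \<open>j\<close>.\<close>
  have Ndisj: "N s1 \<inter> N s2 = {}"
  proof (rule ccontr)
    assume "\<not> ?thesis"
    then obtain k where k: "k \<in> K" "\<not> adj k s1" "\<not> adj k s2" by (auto simp: N_def)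
    have "card {k, s1, s2} \<le> a + 1"
      by (rule indep_le) (use k S sym S_nadj in auto)
    moreover have "k \<noteq> s1" "k \<noteq> s2" using k disj S by auto
    ultimately show False using S a1 by simp
  qed
  have "card (N s1) + card (N s2) = card (N s1 \<union> N s2)" using Ndisj fN by (simp add: card_Un_disjoint)
  also have "\<dots> \<le> card K" by (rule card_mono) (use fin in \<open>auto simp: N_def\<close>)
  finally have N2: "card (N s2) \<le> b - 1" using S(3) cK b2 by linarith
  obtain k1 where k1: "k1 \<in> N s1" using exists_nonneighbour[OF cK, of s1] S by (auto simp: N_def)
  obtain k2 where k2: "k2 \<in> N s2" using exists_nonneighbour[OF cK, of s2] S by (auto simp: N_def)
  have k12: "k1 \<noteq> k2" "k1 \<notin> N s2" "k2 \<notin> N s1" using k1 k2 Ndisj by auto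
  have cN2: "card (N s2 - {k2}) = card (N s2) - 1" using k2 fN by simp
  have "card (N s2 - {k2}) \<le> card (gray j - {i})"
  proof -
    have "i \<in> gray j" using i jD symB by (auto simp: gray_def)
    then have "card (gray j - {i}) = card (gray j) - 1" using fin_gray by simp
    then show ?thesis using cN2 N2 tj by linarith
  qed
  then obtain h where h: "h ` (N s2 - {k2}) \<subseteq> gray j - {i}" "inj_on h (N s2 - {k2})"
    using card_le_inj[of "N s2 - {k2}" "gray j - {i}"] fN fin_gray by auto
  \<comment> \<open>\<open>s1\<close> goes to \<open>i\<close> with \<open>k1\<close>, and
    \<open>s2\<close> to \<open>j\<close> with \<open>k2\<close>. The other nonneighbours of
    \<open>s2\<close> go to gray neighbours of \<open>j\<close>; they are adjacent to
    \<open>s1\<close>, so black pairs with \<open>i\<close> do no harm. The rest of \<open>K\<close>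
    goes to gray neighbours of \<open>i\<close> and is adjacent to \<open>s2\<close>.\<close>
  define T where "T = insert k1 (N s2)"
  define g0 where "g0 k = (if k = k1 then i else if k = k2 then j else h k)" for k
  define C where "C = insert i (insert j (gray i \<union> h ` (N s2 - {k2})))"
  have jg: "j \<notin> gray j" by (simp add: gray_def)
  have hij: "h k \<noteq> i" "h k \<noteq> j" "h k \<in> gray j" if "k \<in> N s2 - {k2}" for k
    using h(1) that jg by blast+
  have T: "T \<subseteq> K" "inj_on g0 T"
  proof -
    show "T \<subseteq> K" using k1 by (auto simp: T_def N_def)
    define X where "X = insert k2 (N s2 - {k2})"
    have "inj_on g0 X"
      using h(2) hij k12 by (auto simp: g0_def inj_on_def X_def)
    moreover have "\<forall>k\<in>X. g0 k \<noteq> i"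
      using hij jD k12 by (auto simp: g0_def X_def)
    moreover have "g0 k1 = i" by (simp add: g0_def)
    ultimately have "g0 k1 \<notin> g0 ` (X - {k1})" "inj_on g0 X" by (auto simp: image_iff)
    then have "inj_on g0 (insert k1 X)" by (simp add: inj_on_insert)
    moreover have "T = insert k1 X" using k2 by (auto simp: T_def X_def)
    ultimately show "inj_on g0 T" by simp
  qed
  have g0T: "g0 ` T = insert i (insert j (h ` (N s2 - {k2})))"
  proof -
    have "T = insert k1 (insert k2 (N s2 - {k2}))" using k2 by (auto simp: T_def)
    moreover have "g0 ` (N s2 - {k2}) = h ` (N s2 - {k2})"
      by (rule image_cong[OF refl]) (use k12 in \<open>auto simp: g0_def\<close>)
    moreover have "g0 k1 = i" "g0 k2 = j" using k12 by (auto simp: g0_def)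
    ultimately show ?thesis by (simp only: image_insert)
  qed
  have fC: "finite C" unfolding C_def using fin_gray fN by simp
  have "card (g0 ` T) = card (N s2) + 1"
    using T(2) k12 fN by (simp add: card_image T_def)
  moreover have "card T = card (N s2) + 1" using k12 fN by (simp add: T_def)
  moreover have "card (C - g0 ` T) = card (gray i - {j} - h ` (N s2 - {k2}))"
    unfolding C_def g0T by (rule arg_cong[of _ _ card]) (auto simp: gray_def)
  moreover have "card (gray i - {j} - h ` (N s2 - {k2})) \<ge> card (gray i - {j}) - card (h ` (N s2 - {k2}))"
    using fN by (intro diff_card_le_card_Diff) auto
  moreover have "card (h ` (N s2 - {k2})) = card (N s2) - 1" using h cN2 by (simp add: card_image)
  moreover have "card (gray i - {j}) = b - 1" using j i fin_gray by simp
  moreover have "card (K - T) = card K - card T" using T fin finite_subset by (metis card_Diff_subset)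
  moreover have "card (N s2) \<ge> 1" using k2 fN by (metis One_nat_def Suc_leI card_gt_0_iff empty_iff)
  ultimately have "card (K - T) \<le> card (C - g0 ` T)" using cK by linarith
  then obtain g where g: "inj_on g K" "\<And>t. t \<in> T \<Longrightarrow> g t = g0 t" "g ` (K - T) \<subseteq> C - g0 ` T"
    using inj_on_extend[OF fin(1) fC T] by blast
  have gk: "g k1 = i" "g k2 = j" using g(2) k2 k12 by (auto simp: T_def g0_def)
  have rest: "g k \<in> gray i" if "k \<in> K - T" for k
    using g(3) that unfolding g0T C_def by blast
  have N2': "g k \<in> gray j" if "k \<in> N s2 - {k2}" for k
    using that g(2)[of k] hij[OF that] k12 by (auto simp: T_def g0_def)
  have CD: "C \<subseteq> D" unfolding C_def using i jD h by (auto simp: gray_def)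
  have g0C: "g0 ` T \<subseteq> C" unfolding g0T C_def by auto
  show ?thesis
  proof (rule embeds_via[OF g(1), where \<kappa> = "\<lambda>s. if s = s1 then k1 else k2"])
    have "g k \<in> C" if "k \<in> K" for k
    proof (cases "k \<in> T")
      case True then show ?thesis using g(2) g0C by auto
    next
      case False then show ?thesis using g(3) that by blast
    qed
    then show "g ` K \<subseteq> D" using CD by blast
  next
    fix s assume "s \<in> S"
    then show "(if s = s1 then k1 else k2) \<in> K \<and> \<not> adj (if s = s1 then k1 else k2) s"
      using S k1 k2 by (auto simp: N_def)
  next
    fix s s' assume "s \<in> S" "s' \<in> S"
    then show "\<not> B (g (if s = s1 then k1 else k2)) (g (if s' = s1 then k1 else k2))"
      using gk jD irrB by auto
  next
    fix s k assume s: "s \<in> S" and k: "k \<in> K" and BB: "B (g (if s = s1 then k1 else k2)) (g k)"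
    consider "k = k1" | "k = k2" | "k \<in> N s2 - {k2}" | "k \<in> K - T" using k by (auto simp: T_def)
    then show "adj k s"
    proof cases
      case 1 then show ?thesis using BB gk jD irrB by (auto split: if_splits)
    next
      case 2 then show ?thesis using BB gk jD irrB by (auto split: if_splits)
    next
      case 3
      then have "s = s1" using BB N2'[OF 3] gk by (auto simp: gray_def split: if_splits)
      then show ?thesis using 3 Ndisj k by (auto simp: N_def)
    next
      case 4
      then have "s \<noteq> s1" using BB rest[OF 4] gk by (auto simp: gray_def split: if_splits)
      then show ?thesis using 4 s S by (auto simp: N_def T_def)
    qed
  qed (use symB in auto)
qed


text \<open>The cluster \<open>i\<close> and its gray neighbours are exactly \<open>b + 1\<close>
  clusters, and only those in \<open>Q\<close> lie in black pairs among them. If \<open>Q\<close> is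
  small, all of \<open>S\<close> can be attached outside it. The estimate \<open>key\<close> leaves
  one exceptional case, \<open>b = a + 1\<close> with a single black pair.\<close>

lemma embeds_many:
  assumes a2: "a \<ge> 2" and ab: "a < b" and cK: "card K = b + 1"
    and i: "i \<in> D" "\<And>j. j \<in> D \<Longrightarrow> x j \<le> x i" "card (gray i) = b"
  shows "embeds D B"
proof -
  define X where "X = x i"
  define e where "e = 1 - b * X"
  define Q where "Q = {j \<in> gray i. \<exists>j'\<in>gray i. B j j'}"
  define C where "C = insert i (gray i)"
  define q where "q = card Q"
  have fQ: "finite Q" and QG: "Q \<subseteq> gray i" using fin_gray by (auto simp: Q_def)
  have fC: "finite C" "card C = b + 1" "C \<subseteq> D"
    using fin_gray i by (auto simp: C_def gray_def)
  have noB: "\<not> B c d" if "c \<in> C - Q" "d \<in> C" for c d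
    using that symB irrB unfolding C_def Q_def by (auto simp: gray_def)
  have cCQ: "card (C - Q) = b + 1 - q"
    using fQ QG fC by (subst card_Diff_subset) (auto simp: C_def q_def)
  have nbr: "\<exists>k\<in>K. \<not> adj k s" if "s \<in> S" for s
    using exists_nonneighbour[OF cK that] .
  then obtain \<kappa> where \<kappa>: "\<And>s. s \<in> S \<Longrightarrow> \<kappa> s \<in> K \<and> \<not> adj (\<kappa> s) s" by metis
  \<comment> \<open>\<open>\<Delta>\<close> measures how far the weights on \<open>Q\<close> fall
    short of the maximum \<open>X\<close>. The total weight of \<open>gray i\<close> bounds it from
    above. It is bounded from below because every member of \<open>Q\<close> has a black partner in
    \<open>Q\<close>, and a large black degree forces a small weight. For
    \<open>q * a \<ge> a + b\<close> the bounds clash as soon as \<open>a \<ge> 2\<close>.\<close>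
  have key: "q = 0 \<or> q * a < a + b"
  proof (rule ccontr)
    assume "\<not> ?thesis"
    then have q: "q > 0" "q * a \<ge> a + b" by auto
    define \<Delta> where "\<Delta> = (\<Sum>j\<in>Q. X - x j)"
    have "a * bdeg i < e" using deg'[OF i(1)] by (simp add: e_def X_def)
    then have bi: "bdeg i < e / a" using pos by (simp add: field_simps)
    have "\<Delta> \<le> (\<Sum>j\<in>gray i. X - x j)"
      unfolding \<Delta>_def by (rule sum_mono2) (use fin_gray QG i(2) in \<open>auto simp: gray_def X_def\<close>)
    also have "\<dots> = b * X - sum x (gray i)" by (simp add: sum_subtractf i(3))
    also have "\<dots> < X - e * (1 - 1 / a)"
      using bi pos unfolding sum_gray[OF i(1)] e_def X_def by (simp add: field_simps)
    finally have D1: "\<Delta> < X - e * (1 - 1 / a)" .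
    have D0: "\<Delta> \<ge> 0" unfolding \<Delta>_def
      by (rule sum_nonneg) (use QG i(2) in \<open>auto simp: gray_def X_def\<close>)
    have "(\<Sum>j\<in>Q. x j) \<le> (\<Sum>j'\<in>Q. \<Sum>j\<in>Q. if B j j' then x j' else 0)"
    proof (rule sum_mono)
      fix j' assume j': "j' \<in> Q"
      then obtain j where j: "j \<in> gray i" "B j' j" by (auto simp: Q_def)
      then have jQ: "j \<in> Q" using j' symB by (auto simp: Q_def)
      have "x j' = (if B j j' then x j' else 0)" using symB j by auto
      also have "\<dots> \<le> (\<Sum>j\<in>Q. if B j j' then x j' else 0)"
        by (rule member_le_sum) (use jQ j' fQ QG x_pos in \<open>auto simp: gray_def intro: less_imp_le\<close>)
      finally show "x j' \<le> (\<Sum>j\<in>Q. if B j j' then x j' else 0)" .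
    qed
    also have "\<dots> = (\<Sum>j\<in>Q. \<Sum>j'\<in>Q. if B j j' then x j' else 0)" by (rule sum.swap)
    also have "\<dots> \<le> (\<Sum>j\<in>Q. bdeg j)"
    proof (rule sum_mono)
      fix j assume "j \<in> Q"
      have "(\<Sum>j'\<in>Q. if B j j' then x j' else 0) = sum x {j' \<in> Q. B j j'}"
        using fQ by (simp add: sum.inter_filter)
      also have "\<dots> \<le> bdeg j"
        unfolding bdeg_def by (rule sum_mono2) (use fD QG x_pos in \<open>auto simp: gray_def intro: less_imp_le\<close>)
      finally show "(\<Sum>j'\<in>Q. if B j j' then x j' else 0) \<le> bdeg j" .
    qed
    also have "\<dots> < (\<Sum>j\<in>Q. (e + b * (X - x j)) / a)"
    proof (rule sum_strict_mono)
      fix j assume "j \<in> Q"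
      then have "j \<in> D" using QG by (auto simp: gray_def)
      from deg'[OF this] show "bdeg j < (e + b * (X - x j)) / a"
        using pos by (simp add: field_simps e_def)
    qed (use fQ q in \<open>auto simp: q_def\<close>)
    also have "\<dots> = (q * e + b * \<Delta>) / a"
      by (simp add: sum_divide_distrib[symmetric] sum.distrib sum_distrib_left q_def \<Delta>_def)
    also have "(\<Sum>j\<in>Q. x j) = q * X - \<Delta>" by (simp add: \<Delta>_def sum_subtractf q_def)
    finally have "a * (q * X - \<Delta>) < q * e + b * \<Delta>" using pos by (simp add: field_simps)
    then have "q * (a * X - e) < real (a + b) * \<Delta>" by (simp add: algebra_simps)
    also have "\<dots> \<le> real (q * a) * (X - e * (1 - 1 / a))"
    proof (rule mult_mono)
      show "real (a + b) \<le> real (q * a)" using q(2) by (simp only: of_nat_le_iff)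
    qed (use D0 D1 in auto)
    also have "\<dots> = q * (a * X - e * (a - 1))" using pos by (simp add: field_simps)
    finally have "q * (a * X - e) < real q * (a * X - e * (a - 1))" .
    then have "a * X - e < a * X - e * (real a - 1)" using q pos by (simp add: of_nat_diff)
    then have "e * (real a - 2) < 0" by (simp add: algebra_simps)
    moreover have "e > 0" using \<open>a * bdeg i < e\<close> bdeg_nonneg[of i] by (smt (verit) mult_nonneg_nonneg of_nat_0_le_iff)
    ultimately show False using a2 by (simp add: mult_less_0_iff)
  qed
  show ?thesis
  proof (cases "q \<le> b - a")
    case True
    show ?thesis
    proof (rule embeds_hitting[OF fC(1,3), where U = "C - Q" and T = "\<kappa> ` S"])
      show "card (\<kappa> ` S) \<le> card (C - Q)"
        using card_image_le[OF fin(2), of \<kappa>] cS cCQ True ab by simp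
    qed (use fC cK \<kappa> noB symB in auto)
  next
    case False
    then have q: "q \<ge> b - a + 1" "q * a < a + b" using key by auto
    \<comment> \<open>The two bounds on \<open>q\<close> give \<open>c * a < a + c\<close>, that is
      \<open>(c - 1) * (a - 1) < 1\<close>, which leaves only \<open>c = 1\<close>.\<close>
    obtain c where c: "b = a + c" using ab less_imp_add_positive by (metis le_add_diff_inverse less_imp_le)
    have "(c + 1) * a \<le> q * a" using q c by (intro mult_right_mono) auto
    then have "c * a < a + c" using q(2) c by (simp add: algebra_simps)
    have "c = 1"
    proof (rule ccontr)
      assume "c \<noteq> 1"
      then obtain c' a' where "c = c' + 2" "a = a' + 2" using ab c a2 by (metis Suc_1 Suc_leI add.commute add_0_right le_Suc_ex less_add_same_cancel1 nat_neq_iff not_less_eq One_nat_def less_one)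
      then show False using \<open>c * a < a + c\<close> by simp
    qed
    then have ba: "b = a + 1" using c by simp
    have "q * a < 3 * a" using q(2) ba a2 by linarith
    then have "q < 3" by (rule mult_less_cancel2[THEN iffD1, THEN conjunct2])
    then have "q = 2" using q(1) ba by simp
    then obtain j j' where Q: "Q = {j, j'}" "j \<noteq> j'" unfolding q_def by (meson card_2_iff)
    \<comment> \<open>Outside \<open>Q\<close> there is one cluster fewer than there are vertices in
      \<open>S\<close>. A common nonneighbour of two of these vertices saves a cluster.\<close>
    have cU: "card (C - Q) = a" using cCQ \<open>q = 2\<close> ba by simp
    show ?thesis
    proof (cases "\<exists>s1\<in>S. \<exists>s2\<in>S. s1 \<noteq> s2 \<and> (\<exists>k\<in>K. \<not> adj k s1 \<and> \<not> adj k s2)")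
      case True
      then obtain s1 s2 k where s: "s1 \<in> S" "s2 \<in> S" "s1 \<noteq> s2" "k \<in> K" "\<not> adj k s1" "\<not> adj k s2" by blast
      show ?thesis
      proof (rule embeds_hitting[OF fC(1,3), where U = "C - Q" and T = "insert k (\<kappa> ` (S - {s1, s2}))"])
        have "card (S - {s1, s2}) = a - 1" using s cS fin by (subst card_Diff_subset) auto
        then have "card (\<kappa> ` (S - {s1, s2})) \<le> a - 1" using card_image_le[of "S - {s1, s2}" \<kappa>] fin by simp
        then have "card (insert k (\<kappa> ` (S - {s1, s2}))) \<le> a"
          using card_insert_le_m1[of a "\<kappa> ` (S - {s1, s2})" k] a2 by simp
        then show "card (insert k (\<kappa> ` (S - {s1, s2}))) \<le> card (C - Q)" using cU by simp
        show "\<exists>l\<in>insert k (\<kappa> ` (S - {s1, s2})). \<not> adj l s" if "s \<in> S" for s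
          using \<kappa>[OF that] s that by (cases "s = s1 \<or> s = s2") auto
      qed (use fC cK \<kappa> noB symB s in auto)
    next
      case False
      then have dj: "s1 = s2" if "s1 \<in> S" "s2 \<in> S" "k \<in> K" "\<not> adj k s1" "\<not> adj k s2" for s1 s2 k
        using that by blast
      have inj: "inj_on \<kappa> S" using dj \<kappa> by (intro inj_onI) metis
      have c\<kappa>: "card (\<kappa> ` S) = a + 1" using inj cS by (simp add: card_image)
      then have "\<not> K \<subseteq> \<kappa> ` S" using cK ba card_mono[of "\<kappa> ` S" K] fin by auto
      then obtain k' where k': "k' \<in> K" "k' \<notin> \<kappa> ` S" by blast
      obtain s1 s2 where s12: "s1 \<in> S" "s2 \<in> S" "s1 \<noteq> s2"
        using cS a2 by (metis One_nat_def Suc_eq_plus1 Suc_le_mono add_leE card_le_Suc0_iff_eq fin(2) not_less_eq_eq numeral_2_eq_2)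
      then obtain t where t: "t \<in> S" "adj k' t" using dj k' by blast
      \<comment> \<open>The spare vertex \<open>k'\<close> and \<open>\<kappa> t\<close> take the
        two ends of the black pair. The only vertex of \<open>S\<close> that sees this pair is
        \<open>t\<close>, which is adjacent to \<open>k'\<close>.\<close>
      define T where "T = {\<kappa> t, k'}"
      define g0 where "g0 k = (if k = k' then j' else j)" for k
      have kt: "\<kappa> t \<noteq> k'" "\<kappa> t \<in> K" using k' t \<kappa> by auto
      have T: "T \<subseteq> K" "inj_on g0 T" "g0 ` T = Q" using kt k' Q by (auto simp: T_def g0_def inj_on_def)
      have "card (K - T) = a" using kt k' cK ba fin by (subst card_Diff_subset) (auto simp: T_def)
      then have "card (K - T) \<le> card (C - g0 ` T)" using T cU by simp
      then obtain g where g: "inj_on g K" "\<And>t. t \<in> T \<Longrightarrow> g t = g0 t" "g ` (K - T) \<subseteq> C - Q"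
        using inj_on_extend[OF fin(1) fC(1) T(1,2)] T(3) by metis
      have gk: "g (\<kappa> t) = j" "g k' = j'" using g(2) kt by (auto simp: T_def g0_def)
      have QC: "Q \<subseteq> C" using QG by (auto simp: C_def)
      have gC: "g k \<in> C" if "k \<in> K" for k
        using g(3) gk QC Q that by (cases "k \<in> T") (auto simp: T_def)
      have gU: "g (\<kappa> s) \<in> C - Q" if "s \<in> S" "s \<noteq> t" for s
      proof -
        have "\<kappa> s \<in> K - T" using that k' \<kappa>[OF that(1)] inj t by (auto simp: T_def dest: inj_onD)
        then show ?thesis using g(3) by blast
      qed
      show ?thesis
      proof (rule embeds_via[OF g(1)])
        show "g ` K \<subseteq> D" using gC fC by blast
        show "\<And>s. s \<in> S \<Longrightarrow> \<kappa> s \<in> K \<and> \<not> adj (\<kappa> s) s" using \<kappa> by blast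
        show "\<not> B (g (\<kappa> s)) (g (\<kappa> s'))" if "s \<in> S" "s' \<in> S" for s s'
          using gU[of s] gU[of s'] gC \<kappa> that noB symB irrB by (metis (no_types))
        show "adj k s" if "s \<in> S" "k \<in> K" and BB: "B (g (\<kappa> s)) (g k)" for s k
        proof -
          have st: "s = t" using noB[OF gU[OF that(1)] gC[OF that(2)]] BB by blast
          have "g k \<in> Q" using noB[of "g k" "g (\<kappa> s)"] gC \<kappa> that symB by blast
          then have "g k = j'" using BB st gk Q irrB by auto
          then have "k = k'" using g(1) gk k' that by (metis inj_onD)
          then show ?thesis using t st by simp
        qed
      qed (use symB in auto)
    qed
  qed
qed

lemma embeds_weighted: "embeds D B"
proof (cases "b \<le> a")
  case True
  then show ?thesis by (rule embeds_low)
next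
  case False
  then have ab: "a < b" by simp
  obtain i where i: "i \<in> D" "\<And>j. j \<in> D \<Longrightarrow> x j \<le> x i"
    using finite_ex_maximizer[OF fD D_ne] by blast
  show ?thesis
  proof (cases "card K \<le> card (gray i)")
    case True
    show ?thesis
      by (rule embeds_star[of "gray i" _ i]) (use True i fin_gray symB irrB in \<open>auto simp: gray_def\<close>)
  next
    case False
    have "sum x (gray i) \<le> card (gray i) * x i"
      using sum_bounded_above[of "gray i" x "x i"] i(2) by (simp add: gray_def)
    then have "(real b - 1) * x i < card (gray i) * x i" using gray_gt[OF i(1)] by linarith
    then have "real b - 1 < card (gray i)" using x_pos[OF i(1)] by (simp add: mult_less_cancel_right)
    then have "card (gray i) = b" "card K = b + 1" using False card_K_le by linarith+
    then show ?thesis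
      using embeds_two[OF _ ab _ i] embeds_many[OF _ ab _ i] pos by (cases "a = 1") auto
  qed
qed

end

end

section \<open>Cheap coloured patterns of clusters\<close>

definition quad :: "'c set \<Rightarrow> ('c \<Rightarrow> 'c \<Rightarrow> real) \<Rightarrow> ('c \<Rightarrow> real) \<Rightarrow> real" where
  "quad D M x = (\<Sum>i\<in>D. \<Sum>j\<in>D. M i j * x i * x j)"

text \<open>Weights vanish outside \<open>D\<close>, which makes the set compact in the product
  topology on all functions; free coordinates would be unbounded.\<close>

definition prob_simplex :: "'c set \<Rightarrow> ('c \<Rightarrow> real) set" where
  "prob_simplex D = {x. (\<forall>i\<in>D. x i \<ge> 0) \<and> (\<forall>i. i \<notin> D \<longrightarrow> x i = 0) \<and> sum x D = 1}"

lemma quad_perturb: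
  assumes D: "finite D" "u \<in> D" "v \<in> D" "u \<noteq> v" and sym: "\<And>i j. M i j = M j i"
  shows "quad D M (\<lambda>i. x i + s * (of_bool (i = u) - of_bool (i = v))) =
    quad D M x + 2 * s * ((\<Sum>j\<in>D. M u j * x j) - (\<Sum>j\<in>D. M v j * x j))
    + s\<^sup>2 * (M u u + M v v - 2 * M u v)"
proof -
  define d :: "'a \<Rightarrow> real" where "d i = of_bool (i = u) - of_bool (i = v)" for i
  have dl: "(\<Sum>i\<in>D. d i * f i) = f u - f v" for f :: "'a \<Rightarrow> real"
  proof -
    have "(\<Sum>i\<in>D. d i * f i) = (\<Sum>i\<in>D. if i = u then f i else 0) - (\<Sum>i\<in>D. if i = v then f i else 0)"
      unfolding sum_subtractf[symmetric] by (rule sum.cong) (auto simp: d_def)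
    then show ?thesis using D by simp
  qed
  have "M i j * (x i + s * d i) * (x j + s * d j) = M i j * x i * x j + s * (d i * (M i j * x j))
      + s * (d j * (M i j * x i)) + s\<^sup>2 * (d i * (d j * M i j))" for i j
    by (simp add: algebra_simps power2_eq_square)
  then have "quad D M (\<lambda>i. x i + s * d i) =
     quad D M x + s * (\<Sum>i\<in>D. d i * (\<Sum>j\<in>D. M i j * x j)) + s * (\<Sum>i\<in>D. \<Sum>j\<in>D. d j * (M i j * x i))
      + s\<^sup>2 * (\<Sum>i\<in>D. d i * (\<Sum>j\<in>D. d j * M i j))"
    by (simp only: quad_def sum_distrib_left sum.distrib)
  also have "(\<Sum>i\<in>D. \<Sum>j\<in>D. d j * (M i j * x i)) = (\<Sum>j\<in>D. d j * (\<Sum>i\<in>D. M i j * x i))"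
    by (subst sum.swap) (simp add: sum_distrib_left)
  also have "\<dots> = (\<Sum>j\<in>D. d j * (\<Sum>i\<in>D. M j i * x i))" by (intro sum.cong arg_cong2[of _ _ _ _ "(*)"] refl sym)
  finally have "quad D M (\<lambda>i. x i + s * d i) = quad D M x + 2 * s * ((\<Sum>j\<in>D. M u j * x j) - (\<Sum>j\<in>D. M v j * x j))
    + s\<^sup>2 * (M u u + M v v - 2 * M u v)"
    unfolding dl sym[of v u] by (simp add: algebra_simps)
  then show ?thesis unfolding d_def .
qed

text \<open>The first order condition at a minimum: for small \<open>s\<close> the linear term would
  dominate and take either sign.\<close>

lemma quadratic_nonneg_imp_zero:
  fixes c m \<epsilon> :: real
  assumes "\<epsilon> > 0" "\<And>s. \<bar>s\<bar> \<le> \<epsilon> \<Longrightarrow> 2 * s * c + s\<^sup>2 * m \<ge> 0"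
  shows "c = 0"
proof (rule ccontr)
  assume c: "c \<noteq> 0"
  define t where "t = min \<epsilon> (\<bar>c\<bar> / (\<bar>m\<bar> + 1))"
  have t: "t > 0" "t \<le> \<epsilon>" "t * (\<bar>m\<bar> + 1) \<le> \<bar>c\<bar>"
  proof -
    have "t \<le> \<bar>c\<bar> / (\<bar>m\<bar> + 1)" by (simp add: t_def)
    then show "t * (\<bar>m\<bar> + 1) \<le> \<bar>c\<bar>" by (subst (asm) pos_le_divide_eq) auto
    have "\<bar>c\<bar> / (\<bar>m\<bar> + 1) > 0" using c by (intro divide_pos_pos) auto
    then show "t > 0" using assms(1) by (simp add: t_def)
  qed (simp add: t_def)
  have "2 * (- sgn c * t) * c + (- sgn c * t)\<^sup>2 * m \<ge> 0"
    by (rule assms(2)) (use t in \<open>simp add: abs_mult abs_sgn_eq\<close>)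
  moreover have "2 * (- sgn c * t) * c = - (t * (2 * \<bar>c\<bar>))" by (simp add: abs_sgn)
  moreover have "(sgn c)\<^sup>2 = 1" using c by (simp add: sgn_if power2_eq_square)
  then have "(- sgn c * t)\<^sup>2 * m = t * (t * m)" by (simp add: power_mult_distrib power2_eq_square)
  ultimately have "t * (2 * \<bar>c\<bar>) \<le> t * (t * m)" by linarith
  then have "2 * \<bar>c\<bar> \<le> t * m" using t by simp
  also have "\<dots> \<le> t * (\<bar>m\<bar> + 1)" using t by (intro mult_left_mono) auto
  finally show False using t c by linarith
qed

lemma compact_prob_simplex:
  assumes "finite D"
  shows "compact (prob_simplex D)"
proof -
  let ?P = "PiE UNIV (\<lambda>i. if i \<in> D then {0..1::real} else {0})"
  have "compactin (product_topology (\<lambda>i. euclidean) UNIV) ?P"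
    by (subst compactin_PiE) auto
  then have "compact ?P" by (simp add: euclidean_product_topology)
  moreover have "closed {x::'a \<Rightarrow> real. sum x D = 1}"
    by (intro closed_Collect_eq continuous_intros continuous_on_product_coordinates)
  ultimately have "compact (?P \<inter> {x. sum x D = 1})" by (rule compact_Int_closed)
  also have "?P \<inter> {x. sum x D = 1} = prob_simplex D"
  proof -
    have "x i \<le> 1" if "\<And>i. i \<in> D \<Longrightarrow> x i \<ge> 0" "sum x D = 1" "i \<in> D" for x :: "'a \<Rightarrow> real" and i
      using member_le_sum[of i D x] that assms by auto
    then show ?thesis
      unfolding prob_simplex_def by (auto simp: PiE_iff split: if_splits)
  qed
  finally show ?thesis .
qed

text \<open>Minimize over the smallest support on which the form takes a value below 1: the gradient is then
  constant, and moving weight between two points must strictly increase the form.\<close>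

lemma quad_core:
  assumes fD: "finite D" and sym: "\<And>i j. M i j = M j i"
    and ex: "x \<in> prob_simplex D" "quad D M x < 1"
  shows "\<exists>D'\<subseteq>D. \<exists>y. (\<forall>i\<in>D'. y i > 0) \<and> sum y D' = 1 \<and>
    (\<forall>i\<in>D'. (\<Sum>j\<in>D'. M i j * y j) < 1) \<and>
    (\<forall>u\<in>D'. \<forall>v\<in>D'. u \<noteq> v \<longrightarrow> 2 * M u v < M u u + M v v)"
proof -
  define P where "P E \<longleftrightarrow> E \<subseteq> D \<and> (\<exists>y\<in>prob_simplex E. quad E M y < 1)" for E
  have "P D" using ex by (auto simp: P_def)
  then obtain E where E: "P E" "\<And>F. P F \<Longrightarrow> card E \<le> card F"
    using ex_has_least_nat[of P D card] by blast
  have ED: "E \<subseteq> D" and fE: "finite E" using E fD finite_subset by (auto simp: P_def)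
  obtain z where z: "z \<in> prob_simplex E" "quad E M z < 1" using E by (auto simp: P_def)
  have "continuous_on (prob_simplex E) (quad E M)"
    unfolding quad_def by (intro continuous_intros continuous_on_product_coordinates continuous_on_subset[OF _ subset_UNIV])
  then obtain y where y: "y \<in> prob_simplex E" "\<And>w. w \<in> prob_simplex E \<Longrightarrow> quad E M y \<le> quad E M w"
    using continuous_attains_inf[OF compact_prob_simplex[OF fE], of "quad E M"] z by blast
  have lt: "quad E M y < 1" using y(2)[OF z(1)] z(2) by linarith
  \<comment> \<open>Minimality of the support enters here: a value below 1 with weight 0 at
    \<open>v\<close> would survive the removal of \<open>v\<close>.\<close>
  have drop: False if "v \<in> E" "w \<in> prob_simplex E" "w v = 0" "quad E M w < 1" for v w
  proof -
    have "sum w (E - {v}) = sum w E" by (rule sum.mono_neutral_left) (use fE that in auto)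
    then have "w \<in> prob_simplex (E - {v})" using that by (auto simp: prob_simplex_def split: if_splits)
    moreover have "quad (E - {v}) M w = quad E M w"
      unfolding quad_def
      by (rule sum.mono_neutral_cong_left[OF fE] sum.mono_neutral_left[OF fE])+
         (use that in \<open>auto intro!: sum.mono_neutral_left fE\<close>)
    ultimately have "\<exists>w\<in>prob_simplex (E - {v}). quad (E - {v}) M w < 1" using that(4) by metis
    then have "P (E - {v})" using ED by (auto simp: P_def)
    from E(2)[OF this] that(1) fE show False using card_Diff1_less[OF fE that(1)] by simp
  qed
  have ypos: "y i > 0" if "i \<in> E" for i
  proof -
    have "y i \<ge> 0" using y that by (auto simp: prob_simplex_def split: if_splits)
    moreover have "y i \<noteq> 0" using drop[OF that y(1) _ lt] by blast
    ultimately show ?thesis by simp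
  qed
  define pert where "pert u v s = (\<lambda>i. y i + s * (of_bool (i = u) - of_bool (i = v)))" for u v s
  have pert: "pert u v s \<in> prob_simplex E"
    if "u \<in> E" "v \<in> E" "u \<noteq> v" "- y u \<le> s" "s \<le> y v" for u v s
  proof -
    have "sum (pert u v s) E = sum y E + s * ((\<Sum>i\<in>E. of_bool (i = u)) - (\<Sum>i\<in>E. of_bool (i = v)))"
      by (simp add: pert_def sum.distrib sum_distrib_left sum_subtractf algebra_simps)
    also have "\<dots> = 1" using that fE y by (simp add: prob_simplex_def)
    finally show ?thesis
      using y that by (auto simp: prob_simplex_def pert_def of_bool_def)
  qed
  have eq: "(\<Sum>j\<in>E. M u j * y j) = (\<Sum>j\<in>E. M v j * y j)"
    if uv: "u \<in> E" "v \<in> E" "u \<noteq> v" for u v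
  proof -
    have "(\<Sum>j\<in>E. M u j * y j) - (\<Sum>j\<in>E. M v j * y j) = 0"
    proof (rule quadratic_nonneg_imp_zero)
      show "min (y u) (y v) > 0" using ypos uv by simp
      show "2 * s * ((\<Sum>j\<in>E. M u j * y j) - (\<Sum>j\<in>E. M v j * y j)) + s\<^sup>2 * (M u u + M v v - 2 * M u v) \<ge> 0"
        if "\<bar>s\<bar> \<le> min (y u) (y v)" for s
        using y(2)[OF pert[OF uv, of s]] that
        unfolding pert_def quad_perturb[OF fE uv sym] by linarith
    qed
    then show ?thesis by simp
  qed
  have Ene: "E \<noteq> {}" using y by (auto simp: prob_simplex_def)
  have lt1: "(\<Sum>j\<in>E. M i j * y j) < 1" if i: "i \<in> E" for i
  proof -
    \<comment> \<open>By \<open>eq\<close> every row sum equals the weighted mean of the row sums,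
      which is the value of the form.\<close>
    have "quad E M y = (\<Sum>k\<in>E. y k * (\<Sum>j\<in>E. M k j * y j))"
      by (simp add: quad_def sum_distrib_left algebra_simps)
    also have "\<dots> = (\<Sum>k\<in>E. y k * (\<Sum>j\<in>E. M i j * y j))"
      by (rule sum.cong[OF refl]) (metis eq i)
    also have "\<dots> = (\<Sum>j\<in>E. M i j * y j)"
      using y by (simp add: sum_distrib_right[symmetric] prob_simplex_def)
    finally show ?thesis using lt by simp
  qed
  have strict: "2 * M u v < M u u + M v v" if uv: "u \<in> E" "v \<in> E" "u \<noteq> v" for u v
  proof (rule ccontr)
    assume n: "\<not> ?thesis"
    \<comment> \<open>All the weight of \<open>v\<close> moves to \<open>u\<close>. The linear term
      vanishes by \<open>eq\<close>, so the form does not grow although the support shrinks.\<close>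
    let ?w = "pert u v (y v)"
    have "quad E M ?w = quad E M y + (y v)\<^sup>2 * (M u u + M v v - 2 * M u v)"
      unfolding pert_def quad_perturb[OF fE uv sym] eq[OF uv] by simp
    also have "\<dots> \<le> quad E M y"
      using n by (simp add: mult_nonneg_nonpos)
    finally have "quad E M ?w < 1" using lt by simp
    moreover have "?w \<in> prob_simplex E" 
      using ypos[OF uv(1)] ypos[OF uv(2)] by (intro pert uv) linarith+
    moreover have "?w v = 0" using uv by (simp add: pert_def)
    ultimately show False using drop uv by blast
  qed
  have "sum y E = 1" using y by (simp add: prob_simplex_def)
  then show ?thesis
    by (intro exI[of _ E] exI[of _ y] conjI ballI impI ED ypos lt1 strict)
qed

section \<open>Coloured clusters and their cost\<close>

datatype ptype = White | Black | Gray

fun pswap :: "ptype \<Rightarrow> ptype" where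
  "pswap White = Black" | "pswap Black = White" | "pswap Gray = Gray"

text \<open>Deleting and adding all pairs of a cluster pair costs \<open>p\<close> and \<open>1 - p\<close>. Up to scaling the weights
  \<open>b\<close> and \<open>a\<close> are these costs at the peak \<open>p = b / (a + b)\<close> of the tent function in the theorem; since the
  tent times \<open>b\<close> (times \<open>a\<close>) is at most \<open>p\<close> (at most \<open>1 - p\<close>), this single value of \<open>p\<close> suffices.\<close>

definition pcost :: "nat \<Rightarrow> nat \<Rightarrow> ptype \<Rightarrow> real" where
  "pcost a b t = (case t of White \<Rightarrow> real b | Black \<Rightarrow> real a | Gray \<Rightarrow> 0)"

definition pcompat :: "ptype \<Rightarrow> bool \<Rightarrow> bool" where
  "pcompat t e \<longleftrightarrow> (t = White \<longrightarrow> \<not> e) \<and> (t = Black \<longrightarrow> e)"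

text \<open>Embedding into a coloured regularity graph, the reduced graph used for induced
  subgraphs: clusters are white or black, pairs of clusters white, black or gray.\<close>

definition crk_embeds ::
  "'h set \<Rightarrow> ('h \<Rightarrow> 'h \<Rightarrow> bool) \<Rightarrow> 'c set \<Rightarrow> ('c \<Rightarrow> bool) \<Rightarrow> ('c \<Rightarrow> 'c \<Rightarrow> ptype) \<Rightarrow> bool" where
  "crk_embeds V adj D white T \<longleftrightarrow> (\<exists>\<phi>. \<phi> ` V \<subseteq> D \<and>
     (\<forall>u\<in>V. \<forall>v\<in>V. u \<noteq> v \<longrightarrow>
        (if \<phi> u = \<phi> v then adj u v \<longleftrightarrow> \<not> white (\<phi> u) else pcompat (T (\<phi> u) (\<phi> v)) (adj u v))))"

definition crk_cost :: "nat \<Rightarrow> nat \<Rightarrow> ('c \<Rightarrow> bool) \<Rightarrow> ('c \<Rightarrow> 'c \<Rightarrow> ptype) \<Rightarrow> 'c \<Rightarrow> 'c \<Rightarrow> real" where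
  "crk_cost a b white T i j = (if i = j then (if white i then real b else real a) else pcost a b (T i j))"

lemma crk_embeds_swap:
  "crk_embeds V (\<lambda>u v. \<not> adj u v) D (\<lambda>i. \<not> white i) (\<lambda>i j. pswap (T i j)) \<longleftrightarrow> crk_embeds V adj D white T"
proof -
  have 1: "pcompat (pswap t) (\<not> e) \<longleftrightarrow> pcompat t e" for t e
    by (cases t) (auto simp: pcompat_def)
  have 2: "(if c then \<not> p \<longleftrightarrow> \<not> \<not> q else r) \<longleftrightarrow> (if c then p \<longleftrightarrow> \<not> q else r)" for c p q r by auto
  show ?thesis unfolding crk_embeds_def 1 2 by (rule refl)
qed

lemma crk_cost_swap:
  "crk_cost b a (\<lambda>i. \<not> white i) (\<lambda>i j. pswap (T i j)) = crk_cost a b white T"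
proof (intro ext)
  fix i j show "crk_cost b a (\<lambda>i. \<not> white i) (\<lambda>i j. pswap (T i j)) i j = crk_cost a b white T i j"
    by (cases "T i j") (auto simp: crk_cost_def pcost_def)
qed

text \<open>Scaling to total weight 1 turns the bound on the simplex into a homogeneous one.\<close>

lemma quad_ge_square:
  assumes fD: "finite D" and x: "\<And>i. i \<in> D \<Longrightarrow> x i \<ge> 0"
    and M: "\<And>i j. M i j \<ge> 0" and ge: "\<And>y. y \<in> prob_simplex D \<Longrightarrow> quad D M y \<ge> 1"
  shows "quad D M x \<ge> (sum x D)\<^sup>2"
proof (cases "sum x D = 0")
  case True
  then show ?thesis using x M by (auto simp: quad_def intro!: sum_nonneg)
next
  case False
  define s where "s = sum x D"
  have s: "s > 0" using False sum_nonneg[of D x] x unfolding s_def by fastforce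
  define y where "y i = (if i \<in> D then x i / s else 0)" for i
  have "sum y D = 1"
    using s by (simp add: y_def sum_divide_distrib[symmetric] s_def)
  then have "y \<in> prob_simplex D" using s x by (auto simp: prob_simplex_def y_def)
  then have "1 \<le> quad D M y" by (rule ge)
  also have "quad D M y = quad D M x / s\<^sup>2"
    by (simp add: quad_def y_def sum_divide_distrib power2_eq_square)
  finally show ?thesis using s by (simp add: s_def[symmetric] field_simps)
qed

context split_pattern
begin

lemma swap: "split_pattern S K (\<lambda>u v. \<not> adj u v) b a"
proof
  show "S \<inter> K = {}" using disj by blast
  show "\<exists>C\<subseteq>S \<union> K. (\<forall>u\<in>C. \<forall>v\<in>C. u \<noteq> v \<longrightarrow> \<not> adj u v) \<and> card C = a + 1"
    using indep_ex by (simp add: Un_commute)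
  show "\<exists>C\<subseteq>S \<union> K. (\<forall>u\<in>C. \<forall>v\<in>C. u \<noteq> v \<longrightarrow> \<not> \<not> adj u v) \<and> card C = b + 1"
    using clique_ex by (simp add: Un_commute)
qed (use fin sym K_adj S_nadj pos clique_le indep_le in \<open>auto simp: Un_commute\<close>)

text \<open>If \<open>S\<close> is not a maximum independent set, then adding one vertex of
  \<open>K\<close> makes it one, and this vertex can change sides. The weighted embedding relies on
  the size \<open>a + 1\<close>.\<close>

lemma normalize: "\<exists>K' S'. split_pattern K' S' adj a b \<and> K' \<union> S' = K \<union> S \<and> card S' = a + 1"
proof (cases "card S = a + 1")
  case True
  then show ?thesis using split_pattern_axioms by blast
next
  case False
  then have cS: "card S = a" using card_S_ge card_S_le by simp
  obtain C where C: "C \<subseteq> K \<union> S" "\<forall>u\<in>C. \<forall>v\<in>C. u \<noteq> v \<longrightarrow> \<not> adj u v" "card C = a + 1"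
    using indep_ex by blast
  have "finite C" using C fin finite_subset by (metis finite_UnI)
  have "\<not> C \<subseteq> S" using C cS fin card_mono[of S C] by auto
  then obtain k where k: "k \<in> C" "k \<in> K" using C by blast
  have "C - {k} \<subseteq> S" using C k K_adj by blast
  moreover have "card (C - {k}) = a" using C k \<open>finite C\<close> by simp
  ultimately have CS: "C - {k} = S" using cS fin by (intro card_subset_eq) auto
  have kS: "k \<notin> S" using k disj by blast
  have "split_pattern (K - {k}) (insert k S) adj a b"
  proof
    have U: "(K - {k}) \<union> insert k S = K \<union> S" using k by blast
    show "u \<in> insert k S \<Longrightarrow> v \<in> insert k S \<Longrightarrow> u \<noteq> v \<Longrightarrow> \<not> adj u v" for u v
      using C(2) k CS by blast
    show "\<exists>C\<subseteq>(K - {k}) \<union> insert k S. (\<forall>u\<in>C. \<forall>v\<in>C. u \<noteq> v \<longrightarrow> adj u v) \<and> card C = b + 1"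
      "\<exists>C\<subseteq>(K - {k}) \<union> insert k S. (\<forall>u\<in>C. \<forall>v\<in>C. u \<noteq> v \<longrightarrow> \<not> adj u v) \<and> card C = a + 1"
      unfolding U using clique_ex indep_ex by blast+
    show "card C \<le> b + 1" if "C \<subseteq> (K - {k}) \<union> insert k S" "\<And>u v. u \<in> C \<Longrightarrow> v \<in> C \<Longrightarrow> u \<noteq> v \<Longrightarrow> adj u v" for C
      by (rule clique_le) (use that U in auto)
    show "card C \<le> a + 1" if "C \<subseteq> (K - {k}) \<union> insert k S" "\<And>u v. u \<in> C \<Longrightarrow> v \<in> C \<Longrightarrow> u \<noteq> v \<Longrightarrow> \<not> adj u v" for C
      by (rule indep_le) (use that U in auto)
  qed (use fin disj k K_adj sym pos in auto)
  moreover have "card (insert k S) = a + 1" using kS fin cS by simp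
  ultimately show ?thesis using k by (intro exI[of _ "K - {k}"] exI[of _ "insert k S"]) auto
qed

text \<open>On the support from \<open>quad_core\<close> no two white clusters form a white pair,
  since \<open>2 * b < b + b\<close> fails. The cost bound at each cluster then becomes the black
  degree bound of \<open>embeds_weighted\<close>.\<close>

lemma crk_embeds_white:
  assumes fD: "finite D" and symT: "\<And>i j. T i j = T j i"
    and white: "\<And>i. i \<in> D \<Longrightarrow> white i"
    and x: "x \<in> prob_simplex D" "quad D (crk_cost a b white T) x < 1"
  shows "crk_embeds (K \<union> S) adj D white T"
proof -
  let ?M = "crk_cost a b white T"
  have symM: "?M i j = ?M j i" for i j by (simp add: crk_cost_def symT)
  obtain D' y where D0: "D' \<subseteq> D" "\<forall>i\<in>D'. y i > 0" "sum y D' = 1"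
    "\<forall>i\<in>D'. (\<Sum>j\<in>D'. ?M i j * y j) < 1"
    "\<forall>u\<in>D'. \<forall>v\<in>D'. u \<noteq> v \<longrightarrow> 2 * ?M u v < ?M u u + ?M v v"
    using quad_core[of D ?M, OF fD symM x] by (elim exE conjE, intro that)
  note D' = D0(1) D0(2)[rule_format] D0(3) D0(4)[rule_format] D0(5)[rule_format]
  have fD': "finite D'" by (rule finite_subset[OF D'(1) fD])
  have wD': "white i" if "i \<in> D'" for i using white D'(1) that by blast
  have nw: "T u v \<noteq> White" if "u \<in> D'" "v \<in> D'" "u \<noteq> v" for u v
    using D'(5)[OF that] that(3) wD'[OF that(1)] wD'[OF that(2)]
    by (auto simp: crk_cost_def pcost_def)
  define B where "B i j \<longleftrightarrow> i \<noteq> j \<and> T i j = Black" for i j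
  have dg: "b * y i + a * (\<Sum>j | j \<in> D' \<and> B i j. y j) < 1" if i: "i \<in> D'" for i
  proof -
    have "(\<Sum>j\<in>D'. ?M i j * y j) = (\<Sum>j\<in>D'. (if i = j then b * y j else 0) + (if B i j then a * y j else 0))"
    proof (rule sum.cong[OF refl])
      fix j assume j: "j \<in> D'"
      show "?M i j * y j = (if i = j then b * y j else 0) + (if B i j then a * y j else 0)"
        using nw[OF i j] wD'[OF i] by (cases "T i j") (auto simp: crk_cost_def pcost_def B_def)
    qed
    also have "\<dots> = b * y i + (\<Sum>j\<in>D'. if B i j then a * y j else 0)"
      using i fD' by (simp add: sum.distrib)
    also have "(\<Sum>j\<in>D'. if B i j then a * y j else 0) = a * (\<Sum>j | j \<in> D' \<and> B i j. y j)"
      using fD' by (simp add: sum.inter_filter[symmetric] sum_distrib_left)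
    finally show ?thesis using D'(4)[OF i] by simp
  qed
  obtain K' S' where KS: "split_pattern K' S' adj a b" "K' \<union> S' = K \<union> S" "card S' = a + 1"
    using normalize by blast
  interpret n: split_pattern K' S' adj a b by (rule KS(1))
  have "n.embeds D' B"
    by (rule n.embeds_weighted[OF fD' D'(2,3) _ _ dg KS(3)]) (auto simp: B_def symT)
  then obtain \<phi> where \<phi>0: "\<phi> ` (K \<union> S) \<subseteq> D'"
    "\<forall>u\<in>K \<union> S. \<forall>v\<in>K \<union> S. u \<noteq> v \<longrightarrow> (\<phi> u = \<phi> v \<longrightarrow> \<not> adj u v) \<and> (B (\<phi> u) (\<phi> v) \<longrightarrow> adj u v)"
    unfolding n.embeds_def KS(2) by (elim exE conjE, intro that)
  note \<phi> = \<phi>0(1) \<phi>0(2)[rule_format]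
  show ?thesis
    unfolding crk_embeds_def
  proof (intro exI[of _ \<phi>] conjI ballI impI)
    fix u v assume uv: "u \<in> K \<union> S" "v \<in> K \<union> S" "u \<noteq> v"
    have "\<phi> u \<in> D'" "\<phi> v \<in> D'" using \<phi>(1) uv by blast+
    then show "if \<phi> u = \<phi> v then adj u v \<longleftrightarrow> \<not> white (\<phi> u) else pcompat (T (\<phi> u) (\<phi> v)) (adj u v)"
      using \<phi>(2)[OF uv] nw wD' by (auto simp: B_def pcompat_def)
  qed (use \<phi>(1) D'(1) in blast)
qed

text \<open>Without an embedding, the white clusters cost at least the square of their weight, and
  so do the black ones by complementation. A gray pair between the two kinds would host
  \<open>K\<close> on its black and \<open>S\<close> on its white end, so all these pairs cost at
  least 1. Altogether the cost is at least the square of the total weight 1.\<close>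

theorem crk_embeds_if_cheap:
  assumes fD: "finite D" and symT: "\<And>i j. T i j = T j i"
    and x: "x \<in> prob_simplex D" "quad D (crk_cost a b white T) x < 1"
  shows "crk_embeds (K \<union> S) adj D white T"
proof (rule ccontr)
  assume ne: "\<not> ?thesis"
  let ?M = "crk_cost a b white T"
  define W where "W = {i \<in> D. white i}"
  define L where "L = {i \<in> D. \<not> white i}"
  have fWL: "finite W" "finite L" and DWL: "D = W \<union> L" "W \<inter> L = {}"
    using fD by (auto simp: W_def L_def)
  have mono: "crk_embeds (K \<union> S) adj E white T \<Longrightarrow> False" if "E \<subseteq> D" for E
    using ne that unfolding crk_embeds_def by (meson subset_trans)
  have M0: "?M i j \<ge> 0" for i j by (cases "T i j") (auto simp: crk_cost_def pcost_def)
  have symM: "?M i j = ?M j i" for i j by (simp add: crk_cost_def symT)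
  have x0: "x i \<ge> 0" if "i \<in> D" for i using x that by (auto simp: prob_simplex_def)
  have w: "quad W ?M x \<ge> (sum x W)\<^sup>2"
  proof (rule quad_ge_square[OF fWL(1) _ M0])
    show "quad W ?M y \<ge> 1" if "y \<in> prob_simplex W" for y
      using crk_embeds_white[OF fWL(1) symT _ that, of white] mono[of W] unfolding W_def by force
  qed (use x0 W_def in auto)
  have l: "quad L ?M x \<ge> (sum x L)\<^sup>2"
  proof (rule quad_ge_square[OF fWL(2) _ M0])
    interpret s: split_pattern S K "\<lambda>u v. \<not> adj u v" b a by (rule swap)
    show "quad L ?M y \<ge> 1" if "y \<in> prob_simplex L" for y
    proof (rule ccontr)
      assume "\<not> ?thesis"
      then have "crk_embeds (S \<union> K) (\<lambda>u v. \<not> adj u v) L (\<lambda>i. \<not> white i) (\<lambda>i j. pswap (T i j))"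
        using that symT by (intro s.crk_embeds_white[OF fWL(2), where x = y]) (auto simp: crk_cost_swap L_def)
      then show False using mono[of L] DWL by (simp add: crk_embeds_swap Un_commute)
    qed
  qed (use x0 L_def in auto)
  have cross: "?M i j \<ge> 1" if i: "i \<in> W" and j: "j \<in> L" for i j
  proof (rule ccontr)
    assume "\<not> ?thesis"
    moreover have ij: "i \<noteq> j" using i j by (auto simp: W_def L_def)
    ultimately have G: "T i j = Gray" "T j i = Gray" using pos symT by (cases "T i j"; auto simp: crk_cost_def pcost_def)+
    have "crk_embeds (K \<union> S) adj D white T"
      unfolding crk_embeds_def
      by (intro exI[of _ "\<lambda>u. if u \<in> K then j else i"])
         (use i j ij G disj K_adj S_nadj in \<open>auto simp: W_def L_def pcompat_def\<close>)
    then show False using ne by simp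
  qed
  have c2: "(\<Sum>i\<in>W. \<Sum>j\<in>L. ?M i j * x i * x j) \<ge> sum x W * sum x L"
    unfolding sum_product
  proof (intro sum_mono)
    fix i j assume ij: "i \<in> W" "j \<in> L"
    have "1 * (x i * x j) \<le> ?M i j * (x i * x j)"
      by (rule mult_right_mono[OF cross[OF ij]]) (use x0 ij DWL in auto)
    then show "x i * x j \<le> ?M i j * x i * x j" by (simp add: mult.assoc)
  qed
  have c3: "(\<Sum>i\<in>L. \<Sum>j\<in>W. ?M i j * x i * x j) = (\<Sum>i\<in>W. \<Sum>j\<in>L. ?M i j * x i * x j)"
  proof (subst sum.swap, intro sum.cong refl)
    fix i j show "?M j i * x j * x i = ?M i j * x i * x j" by (simp only: symM[of j i] ac_simps)
  qed
  have "quad D ?M x = quad W ?M x + quad L ?M x + 2 * (\<Sum>i\<in>W. \<Sum>j\<in>L. ?M i j * x i * x j)"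
    unfolding quad_def DWL(1) using fWL DWL(2) c3
    by (simp add: sum.union_disjoint sum.distrib)
  also have "\<dots> \<ge> (sum x W + sum x L)\<^sup>2"
    using w l c2 by (simp add: power2_sum)
  finally have "quad D ?M x \<ge> (sum x D)\<^sup>2"
    using fWL DWL by (simp add: sum.union_disjoint)
  then show False using x by (simp add: prob_simplex_def)
qed

end

section \<open>Weak regularity\<close>

definition cell :: "'v set \<Rightarrow> ('v \<Rightarrow> nat) \<Rightarrow> nat \<Rightarrow> 'v set" where
  "cell V q c = {x \<in> V. q x = c}"

definition cell_avg :: "'v set \<Rightarrow> ('v \<Rightarrow> 'v \<Rightarrow> real) \<Rightarrow> ('v \<Rightarrow> nat) \<Rightarrow> nat \<Rightarrow> nat \<Rightarrow> real" where
  "cell_avg V W q c d =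
     (\<Sum>x\<in>cell V q c. \<Sum>y\<in>cell V q d. W x y) / (card (cell V q c) * card (cell V q d))"

lemma sum_cells:
  assumes "finite V"
  shows "(\<Sum>x\<in>V. \<Sum>y\<in>V. F x y) =
    (\<Sum>c\<in>q ` V. \<Sum>d\<in>q ` V. \<Sum>x\<in>cell V q c. \<Sum>y\<in>cell V q d. F x y :: real)"
proof -
  have "(\<Sum>x\<in>V. \<Sum>y\<in>V. F x y) = (\<Sum>c\<in>q ` V. \<Sum>x\<in>cell V q c. \<Sum>y\<in>V. F x y)"
    unfolding cell_def by (rule sum.image_gen[OF assms])
  also have "\<dots> = (\<Sum>c\<in>q ` V. \<Sum>x\<in>cell V q c. \<Sum>d\<in>q ` V. \<Sum>y\<in>cell V q d. F x y)"
    unfolding cell_def by (intro sum.cong refl sum.image_gen[OF assms])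
  also have "\<dots> = (\<Sum>c\<in>q ` V. \<Sum>d\<in>q ` V. \<Sum>x\<in>cell V q c. \<Sum>y\<in>cell V q d. F x y)"
    by (intro sum.cong refl sum.swap)
  finally show ?thesis .
qed

lemma cell_avg_block:
  assumes "finite V" "c \<in> q ` V" "d \<in> q ` V"
  shows "card (cell V q c) * card (cell V q d) * cell_avg V W q c d =
    (\<Sum>x\<in>cell V q c. \<Sum>y\<in>cell V q d. W x y)"
proof -
  have "finite (cell V q c)" "finite (cell V q d)" "cell V q c \<noteq> {}" "cell V q d \<noteq> {}"
    using assms by (auto simp: cell_def)
  then show ?thesis by (simp add: cell_avg_def)
qed

text \<open>Averaging over pairs of cells is the orthogonal projection onto the functions that are
  constant on them.\<close>

lemma cell_avg_projection:
  assumes "finite V"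
  shows "(\<Sum>x\<in>V. \<Sum>y\<in>V. cell_avg V W q (q x) (q y) * g (q x) (q y)) =
    (\<Sum>x\<in>V. \<Sum>y\<in>V. W x y * g (q x) (q y))"
  unfolding sum_cells[OF assms, of _ q]
proof (rule sum.cong[OF refl], rule sum.cong[OF refl])
  fix c d assume cd: "c \<in> q ` V" "d \<in> q ` V"
  have "(\<Sum>x\<in>cell V q c. \<Sum>y\<in>cell V q d. cell_avg V W q (q x) (q y) * g (q x) (q y)) =
      (\<Sum>x\<in>cell V q c. \<Sum>y\<in>cell V q d. cell_avg V W q c d * g c d)"
    by (intro sum.cong refl) (auto simp: cell_def)
  also have "\<dots> = card (cell V q c) * card (cell V q d) * cell_avg V W q c d * g c d" by simp
  also have "\<dots> = (\<Sum>x\<in>cell V q c. \<Sum>y\<in>cell V q d. W x y) * g c d"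
    using cell_avg_block[OF assms cd, of W] by simp
  also have "\<dots> = (\<Sum>x\<in>cell V q c. \<Sum>y\<in>cell V q d. W x y * g (q x) (q y))"
    unfolding sum_distrib_right by (intro sum.cong refl) (auto simp: cell_def)
  finally show "(\<Sum>x\<in>cell V q c. \<Sum>y\<in>cell V q d. cell_avg V W q (q x) (q y) * g (q x) (q y)) =
    (\<Sum>x\<in>cell V q c. \<Sum>y\<in>cell V q d. W x y * g (q x) (q y))" .
qed

lemma cell_avg_bounds:
  assumes "finite V" "\<And>x y. x \<in> V \<Longrightarrow> y \<in> V \<Longrightarrow> 0 \<le> W x y \<and> W x y \<le> 1"
  shows "0 \<le> cell_avg V W q c d" "cell_avg V W q c d \<le> 1"
proof -
  let ?S = "\<Sum>x\<in>cell V q c. \<Sum>y\<in>cell V q d. W x y"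
  have "?S \<ge> 0" using assms by (intro sum_nonneg) (auto simp: cell_def)
  then show "0 \<le> cell_avg V W q c d" by (simp add: cell_avg_def)
  have "?S \<le> (\<Sum>x\<in>cell V q c. \<Sum>y\<in>cell V q d. 1)"
    using assms by (intro sum_mono) (auto simp: cell_def)
  then have "?S \<le> card (cell V q c) * card (cell V q d)" by simp
  then show "cell_avg V W q c d \<le> 1"
  proof (cases "card (cell V q c) * card (cell V q d) = 0")
    case False
    then have "real (card (cell V q c) * card (cell V q d)) > 0" by simp
    with \<open>?S \<le> card (cell V q c) * card (cell V q d)\<close> show ?thesis
      unfolding cell_avg_def by (subst pos_divide_le_eq) simp_all
  qed (auto simp: cell_avg_def)
qed

lemma cell_avg_sym:
  assumes "\<And>x y. W x y = W y x"
  shows "cell_avg V W q c d = cell_avg V W q d c"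
proof -
  have "(\<Sum>x\<in>cell V q c. \<Sum>y\<in>cell V q d. W x y) = (\<Sum>x\<in>cell V q d. \<Sum>y\<in>cell V q c. W x y)"
    by (subst sum.swap) (intro sum.cong refl assms)
  then show ?thesis by (simp add: cell_avg_def mult.commute)
qed

text \<open>Distance in the cut norm, not normalized: in applications \<open>r\<close> is of order
  \<open>(card V)^2\<close>.\<close>

definition cut_close :: "'v set \<Rightarrow> ('v \<Rightarrow> 'v \<Rightarrow> real) \<Rightarrow> ('v \<Rightarrow> 'v \<Rightarrow> real) \<Rightarrow> real \<Rightarrow> bool" where
  "cut_close V W U r \<longleftrightarrow> (\<forall>A\<subseteq>V. \<forall>B\<subseteq>V. \<bar>\<Sum>x\<in>A. \<Sum>y\<in>B. W x y - U x y\<bar> \<le> r)"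

text \<open>By Pythagoras for the nested projections \<open>U\<close> and \<open>U'\<close>, the
  gain in energy is their squared distance, which Cauchy-Schwarz against the indicator of
  \<open>A \<times> B\<close> bounds from below. The factor \<open>(card V)^2\<close> avoids a
  division.\<close>

lemma energy_increment:
  fixes W :: "'v \<Rightarrow> 'v \<Rightarrow> real"
  assumes fV: "finite V" and AB: "A \<subseteq> V" "B \<subseteq> V"
    and big: "\<bar>\<Sum>x\<in>A. \<Sum>y\<in>B. W x y - cell_avg V W q (q x) (q y)\<bar> \<ge> r" "r \<ge> 0"
    and q': "q' = (\<lambda>x. 4 * q x + 2 * of_bool (x \<in> A) + of_bool (x \<in> B))"
  shows "(\<Sum>x\<in>V. \<Sum>y\<in>V. (cell_avg V W q' (q' x) (q' y))\<^sup>2) * (card V)\<^sup>2 \<ge>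
    (\<Sum>x\<in>V. \<Sum>y\<in>V. (cell_avg V W q (q x) (q y))\<^sup>2) * (card V)\<^sup>2 + r\<^sup>2"
proof -
  define U where "U x y = cell_avg V W q (q x) (q y)" for x y
  define U' where "U' x y = cell_avg V W q' (q' x) (q' y)" for x y
  \<comment> \<open>The two low bits of \<open>q'\<close> record membership in \<open>A\<close> and
    \<open>B\<close>, so \<open>q\<close> and both indicators are functions of
    \<open>q'\<close>.\<close>
  have q4: "q' x div 4 = q x" for x unfolding q' of_bool_def by (cases "x \<in> A"; cases "x \<in> B"; simp; presburger?)
  have qB: "odd (q' x) \<longleftrightarrow> x \<in> B" for x by (simp add: q')
  have qA: "odd (q' x div 2) \<longleftrightarrow> x \<in> A" for x unfolding q' of_bool_def by (cases "x \<in> A"; cases "x \<in> B"; simp; presburger?)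
  have UU: "(\<Sum>x\<in>V. \<Sum>y\<in>V. U' x y * U x y) = (\<Sum>x\<in>V. \<Sum>y\<in>V. (U x y)\<^sup>2)"
  proof -
    have "(\<Sum>x\<in>V. \<Sum>y\<in>V. U' x y * U x y) = (\<Sum>x\<in>V. \<Sum>y\<in>V. W x y * U x y)"
      using cell_avg_projection[OF fV, of W q' "\<lambda>c d. cell_avg V W q (c div 4) (d div 4)"]
      unfolding q4 U_def U'_def .
    also have "\<dots> = (\<Sum>x\<in>V. \<Sum>y\<in>V. U x y * U x y)"
      using cell_avg_projection[OF fV, of W q "cell_avg V W q"] unfolding U_def by simp
    finally show ?thesis by (simp add: power2_eq_square)
  qed
  define I where "I x y = (of_bool (x \<in> A \<and> y \<in> B) :: real)" for x y
  have sumI: "(\<Sum>x\<in>V. \<Sum>y\<in>V. F x y * I x y) = (\<Sum>x\<in>A. \<Sum>y\<in>B. F x y)" for F :: "'v \<Rightarrow> 'v \<Rightarrow> real"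
  proof -
    have restr: "sum f C = (\<Sum>x\<in>V. if x \<in> C then f x else 0)" if "C \<subseteq> V" for C and f :: "'v \<Rightarrow> real"
      using sum.inter_restrict[OF fV, of f C] that by (simp add: Int_absorb1)
    have "(\<Sum>x\<in>A. \<Sum>y\<in>B. F x y) = (\<Sum>x\<in>V. if x \<in> A then (\<Sum>y\<in>V. if y \<in> B then F x y else 0) else 0)"
      by (simp only: restr[OF AB(1)] restr[OF AB(2)])
    also have "\<dots> = (\<Sum>x\<in>V. \<Sum>y\<in>V. F x y * I x y)"
      by (intro sum.cong refl) (auto simp: I_def intro!: sum.cong)
    finally show ?thesis by simp
  qed
  have "(\<Sum>x\<in>V. \<Sum>y\<in>V. U' x y * I x y) = (\<Sum>x\<in>V. \<Sum>y\<in>V. W x y * I x y)"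
    using cell_avg_projection[OF fV, of W q' "\<lambda>c d. of_bool (odd (c div 2) \<and> odd d)"]
    unfolding qA qB U'_def I_def .
  then have "(\<Sum>x\<in>A. \<Sum>y\<in>B. W x y - U x y) = (\<Sum>x\<in>V. \<Sum>y\<in>V. (U' x y - U x y) * I x y)"
    by (simp add: sumI sum_subtractf left_diff_distrib)
  also have "\<dots> = (\<Sum>z\<in>V \<times> V. (U' (fst z) (snd z) - U (fst z) (snd z)) * I (fst z) (snd z))"
    by (simp add: sum.cartesian_product case_prod_unfold)
  finally have "r\<^sup>2 \<le> (\<Sum>z\<in>V \<times> V. (U' (fst z) (snd z) - U (fst z) (snd z)) * I (fst z) (snd z))\<^sup>2"
    using big unfolding U_def[symmetric] by (metis abs_le_square_iff abs_of_nonneg)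
  also have "\<dots> \<le> (\<Sum>z\<in>V \<times> V. (U' (fst z) (snd z) - U (fst z) (snd z))\<^sup>2) * (\<Sum>z\<in>V \<times> V. (I (fst z) (snd z))\<^sup>2)"
    by (rule Cauchy_Schwarz_ineq_sum)
  also have "\<dots> \<le> (\<Sum>z\<in>V \<times> V. (U' (fst z) (snd z) - U (fst z) (snd z))\<^sup>2) * (\<Sum>z\<in>V \<times> V. 1)"
    by (intro mult_left_mono sum_mono sum_nonneg) (auto simp: I_def)
  also have "(\<Sum>z\<in>V \<times> V. 1) = real ((card V)\<^sup>2)" by (simp add: card_cartesian_product power2_eq_square)
  also have "(\<Sum>z\<in>V \<times> V. (U' (fst z) (snd z) - U (fst z) (snd z))\<^sup>2) = (\<Sum>x\<in>V. \<Sum>y\<in>V. (U' x y - U x y)\<^sup>2)"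
    by (simp add: sum.cartesian_product case_prod_unfold)
  also have "\<dots> = (\<Sum>x\<in>V. \<Sum>y\<in>V. (U' x y)\<^sup>2) - (\<Sum>x\<in>V. \<Sum>y\<in>V. (U x y)\<^sup>2)"
  proof -
    have "(\<Sum>x\<in>V. \<Sum>y\<in>V. (U' x y - U x y)\<^sup>2) =
      (\<Sum>x\<in>V. \<Sum>y\<in>V. (U' x y)\<^sup>2) + (\<Sum>x\<in>V. \<Sum>y\<in>V. (U x y)\<^sup>2) - 2 * (\<Sum>x\<in>V. \<Sum>y\<in>V. U' x y * U x y)"
      by (simp add: power2_diff sum.distrib sum_subtractf sum_distrib_left mult.assoc)
    then show ?thesis using UU by simp
  qed
  finally show ?thesis unfolding U_def U'_def by (simp add: algebra_simps)
qed

text \<open>The partition form of the Frieze-Kannan lemma. The energy never exceeds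
  \<open>(card V)^2\<close>, and a partition that fails has a refinement into at most four times as
  many cells that gains \<open>\<epsilon>^2 * (card V)^2\<close>, so \<open>R\<close> successive
  refinements are impossible.\<close>

theorem weak_regularity:
  fixes \<epsilon> :: real
  assumes "\<epsilon> > 0"
  shows "\<exists>k. \<forall>(V :: 'v set) W. finite V \<longrightarrow> (\<forall>x\<in>V. \<forall>y\<in>V. 0 \<le> W x y \<and> W x y \<le> 1) \<longrightarrow>
     (\<exists>q. (\<forall>x. q x < k) \<and> cut_close V W (\<lambda>x y. cell_avg V W q (q x) (q y)) (\<epsilon> * (card V)\<^sup>2))"
proof -
  obtain R :: nat where R: "R * \<epsilon>\<^sup>2 > 1"
    using ex_less_of_nat_mult[of "\<epsilon>\<^sup>2" 1] assms by auto
  show ?thesis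
  proof (intro exI[of _ "4 ^ R"] allI impI)
    fix V :: "'v set" and W :: "'v \<Rightarrow> 'v \<Rightarrow> real"
    assume fV: "finite V" and W0: "\<forall>x\<in>V. \<forall>y\<in>V. 0 \<le> W x y \<and> W x y \<le> 1"
    have W: "0 \<le> W x y \<and> W x y \<le> 1" if "x \<in> V" "y \<in> V" for x y using W0 that by blast
    let ?cc = "\<lambda>q. cut_close V W (\<lambda>x y. cell_avg V W q (q x) (q y)) (\<epsilon> * (card V)\<^sup>2)"
    let ?E = "\<lambda>q. \<Sum>x\<in>V. \<Sum>y\<in>V. (cell_avg V W q (q x) (q y))\<^sup>2"
    show "\<exists>q. (\<forall>x. q x < 4 ^ R) \<and> ?cc q"
    proof (cases "V = {}")
      case True
      then show ?thesis by (intro exI[of _ "\<lambda>_. 0"]) (auto simp: cut_close_def)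
    next
      case False
      then have n: "card V > 0" using fV by (simp add: card_gt_0_iff)
      have step: "(\<exists>q. (\<forall>x. q x < 4 ^ R) \<and> ?cc q) \<or> (\<exists>q. (\<forall>x. q x < 4 ^ r) \<and> ?E q \<ge> r * \<epsilon>\<^sup>2 * (card V)\<^sup>2)"
        if "r \<le> R" for r
        using that
      proof (induction r)
        case 0
        then show ?case by (intro disjI2 exI[of _ "\<lambda>_. 0"]) (auto intro!: sum_nonneg)
      next
        case (Suc r)
        show ?case
        proof (cases "\<exists>q. (\<forall>x. q x < 4 ^ R) \<and> ?cc q")
          case True then show ?thesis by blast
        next
          case False
          then obtain q where q: "\<And>x. q x < 4 ^ r" "?E q \<ge> r * \<epsilon>\<^sup>2 * (card V)\<^sup>2" using Suc by auto
          have "q x < 4 ^ R" for x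
            using q(1)[of x] Suc.prems power_increasing[of r R "4::nat"] by (meson Suc_leD less_le_trans one_le_numeral)
          then have "\<not> ?cc q" using False by blast
          then obtain A B where AB: "A \<subseteq> V" "B \<subseteq> V"
            "\<bar>\<Sum>x\<in>A. \<Sum>y\<in>B. W x y - cell_avg V W q (q x) (q y)\<bar> \<ge> \<epsilon> * (card V)\<^sup>2"
            unfolding cut_close_def by (auto simp: not_le intro: less_imp_le)
          define q' where "q' = (\<lambda>x. 4 * q x + 2 * of_bool (x \<in> A) + of_bool (x \<in> B))"
          have "?E q * (card V)\<^sup>2 + (\<epsilon> * (card V)\<^sup>2)\<^sup>2 \<le> ?E q' * (card V)\<^sup>2"
            by (rule energy_increment[OF fV AB _ q'_def]) (use assms in simp)
          then have "(?E q + \<epsilon>\<^sup>2 * (card V)\<^sup>2) * (card V)\<^sup>2 \<le> ?E q' * (card V)\<^sup>2"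
            by (simp add: algebra_simps power2_eq_square)
          then have "?E q + \<epsilon>\<^sup>2 * (card V)\<^sup>2 \<le> ?E q'" using n by simp
          then have "?E q' \<ge> Suc r * \<epsilon>\<^sup>2 * (card V)\<^sup>2" using q(2) by (simp add: algebra_simps)
          moreover have "q' x < 4 ^ Suc r" for x
            using q(1)[of x] by (simp add: q'_def of_bool_def)
          ultimately show ?thesis by blast
        qed
      qed
      have "\<not> (\<exists>q. (\<forall>x. q x < 4 ^ R) \<and> ?E q \<ge> R * \<epsilon>\<^sup>2 * (card V)\<^sup>2)"
      proof
        assume "\<exists>q. (\<forall>x. q x < 4 ^ R) \<and> ?E q \<ge> R * \<epsilon>\<^sup>2 * (card V)\<^sup>2"
        then obtain q where q: "?E q \<ge> R * \<epsilon>\<^sup>2 * (card V)\<^sup>2" by blast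
        have "?E q \<le> (\<Sum>x\<in>V. \<Sum>y\<in>V. 1)"
          using cell_avg_bounds[OF fV W] by (intro sum_mono) (auto intro!: power_le_one)
        also have "\<dots> = 1 * real ((card V)\<^sup>2)" by (simp add: power2_eq_square)
        also have "\<dots> < R * \<epsilon>\<^sup>2 * (card V)\<^sup>2" using R n by (intro mult_strict_right_mono) auto
        finally show False using q by simp
      qed
      then show ?thesis using step[OF order.refl] by blast
    qed
  qed
qed

section \<open>Counting and blow-ups\<close>

lemma sum_PiE_insert:
  assumes "a \<notin> I"
  shows "(\<Sum>z\<in>PiE (insert a I) (\<lambda>_. V). F z) = (\<Sum>z\<in>PiE I (\<lambda>_. V). \<Sum>x\<in>V. F (z(a := x)))"
proof -
  have "(\<Sum>z\<in>PiE (insert a I) (\<lambda>_. V). F z) = (\<Sum>(x, z)\<in>V \<times> PiE I (\<lambda>_. V). F (z(a := x)))"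
    unfolding PiE_insert_eq
    by (subst sum.reindex[OF inj_combinator[OF assms]]) (simp add: case_prod_unfold comp_def)
  also have "\<dots> = (\<Sum>x\<in>V. \<Sum>z\<in>PiE I (\<lambda>_. V). F (z(a := x)))"
    by (simp add: sum.cartesian_product)
  finally show ?thesis by (subst (asm) sum.swap)
qed

lemma sum_PiE_pair:
  assumes "finite I" "i \<in> I" "j \<in> I" "i \<noteq> j"
  shows "(\<Sum>z\<in>PiE I (\<lambda>_. V). F z) =
    (\<Sum>z\<in>PiE (I - {i, j}) (\<lambda>_. V). \<Sum>x\<in>V. \<Sum>y\<in>V. F (z(i := x, j := y)))"
proof -
  have I: "I = insert j (insert i (I - {i, j}))" using assms by auto
  show ?thesis
    by (subst I, subst sum_PiE_insert, use assms in simp, subst sum_PiE_insert) auto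
qed

lemma sum_PiE_pair_eq:
  fixes f :: "'v \<Rightarrow> 'v \<Rightarrow> real"
  assumes "finite I" "i \<in> I" "j \<in> I" "i \<noteq> j"
  shows "(\<Sum>z\<in>PiE I (\<lambda>_. V). f (z i) (z j)) = card V ^ (card I - 2) * (\<Sum>x\<in>V. \<Sum>y\<in>V. f x y)"
proof -
  have "card (I - {i, j}) = card I - 2" using assms by (subst card_Diff_subset) auto
  then show ?thesis
    using assms by (subst sum_PiE_pair[OF assms]) (simp add: card_PiE)
qed

text \<open>The form is linear in each factor, so it does not decrease when \<open>f\<close> is
  replaced by the indicator of the rows with positive sum, and then \<open>g\<close>
  likewise.\<close>

lemma bilinear_le:
  fixes D :: "'v \<Rightarrow> 'v \<Rightarrow> real"
  assumes fV: "finite V" and cut: "\<And>A B. A \<subseteq> V \<Longrightarrow> B \<subseteq> V \<Longrightarrow> (\<Sum>x\<in>A. \<Sum>y\<in>B. D x y) \<le> r"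
    and f: "\<And>x. x \<in> V \<Longrightarrow> 0 \<le> f x \<and> f x \<le> 1" and g: "\<And>x. x \<in> V \<Longrightarrow> 0 \<le> g x \<and> g x \<le> 1"
  shows "(\<Sum>x\<in>V. \<Sum>y\<in>V. D x y * f x * g y) \<le> r"
proof -
  have ext: "(\<Sum>x\<in>V. k x * s x) \<le> (\<Sum>x | x \<in> V \<and> s x > 0. s x)"
    if "\<And>x. x \<in> V \<Longrightarrow> 0 \<le> k x \<and> k x \<le> (1::real)" for k s
  proof -
    have "(\<Sum>x\<in>V. k x * s x) \<le> (\<Sum>x\<in>V. if s x > 0 then s x else 0)"
    proof (rule sum_mono)
      fix x assume x: "x \<in> V"
      show "k x * s x \<le> (if s x > 0 then s x else 0)"
        using that[OF x] by (auto simp: mult_le_cancel_right1 mult_nonneg_nonpos not_less)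
    qed
    then show ?thesis using fV by (simp add: sum.inter_filter)
  qed
  define A where "A = {x \<in> V. (\<Sum>y\<in>V. D x y * g y) > 0}"
  define B where "B = {y \<in> V. (\<Sum>x\<in>A. D x y) > 0}"
  have "(\<Sum>x\<in>V. \<Sum>y\<in>V. D x y * f x * g y) = (\<Sum>x\<in>V. f x * (\<Sum>y\<in>V. D x y * g y))"
    by (simp add: sum_distrib_left mult_ac)
  also have "\<dots> \<le> (\<Sum>x\<in>A. \<Sum>y\<in>V. D x y * g y)" unfolding A_def by (rule ext[OF f])
  also have "\<dots> = (\<Sum>y\<in>V. g y * (\<Sum>x\<in>A. D x y))"
    by (subst sum.swap) (simp add: sum_distrib_left mult_ac)
  also have "\<dots> \<le> (\<Sum>y\<in>B. \<Sum>x\<in>A. D x y)" unfolding B_def by (rule ext[OF g])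
  also have "\<dots> = (\<Sum>x\<in>A. \<Sum>y\<in>B. D x y)" by (rule sum.swap)
  also have "\<dots> \<le> r" by (rule cut) (auto simp: A_def B_def)
  finally show ?thesis .
qed

lemma bilinear_abs_le:
  fixes D :: "'v \<Rightarrow> 'v \<Rightarrow> real"
  assumes fV: "finite V" and cut: "\<And>A B. A \<subseteq> V \<Longrightarrow> B \<subseteq> V \<Longrightarrow> \<bar>\<Sum>x\<in>A. \<Sum>y\<in>B. D x y\<bar> \<le> r"
    and f: "\<And>x. x \<in> V \<Longrightarrow> 0 \<le> f x \<and> f x \<le> 1" and g: "\<And>x. x \<in> V \<Longrightarrow> 0 \<le> g x \<and> g x \<le> 1"
  shows "\<bar>\<Sum>x\<in>V. \<Sum>y\<in>V. D x y * f x * g y\<bar> \<le> r"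
proof -
  have "(\<Sum>x\<in>V. \<Sum>y\<in>V. D x y * f x * g y) \<le> r"
    by (rule bilinear_le[OF fV _ f g]) (use cut in \<open>auto simp: abs_le_iff\<close>)
  moreover have "(\<Sum>x\<in>V. \<Sum>y\<in>V. (- D x y) * f x * g y) \<le> r"
    by (rule bilinear_le[OF fV _ f g]) (use cut in \<open>auto simp: abs_le_iff sum_negf\<close>)
  then have "- (\<Sum>x\<in>V. \<Sum>y\<in>V. D x y * f x * g y) \<le> r" by (simp add: sum_negf)
  ultimately show ?thesis by simp
qed

text \<open>Freeze all coordinates except \<open>i\<close> and \<open>j\<close>. No factor in
  \<open>P\<close> contains both, so the product splits into a function of \<open>x\<close> times a
  function of \<open>y\<close>, and the cut bound applies to each frozen tuple.\<close>

lemma counting_single: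
  fixes \<kappa> :: "nat \<times> nat \<Rightarrow> 'v \<Rightarrow> 'v \<Rightarrow> real" and r :: real
  assumes fV: "finite V" and fI: "finite I" and ij: "i \<in> I" "j \<in> I" "i \<noteq> j"
    and cut: "\<And>A B. A \<subseteq> V \<Longrightarrow> B \<subseteq> V \<Longrightarrow> \<bar>\<Sum>x\<in>A. \<Sum>y\<in>B. D x y\<bar> \<le> r"
    and P: "finite P" "P \<subseteq> I \<times> I" "(i, j) \<notin> P" "(j, i) \<notin> P" "\<And>l. (l, l) \<notin> P"
    and \<kappa>: "\<And>e x y. e \<in> P \<Longrightarrow> x \<in> V \<Longrightarrow> y \<in> V \<Longrightarrow> 0 \<le> \<kappa> e x y \<and> \<kappa> e x y \<le> 1"
  shows "\<bar>\<Sum>z\<in>PiE I (\<lambda>_. V). D (z i) (z j) * (\<Prod>e\<in>P. \<kappa> e (z (fst e)) (z (snd e)))\<bar>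
    \<le> card V ^ (card I - 2) * r"
proof -
  define Pj where "Pj = {e \<in> P. fst e = j \<or> snd e = j}"
  define Pn where "Pn = {e \<in> P. fst e \<noteq> j \<and> snd e \<noteq> j}"
  have PP: "P = Pj \<union> Pn" "Pj \<inter> Pn = {}" and fP: "finite Pj" "finite Pn"
    using P by (auto simp: Pj_def Pn_def)
  have "\<bar>\<Sum>x\<in>V. \<Sum>y\<in>V. D ((z(i := x, j := y)) i) ((z(i := x, j := y)) j) *
      (\<Prod>e\<in>P. \<kappa> e ((z(i := x, j := y)) (fst e)) ((z(i := x, j := y)) (snd e)))\<bar> \<le> r"
    if z: "z \<in> PiE (I - {i, j}) (\<lambda>_. V)" for z
  proof -
    define f where "f x = (\<Prod>e\<in>Pn. \<kappa> e ((z(i := x)) (fst e)) ((z(i := x)) (snd e)))" for x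
    define g where "g y = (\<Prod>e\<in>Pj. \<kappa> e ((z(j := y)) (fst e)) ((z(j := y)) (snd e)))" for y
    have "(\<Prod>e\<in>P. \<kappa> e ((z(i := x, j := y)) (fst e)) ((z(i := x, j := y)) (snd e))) = g y * f x" for x y
    proof -
      have "(\<Prod>e\<in>Pj. \<kappa> e ((z(i := x, j := y)) (fst e)) ((z(i := x, j := y)) (snd e))) = g y"
        unfolding g_def by (rule prod.cong) (use P ij in \<open>auto simp: Pj_def\<close>)
      moreover have "(\<Prod>e\<in>Pn. \<kappa> e ((z(i := x, j := y)) (fst e)) ((z(i := x, j := y)) (snd e))) = f x"
        unfolding f_def by (rule prod.cong) (use P ij in \<open>auto simp: Pn_def\<close>)
      ultimately show ?thesis unfolding PP(1) by (simp add: prod.union_disjoint[OF fP PP(2)])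
    qed
    then have "(\<Sum>x\<in>V. \<Sum>y\<in>V. D ((z(i := x, j := y)) i) ((z(i := x, j := y)) j) *
      (\<Prod>e\<in>P. \<kappa> e ((z(i := x, j := y)) (fst e)) ((z(i := x, j := y)) (snd e)))) =
      (\<Sum>x\<in>V. \<Sum>y\<in>V. D x y * f x * g y)"
      using ij by (simp add: mult_ac)
    moreover have "\<bar>\<Sum>x\<in>V. \<Sum>y\<in>V. D x y * f x * g y\<bar> \<le> r"
    proof (rule bilinear_abs_le[OF fV cut])
      have zV: "(z(i := x)) l \<in> V" if "x \<in> V" "l \<in> I" "l \<noteq> j" for x l
        using z that by (auto simp: PiE_iff)
      have zV': "(z(j := x)) l \<in> V" if "x \<in> V" "l \<in> I" "l \<noteq> i" for x l
        using z that by (auto simp: PiE_iff)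
      show "0 \<le> f x \<and> f x \<le> 1" if "x \<in> V" for x
      proof -
        have "0 \<le> \<kappa> e ((z(i := x)) (fst e)) ((z(i := x)) (snd e)) \<and> \<kappa> e ((z(i := x)) (fst e)) ((z(i := x)) (snd e)) \<le> 1"
          if "e \<in> Pn" for e
        proof (rule \<kappa>)
          obtain k l where e: "e = (k, l)" by force
          have "k \<noteq> j" "l \<noteq> j" "k \<in> I" "l \<in> I" using that P ij e by (auto simp: Pn_def)
          then show "(z(i := x)) (fst e) \<in> V" "(z(i := x)) (snd e) \<in> V"
            using zV[OF \<open>x \<in> V\<close>] e by (auto simp del: fun_upd_apply)
        qed (use that in \<open>auto simp: Pn_def\<close>)
        then show ?thesis unfolding f_def by (intro conjI prod_nonneg prod_le_1) auto
      qed
      show "0 \<le> g y \<and> g y \<le> 1" if "y \<in> V" for y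
      proof -
        have "0 \<le> \<kappa> e ((z(j := y)) (fst e)) ((z(j := y)) (snd e)) \<and> \<kappa> e ((z(j := y)) (fst e)) ((z(j := y)) (snd e)) \<le> 1"
          if "e \<in> Pj" for e
        proof (rule \<kappa>)
          obtain k l where e: "e = (k, l)" by force
          have "k \<noteq> i" "l \<noteq> i" "k \<in> I" "l \<in> I" using that P ij e by (auto simp: Pj_def)
          then show "(z(j := y)) (fst e) \<in> V" "(z(j := y)) (snd e) \<in> V"
            using zV'[OF \<open>y \<in> V\<close>] e by (auto simp del: fun_upd_apply)
        qed (use that in \<open>auto simp: Pj_def\<close>)
        then show ?thesis unfolding g_def by (intro conjI prod_nonneg prod_le_1) auto
      qed
    qed
    ultimately show ?thesis by simp
  qed
  then have "(\<Sum>z\<in>PiE (I - {i, j}) (\<lambda>_. V). \<bar>\<Sum>x\<in>V. \<Sum>y\<in>V. D ((z(i := x, j := y)) i) ((z(i := x, j := y)) j) *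
      (\<Prod>e\<in>P. \<kappa> e ((z(i := x, j := y)) (fst e)) ((z(i := x, j := y)) (snd e)))\<bar>)
     \<le> (\<Sum>z\<in>PiE (I - {i, j}) (\<lambda>_. V). r)"
    by (rule sum_mono)
  also have "\<dots> = card V ^ (card I - 2) * r"
  proof -
    have "card (I - {i, j}) = card I - 2" using ij fI by (subst card_Diff_subset) auto
    then show ?thesis using fI by (simp add: card_PiE)
  qed
  finally show ?thesis
    unfolding sum_PiE_pair[OF fI ij] by (rule order.trans[OF sum_abs])
qed

text \<open>The factors \<open>\<kappa> e\<close> are replaced by \<open>\<kappa>' e\<close> one at
  a time; each replacement is one application of \<open>counting_single\<close>.\<close>

lemma counting_lemma:
  fixes \<kappa> \<kappa>' :: "nat \<times> nat \<Rightarrow> 'v \<Rightarrow> 'v \<Rightarrow> real" and r :: real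
  assumes fV: "finite V"
    and P: "finite P" "P \<subseteq> {(i, j). i < j \<and> j < h}"
    and cut: "\<And>e. e \<in> P \<Longrightarrow> cut_close V (\<kappa> e) (\<kappa>' e) r"
    and \<kappa>: "\<And>e x y. e \<in> P \<Longrightarrow> x \<in> V \<Longrightarrow> y \<in> V \<Longrightarrow> 0 \<le> \<kappa> e x y \<and> \<kappa> e x y \<le> 1"
    and \<kappa>': "\<And>e x y. e \<in> P \<Longrightarrow> x \<in> V \<Longrightarrow> y \<in> V \<Longrightarrow> 0 \<le> \<kappa>' e x y \<and> \<kappa>' e x y \<le> 1"
  shows "\<bar>(\<Sum>z\<in>PiE {..<h} (\<lambda>_. V). \<Prod>e\<in>P. \<kappa> e (z (fst e)) (z (snd e))) -
      (\<Sum>z\<in>PiE {..<h} (\<lambda>_. V). \<Prod>e\<in>P. \<kappa>' e (z (fst e)) (z (snd e)))\<bar> \<le> card P * (card V ^ (h - 2) * r)"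
proof -
  define hyb where "hyb Q e = (if e \<in> Q then \<kappa>' e else \<kappa> e)" for Q e
  define S where "S k = (\<Sum>z\<in>PiE {..<h} (\<lambda>_. V). \<Prod>e\<in>P. k e (z (fst e)) (z (snd e)))"
    for k :: "nat \<times> nat \<Rightarrow> 'v \<Rightarrow> 'v \<Rightarrow> real"
  have "\<bar>S \<kappa> - S (hyb Q)\<bar> \<le> card Q * (card V ^ (h - 2) * r)" if "finite Q" "Q \<subseteq> P" for Q
    using that
  proof (induction Q)
    case empty
    have "hyb {} = \<kappa>" by (auto simp: hyb_def)
    then show ?case by simp
  next
    case (insert e Q)
    obtain i j where e: "e = (i, j)" by force
    have eP: "e \<in> P" "i < j" "j < h" using insert P e by auto
    define R where "R z = (\<Prod>e\<in>P - {e}. hyb Q e (z (fst e)) (z (snd e)))" for z :: "nat \<Rightarrow> 'v"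
    have 1: "(\<Prod>e\<in>P. hyb Q e (z (fst e)) (z (snd e))) = \<kappa> e (z i) (z j) * R z" for z
      using prod.remove[OF P(1) eP(1), of "\<lambda>e. hyb Q e (z (fst e)) (z (snd e))"] insert e
      by (simp add: R_def hyb_def)
    have 2: "(\<Prod>e'\<in>P. hyb (insert e Q) e' (z (fst e')) (z (snd e'))) = \<kappa>' e (z i) (z j) * R z" for z
    proof -
      have "(\<Prod>e'\<in>P - {e}. hyb (insert e Q) e' (z (fst e')) (z (snd e'))) = R z"
        unfolding R_def by (rule prod.cong) (auto simp: hyb_def)
      then show ?thesis
        using prod.remove[OF P(1) eP(1), of "\<lambda>e'. hyb (insert e Q) e' (z (fst e')) (z (snd e'))"] e
        by (simp add: hyb_def)
    qed
    have "S (hyb Q) - S (hyb (insert e Q)) = (\<Sum>z\<in>PiE {..<h} (\<lambda>_. V). (\<kappa> e (z i) (z j) - \<kappa>' e (z i) (z j)) * R z)"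
      unfolding S_def 1 2 by (simp add: sum_subtractf left_diff_distrib)
    also have "\<bar>\<dots>\<bar> \<le> card V ^ (card {..<h} - 2) * r"
      unfolding R_def
    proof (rule counting_single[OF fV, where D = "\<lambda>x y. \<kappa> e x y - \<kappa>' e x y"])
      show "\<bar>\<Sum>x\<in>A. \<Sum>y\<in>B. \<kappa> e x y - \<kappa>' e x y\<bar> \<le> r" if "A \<subseteq> V" "B \<subseteq> V" for A B
        using cut[OF eP(1)] that by (auto simp: cut_close_def)
      show "(j, i) \<notin> P - {e}" using P eP by force
      show "\<And>l. (l, l) \<notin> P - {e}" using P by force
      show "P - {e} \<subseteq> {..<h} \<times> {..<h}" using P by force
      show "0 \<le> hyb Q e' x y \<and> hyb Q e' x y \<le> 1" if "e' \<in> P - {e}" "x \<in> V" "y \<in> V" for e' x y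
        using \<kappa>[of e' x y] \<kappa>'[of e' x y] that by (simp add: hyb_def)
    qed (use eP e P in auto)
    finally have "\<bar>S (hyb Q) - S (hyb (insert e Q))\<bar> \<le> card V ^ (h - 2) * r" by simp
    moreover have "\<bar>S \<kappa> - S (hyb Q)\<bar> \<le> card Q * (card V ^ (h - 2) * r)" using insert by blast
    moreover have "real (card (insert e Q)) * (card V ^ (h - 2) * r) = card Q * (card V ^ (h - 2) * r) + card V ^ (h - 2) * r"
      using insert by (simp add: algebra_simps)
    ultimately show ?case by linarith
  qed
  from this[OF P(1) order.refl] have "\<bar>S \<kappa> - S (hyb P)\<bar> \<le> card P * (card V ^ (h - 2) * r)" .
  moreover have "S (hyb P) = S \<kappa>'" unfolding S_def by (intro sum.cong prod.cong refl) (auto simp: hyb_def)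
  ultimately show ?thesis unfolding S_def by simp
qed


section \<open>Blow-ups of dense patterns\<close>

lemma power_tangent:
  fixes x \<mu> :: real
  assumes "x \<ge> 0" "\<mu> > 0"
  shows "\<mu> * x ^ t \<ge> \<mu> ^ Suc t + t * \<mu> ^ t * (x - \<mu>)"
proof -
  have "1 + real t * (x / \<mu> - 1) \<le> (1 + (x / \<mu> - 1)) ^ t"
    by (rule Bernoulli_inequality) (use assms in simp)
  then have "\<mu> ^ Suc t * (1 + real t * (x / \<mu> - 1)) \<le> \<mu> ^ Suc t * (x / \<mu>) ^ t"
    using assms by (intro mult_left_mono) auto
  also have "\<mu> ^ Suc t * (x / \<mu>) ^ t = \<mu> * x ^ t" using assms by (simp add: power_divide)
  also have "\<mu> ^ Suc t * (1 + real t * (x / \<mu> - 1)) = \<mu> ^ Suc t + t * \<mu> ^ t * (x - \<mu>)"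
    using assms by (simp add: field_simps)
  finally show ?thesis .
qed

text \<open>Jensen's inequality for \<open>x ^ t\<close> in tangent form. \<open>G\<close> may have
  fewer than \<open>N\<close> elements; this only helps, because the tangent at \<open>\<mu>\<close>
  has a nonpositive constant term.\<close>

lemma power_mean_card:
  fixes c :: "'z \<Rightarrow> real" and N :: real
  assumes "finite G" "card G \<le> N" "\<And>z. z \<in> G \<Longrightarrow> c z \<ge> 0" "t \<ge> 1" "\<mu> \<ge> 0" "sum c G \<ge> \<mu> * N"
  shows "(\<Sum>z\<in>G. c z ^ t) \<ge> \<mu> ^ t * N"
proof (cases "\<mu> = 0")
  case True
  then show ?thesis using assms by (auto simp: zero_power intro!: sum_nonneg)
next
  case False
  then have m: "\<mu> > 0" using assms by simp
  have "\<mu> * (\<mu> ^ t * N) = N * (\<mu> ^ Suc t - t * \<mu> ^ t * \<mu>) + t * \<mu> ^ t * (\<mu> * N)" by (simp add: algebra_simps)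
  also have "\<dots> \<le> card G * (\<mu> ^ Suc t - t * \<mu> ^ t * \<mu>) + t * \<mu> ^ t * sum c G"
  proof (rule add_mono)
    have "\<mu> ^ Suc t - t * \<mu> ^ t * \<mu> = - ((real t - 1) * \<mu> ^ Suc t)" by (simp add: algebra_simps)
    also have "\<dots> \<le> 0" using assms(4) m by simp
    finally show "N * (\<mu> ^ Suc t - t * \<mu> ^ t * \<mu>) \<le> card G * (\<mu> ^ Suc t - t * \<mu> ^ t * \<mu>)"
      using assms(2) by (intro mult_right_mono_neg) auto
  qed (use assms m in \<open>auto intro!: mult_left_mono\<close>)
  also have "\<dots> = (\<Sum>z\<in>G. \<mu> ^ Suc t + t * \<mu> ^ t * (c z - \<mu>))"
  proof -
    have "(\<Sum>z\<in>G. \<mu> ^ Suc t + t * \<mu> ^ t * (c z - \<mu>)) = card G * \<mu> ^ Suc t + t * \<mu> ^ t * (sum c G - card G * \<mu>)"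
      by (simp only: sum.distrib sum_distrib_left[symmetric] sum_subtractf sum_constant)
    then show ?thesis by (simp add: algebra_simps)
  qed
  also have "\<dots> \<le> (\<Sum>z\<in>G. \<mu> * c z ^ t)"
    by (intro sum_mono power_tangent assms m)
  finally have "\<mu> * (\<mu> ^ t * N) \<le> \<mu> * (\<Sum>z\<in>G. c z ^ t)" by (simp add: sum_distrib_left)
  then show ?thesis using m by simp
qed

text \<open>Parts are blown up one after another; this is the stage after \<open>l\<close> of
  them.\<close>

definition blow_index :: "nat \<Rightarrow> nat \<Rightarrow> nat \<Rightarrow> (nat \<times> nat) set" where
  "blow_index m t l = {(i, s). i < m \<and> s < (if i < l then t else 1)}"

text \<open>Pairs inside the same part are left free; Ramsey's theorem will take care of their
  types.\<close>

definition typed :: "'v set \<Rightarrow> ('v \<Rightarrow> 'v \<Rightarrow> 'p) \<Rightarrow> (nat \<Rightarrow> nat \<Rightarrow> 'p) \<Rightarrow> (nat \<times> nat) set \<Rightarrow> (nat \<times> nat \<Rightarrow> 'v) set" where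
  "typed V \<tau> T J = {y \<in> PiE J (\<lambda>_. V). \<forall>i s j s'. (i, s) \<in> J \<and> (j, s') \<in> J \<and> i \<noteq> j \<longrightarrow> \<tau> (y (i, s)) (y (j, s')) = T i j}"

lemma finite_blow_index: "finite (blow_index m t l)"
  by (rule finite_subset[of _ "{..<m} \<times> {..<max t 1}"]) (auto simp: blow_index_def split: if_splits)

lemma typed_PiE: "y \<in> typed V \<tau> T J \<Longrightarrow> y \<in> PiE J (\<lambda>_. V)"
  by (simp add: typed_def)

lemma typed_type:
  "y \<in> typed V \<tau> T J \<Longrightarrow> (i, s) \<in> J \<Longrightarrow> (j, s') \<in> J \<Longrightarrow> i \<noteq> j \<Longrightarrow> \<tau> (y (i, s)) (y (j, s')) = T i j"
  by (simp add: typed_def)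

lemma typedI:
  assumes "y \<in> PiE J (\<lambda>_. V)"
    "\<And>i s j s'. (i, s) \<in> J \<Longrightarrow> (j, s') \<in> J \<Longrightarrow> i \<noteq> j \<Longrightarrow> \<tau> (y (i, s)) (y (j, s')) = T i j"
  shows "y \<in> typed V \<tau> T J"
  using assms by (simp add: typed_def)

lemma finite_typed: "finite V \<Longrightarrow> finite J \<Longrightarrow> finite (typed V \<tau> T J)"
  unfolding typed_def by (simp add: finite_PiE)

text \<open>Fix the coordinates \<open>z\<close> outside part \<open>l\<close>. The candidates
  \<open>N z\<close> for the single vertex of this part may be chosen \<open>t\<close> times
  independently, and convexity bounds the sum of \<open>card (N z) ^ t\<close> from below in terms
  of the sum of \<open>card (N z)\<close>.\<close>

lemma blow_up_step:
  fixes d :: real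
  assumes fV: "finite V" and sym: "\<And>x y. \<tau> x y = \<tau> y x" and symT: "\<And>i j. T i j = T j i"
    and l: "l < m" and t: "t \<ge> 1" and d: "(d :: real) \<ge> 0"
    and dens: "card (typed V \<tau> T (blow_index m t l)) \<ge> d * card V ^ card (blow_index m t l)"
  shows "card (typed V \<tau> T (blow_index m t (Suc l))) \<ge> d ^ t * card V ^ card (blow_index m t (Suc l))"
proof -
  let ?n = "card V"
  define J where "J = {p \<in> blow_index m t l. fst p \<noteq> l}"
  have fJ: "finite J" using finite_blow_index by (simp add: J_def)
  have J0: "blow_index m t l = insert (l, 0) J" "(l, 0) \<notin> J"
    using l by (auto simp: J_def blow_index_def split: if_splits)
  have J1: "blow_index m t (Suc l) = J \<union> {l} \<times> {..<t}" "J \<inter> {l} \<times> {..<t} = {}"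
    using l by (auto simp: J_def blow_index_def less_Suc_eq split: if_splits)
  have cJ1: "card (blow_index m t (Suc l)) = card J + t"
    unfolding J1(1) using fJ J1(2) by (subst card_Un_disjoint) (auto simp: card_cartesian_product)
  have Jl: "i \<noteq> l" if "(i, s) \<in> J" for i s using that by (auto simp: J_def)
  define G where "G = typed V \<tau> T J"
  define N where "N z = {v \<in> V. \<forall>j s'. (j, s') \<in> J \<longrightarrow> \<tau> v (z (j, s')) = T l j}" for z
  have fG: "finite G" unfolding G_def by (rule finite_typed[OF fV fJ])
  have fN: "finite (N z)" for z using fV by (simp add: N_def)
  have cG: "card G \<le> ?n ^ card J"
  proof -
    have "card G \<le> card (PiE J (\<lambda>_. V))"
      by (rule card_mono) (use fJ fV in \<open>auto simp: G_def typed_def intro: finite_PiE\<close>)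
    then show ?thesis using fJ by (simp add: card_PiE)
  qed
  have "card (typed V \<tau> T (blow_index m t l)) \<le> card (Sigma G N)"
  proof (rule card_inj_on_le[where f = "\<lambda>y. (restrict y J, y (l, 0))"])
    show "inj_on (\<lambda>y. (restrict y J, y (l, 0))) (typed V \<tau> T (blow_index m t l))"
    proof (rule inj_onI)
      fix y y' assume y: "y \<in> typed V \<tau> T (blow_index m t l)" "y' \<in> typed V \<tau> T (blow_index m t l)"
        and eq: "(restrict y J, y (l, 0)) = (restrict y' J, y' (l, 0))"
      have "y p = y' p" if "p \<in> insert (l, 0) J" for p
        using that eq by (metis Pair_inject insert_iff restrict_apply')
      then show "y = y'" using y unfolding typed_def J0(1)
        by (intro PiE_ext[of y "insert (l, 0) J" "\<lambda>_. V"]) auto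
    qed
    show "(\<lambda>y. (restrict y J, y (l, 0))) ` typed V \<tau> T (blow_index m t l) \<subseteq> Sigma G N"
    proof (rule image_subsetI)
      fix y assume y: "y \<in> typed V \<tau> T (blow_index m t l)"
      note yP = typed_PiE[OF y, unfolded J0(1)] and yt = typed_type[OF y, unfolded J0(1)]
      have "restrict y J \<in> G"
        unfolding G_def by (rule typedI) (use yP yt in \<open>auto simp: PiE_iff\<close>)
      moreover have "y (l, 0) \<in> N (restrict y J)"
        unfolding N_def using yP yt[of l 0] Jl by (auto simp: PiE_iff)
      ultimately show "(restrict y J, y (l, 0)) \<in> Sigma G N" by simp
    qed
    show "finite (Sigma G N)" using fG fN by simp
  qed
  also have "card (Sigma G N) = (\<Sum>z\<in>G. card (N z))" using fG fN by simp
  finally have low: "d * real ?n ^ card (blow_index m t l) \<le> (\<Sum>z\<in>G. real (card (N z)))"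
    using dens by (simp flip: of_nat_sum)
  have "(\<Sum>z\<in>G. real (card (N z)) ^ t) \<ge> (d * ?n) ^ t * (?n ^ card J)"
  proof (rule power_mean_card[OF fG])
    show "real (card G) \<le> real (?n ^ card J)" using cG by (simp only: of_nat_le_iff)
    show "d * ?n * real (?n ^ card J) \<le> (\<Sum>z\<in>G. real (card (N z)))"
      using low fJ J0 by (simp add: mult.assoc)
  qed (use t d in auto)
  also have "(d * ?n) ^ t * (?n ^ card J) = d ^ t * ?n ^ card (blow_index m t (Suc l))"
    by (simp add: cJ1 power_mult_distrib power_add)
  also have "(\<Sum>z\<in>G. real (card (N z)) ^ t) = card (SIGMA z:G. PiE ({l} \<times> {..<t}) (\<lambda>_. N z))"
    using fG fN by (simp add: card_PiE finite_PiE card_cartesian_product)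
  also have "card (SIGMA z:G. PiE ({l} \<times> {..<t}) (\<lambda>_. N z)) \<le> card (typed V \<tau> T (blow_index m t (Suc l)))"
  proof (rule card_inj_on_le[where f = "\<lambda>(z, w) p. if p \<in> J then z p else w p"])
    show "inj_on (\<lambda>(z, w) p. if p \<in> J then z p else w p) (SIGMA z:G. PiE ({l} \<times> {..<t}) (\<lambda>_. N z))"
    proof (rule inj_onI, clarify)
      fix z w z' w'
      assume z: "z \<in> G" "z' \<in> G" and w: "w \<in> PiE ({l} \<times> {..<t}) (\<lambda>_. N z)" "w' \<in> PiE ({l} \<times> {..<t}) (\<lambda>_. N z')"
        and eq: "(\<lambda>p. if p \<in> J then z p else w p) = (\<lambda>p. if p \<in> J then z' p else w' p)"
      have "z p = z' p" if "p \<in> J" for p using fun_cong[OF eq, of p] that by simp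
      then have zz: "z = z'" using z unfolding G_def typed_def
        by (intro PiE_ext[of z J "\<lambda>_. V"]) auto
      have "w p = w' p" if "p \<in> {l} \<times> {..<t}" for p
      proof -
        have "p \<notin> J" using that J1(2) by blast
        then show ?thesis using fun_cong[OF eq, of p] by simp
      qed
      then have "w = w'" using w zz by (intro PiE_ext[of w "{l} \<times> {..<t}" "\<lambda>_. N z"]) auto
      with zz show "z = z' \<and> w = w'" by simp
    qed
    show "(\<lambda>(z, w) p. if p \<in> J then z p else w p) ` (SIGMA z:G. PiE ({l} \<times> {..<t}) (\<lambda>_. N z))
      \<subseteq> typed V \<tau> T (blow_index m t (Suc l))"
    proof (rule image_subsetI, clarify)
      fix z w assume z: "z \<in> G" and w: "w \<in> PiE ({l} \<times> {..<t}) (\<lambda>_. N z)"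
      let ?y = "\<lambda>p. if p \<in> J then z p else w p"
      note zP = typed_PiE[OF z[unfolded G_def]] and zt = typed_type[OF z[unfolded G_def]]
      have wN: "w (l, s) \<in> N z" if "s < t" for s using w that by (auto simp: PiE_iff)
      have wV: "w (l, s) \<in> V" if "s < t" for s using wN[OF that] by (simp add: N_def)
      have wt: "\<tau> (w (l, s)) (z (j, s')) = T l j" if "s < t" "(j, s') \<in> J" for s j s'
        using wN[OF that(1)] that(2) by (simp add: N_def)
      have nJ: "(l, s) \<notin> J" for s using Jl by blast
      have "?y \<in> PiE (J \<union> {l} \<times> {..<t}) (\<lambda>_. V)"
        using zP w wV nJ by (auto simp: PiE_iff extensional_def)
      moreover have "\<tau> (?y (i, s)) (?y (j, s')) = T i j"
        if "(i, s) \<in> J \<union> {l} \<times> {..<t}" "(j, s') \<in> J \<union> {l} \<times> {..<t}" "i \<noteq> j" for i s j s'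
      proof -
        consider "(i, s) \<in> J" "(j, s') \<in> J" | "i = l" "s < t" "(j, s') \<in> J" | "(i, s) \<in> J" "j = l" "s' < t"
          using \<open>(i, s) \<in> J \<union> {l} \<times> {..<t}\<close> \<open>(j, s') \<in> J \<union> {l} \<times> {..<t}\<close> \<open>i \<noteq> j\<close> by auto
        then show ?thesis
        proof cases
          case 1 then show ?thesis using zt[OF 1 \<open>i \<noteq> j\<close>] by simp
        next
          case 2 then show ?thesis using wt nJ by simp
        next
          case 3
          then show ?thesis using wt[of s' i s] nJ sym[of "z (i, s)"] symT[of i l] by simp
        qed
      qed
      ultimately show "?y \<in> typed V \<tau> T (blow_index m t (Suc l))"
        unfolding J1(1) by (intro typedI)
    qed
    show "finite (typed V \<tau> T (blow_index m t (Suc l)))"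
      by (rule finite_typed[OF fV finite_blow_index])
  qed
  finally show ?thesis by simp
qed

lemma blow_up:
  fixes d :: real
  assumes fV: "finite V" and sym: "\<And>x y. \<tau> x y = \<tau> y x" and symT: "\<And>i j. T i j = T j i"
    and t: "t \<ge> 1" and d: "(d :: real) \<ge> 0"
    and dens: "card (typed V \<tau> T (blow_index m t 0)) \<ge> d * card V ^ card (blow_index m t 0)"
  shows "l \<le> m \<Longrightarrow> card (typed V \<tau> T (blow_index m t l)) \<ge> d ^ (t ^ l) * card V ^ card (blow_index m t l)"
proof (induction l)
  case 0
  then show ?case using dens by simp
next
  case (Suc l)
  have "card (typed V \<tau> T (blow_index m t (Suc l))) \<ge> (d ^ (t ^ l)) ^ t * card V ^ card (blow_index m t (Suc l))"
    by (rule blow_up_step[OF fV sym symT]) (use Suc t d in auto)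
  then show ?case by (simp add: power_mult[symmetric] mult.commute)
qed

lemma card_le_card_times_fibre:
  assumes "finite A" "finite B" "f ` A \<subseteq> B" "A \<noteq> {}"
  shows "\<exists>x\<in>A. card A \<le> card B * card {y \<in> A. f y = f x}"
proof -
  have "f ` A \<noteq> {}" "finite (f ` A)" using assms by auto
  then obtain b where b: "b \<in> f ` A" "\<And>c. c \<in> f ` A \<Longrightarrow> card {y \<in> A. f y = c} \<le> card {y \<in> A. f y = b}"
    using finite_ex_maximizer[of "f ` A" "\<lambda>c. card {y \<in> A. f y = c}"] by blast
  have "card A = (\<Sum>c\<in>f ` A. card {y \<in> A. f y = c})"
    using sum.image_gen[OF assms(1), of "\<lambda>_. 1::nat" f] by simp
  also have "\<dots> \<le> card (f ` A) * card {y \<in> A. f y = b}"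
    using sum_bounded_above[of "f ` A" "\<lambda>c. card {y \<in> A. f y = c}" "card {y \<in> A. f y = b}"] b(2) by simp
  also have "\<dots> \<le> card B * card {y \<in> A. f y = b}"
    by (rule mult_right_mono) (use assms in \<open>auto intro: card_mono\<close>)
  finally show ?thesis using b(1) by blast
qed

lemma card_ptype: "card (UNIV :: ptype set) = 3" "finite (UNIV :: ptype set)"
proof -
  have U: "(UNIV :: ptype set) = {White, Black, Gray}" by (auto intro: ptype.exhaust)
  show "card (UNIV :: ptype set) = 3" "finite (UNIV :: ptype set)" unfolding U by auto
qed

text \<open>The mean cost of a tuple is at most \<open>1 - \<eta>\<close> times \<open>m^2\<close>,
  so a proportion of at least \<open>\<eta> / 2\<close> of the tuples costs less than
  \<open>1 - \<eta> / 2\<close> times \<open>m^2\<close>. One of the \<open>3 ^ (m * m)\<close>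
  tables of types accounts for its share of these.\<close>

lemma cheap_pattern:
  fixes \<tau> :: "'v \<Rightarrow> 'v \<Rightarrow> ptype" and \<eta> :: real
  assumes fV: "finite V" "V \<noteq> {}" and \<eta>: "0 < \<eta>" "\<eta> \<le> 1"
    and cheap: "(\<Sum>x\<in>V. \<Sum>y\<in>V. pcost a b (\<tau> x y)) < (1 - \<eta>) * (card V)\<^sup>2"
    and m: "m \<ge> 2"
  obtains x0 where "(\<Sum>i<m. \<Sum>j\<in>{..<m} - {i}. pcost a b (\<tau> (x0 i) (x0 j))) < (real m)\<^sup>2 * (1 - \<eta> / 2)"
    "card {x \<in> PiE {..<m} (\<lambda>_. V). \<forall>i<m. \<forall>j<m. i \<noteq> j \<longrightarrow> \<tau> (x i) (x j) = \<tau> (x0 i) (x0 j)} \<ge>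
       \<eta> / 2 / 3 ^ (m * m) * card V ^ m"
proof -
  let ?n = "real (card V)"
  let ?X = "PiE {..<m} (\<lambda>_. V)"
  define C where "C = (\<Sum>x\<in>V. \<Sum>y\<in>V. pcost a b (\<tau> x y))"
  define s where "s x = (\<Sum>i<m. \<Sum>j\<in>{..<m} - {i}. pcost a b (\<tau> (x i) (x j)))" for x :: "nat \<Rightarrow> 'v"
  have n: "?n > 0" using fV by (simp add: card_gt_0_iff)
  have p0: "pcost a b t \<ge> 0" for t by (cases t) (auto simp: pcost_def)
  have C0: "C \<ge> 0" unfolding C_def using p0 by (intro sum_nonneg)
  have fX: "finite ?X" using fV by (simp add: finite_PiE)
  have cX: "card ?X = card V ^ m" by (simp add: card_PiE)
  have "(\<Sum>x\<in>?X. s x) = (\<Sum>i<m. \<Sum>j\<in>{..<m} - {i}. \<Sum>x\<in>?X. pcost a b (\<tau> (x i) (x j)))"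
    unfolding s_def by (subst sum.swap) (intro sum.cong refl sum.swap)
  also have "\<dots> = (\<Sum>i<m. \<Sum>j\<in>{..<m} - {i}. ?n ^ (m - 2) * C)"
  proof (intro sum.cong refl)
    fix i j assume "i \<in> {..<m}" "j \<in> {..<m} - {i}"
    then show "(\<Sum>x\<in>?X. pcost a b (\<tau> (x i) (x j))) = ?n ^ (m - 2) * C"
      unfolding C_def using sum_PiE_pair_eq[of "{..<m}" i j "\<lambda>x y. pcost a b (\<tau> x y)" V] by auto
  qed
  also have "\<dots> = real (m * (m - 1)) * (?n ^ (m - 2) * C)"
    using m by (simp add: of_nat_diff)
  also have "\<dots> \<le> m\<^sup>2 * (?n ^ (m - 2) * C)"
  proof (rule mult_right_mono)
    have "m * (m - 1) \<le> m\<^sup>2" by (simp add: power2_eq_square)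
    then show "real (m * (m - 1)) \<le> real (m\<^sup>2)" by (simp only: of_nat_le_iff)
  qed (use C0 in simp)
  also have "\<dots> \<le> m\<^sup>2 * (?n ^ (m - 2) * ((1 - \<eta>) * (card V)\<^sup>2))"
    using cheap unfolding C_def by (intro mult_left_mono) auto
  also have "\<dots> = m\<^sup>2 * (1 - \<eta>) * ?n ^ m"
  proof -
    have "?n ^ m = ?n ^ (m - 2) * ?n\<^sup>2" using m by (metis le_add_diff_inverse2 power_add)
    then show ?thesis by (simp add: mult_ac)
  qed
  finally have total: "(\<Sum>x\<in>?X. s x) \<le> m\<^sup>2 * (1 - \<eta>) * ?n ^ m" .
  define L where "L = {x \<in> ?X. s x < m\<^sup>2 * (1 - \<eta> / 2)}"
  have fL: "finite L" "L \<subseteq> ?X" using fX by (auto simp: L_def)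
  have "(\<Sum>x\<in>?X - L. m\<^sup>2 * (1 - \<eta> / 2)) \<le> (\<Sum>x\<in>?X - L. s x)"
  proof (rule sum_mono)
    fix x assume "x \<in> ?X - L"
    then have "\<not> s x < m\<^sup>2 * (1 - \<eta> / 2)" unfolding L_def by blast
    then show "m\<^sup>2 * (1 - \<eta> / 2) \<le> s x" by linarith
  qed
  also have "\<dots> \<le> (\<Sum>x\<in>?X. s x)"
    by (rule sum_mono2) (use fX p0 in \<open>auto simp: s_def intro!: sum_nonneg\<close>)
  also note total
  also have "(\<Sum>x\<in>?X - L. m\<^sup>2 * (1 - \<eta> / 2)) = real (card ?X - card L) * (m\<^sup>2 * (1 - \<eta> / 2))"
    using fL by (simp add: card_Diff_subset)
  also have "real (card ?X - card L) = ?n ^ m - card L"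
    using card_mono[OF fX fL(2)] cX by (simp add: of_nat_diff)
  finally have "m\<^sup>2 * ((?n ^ m - card L) * (1 - \<eta> / 2)) \<le> m\<^sup>2 * ((1 - \<eta>) * ?n ^ m)" by (simp add: mult_ac)
  then have "(?n ^ m - card L) * (1 - \<eta> / 2) \<le> (1 - \<eta>) * ?n ^ m" using m by simp
  then have "\<eta> / 2 * ?n ^ m \<le> card L * (1 - \<eta> / 2)" by (simp add: algebra_simps)
  also have "\<dots> \<le> card L" using \<eta> by (simp add: mult_left_le)
  finally have cL: "\<eta> / 2 * ?n ^ m \<le> card L" .
  then have "card L > 0" using \<eta> n by (smt (verit) mult_pos_pos of_nat_0_less_iff zero_less_power half_gt_zero)
  then have Lne: "L \<noteq> {}" by auto
  let ?I = "{..<m} \<times> {..<m}"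
  define \<Phi> where "\<Phi> x = restrict (\<lambda>p. \<tau> (x (fst p)) (x (snd p))) ?I" for x :: "nat \<Rightarrow> 'v"
  have "\<Phi> ` L \<subseteq> PiE ?I (\<lambda>_. UNIV)"
    unfolding \<Phi>_def by (rule image_subsetI) (simp only: restrict_PiE_iff UNIV_I, blast)
  moreover have "finite (PiE ?I (\<lambda>_. UNIV :: ptype set))" by (simp add: finite_PiE card_ptype)
  ultimately have "\<exists>x0\<in>L. card L \<le> card (PiE ?I (\<lambda>_. UNIV :: ptype set)) * card {x \<in> L. \<Phi> x = \<Phi> x0}"
    using Lne by (intro card_le_card_times_fibre fL(1))
  then obtain x0 where x0: "x0 \<in> L" "card L \<le> card (PiE ?I (\<lambda>_. UNIV :: ptype set)) * card {x \<in> L. \<Phi> x = \<Phi> x0}"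
    by blast
  have c3: "card (PiE ?I (\<lambda>_. UNIV :: ptype set)) = 3 ^ (m * m)"
    by (simp add: card_PiE card_ptype card_cartesian_product)
  define Z where "Z = {x \<in> ?X. \<forall>i<m. \<forall>j<m. i \<noteq> j \<longrightarrow> \<tau> (x i) (x j) = \<tau> (x0 i) (x0 j)}"
  have "card {x \<in> L. \<Phi> x = \<Phi> x0} \<le> card Z"
  proof (rule card_mono)
    show "finite Z" using fX by (simp add: Z_def)
    show "{x \<in> L. \<Phi> x = \<Phi> x0} \<subseteq> Z"
    proof clarify
      fix x assume x: "x \<in> L" "\<Phi> x = \<Phi> x0"
      have "\<tau> (x i) (x j) = \<tau> (x0 i) (x0 j)" if "i < m" "j < m" for i j
        using fun_cong[OF x(2), of "(i, j)"] that by (simp add: \<Phi>_def)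
      then show "x \<in> Z" using x fL by (auto simp: Z_def)
    qed
  qed
  then have "real (card L) \<le> 3 ^ (m * m) * real (card Z)"
  proof -
    assume "card {x \<in> L. \<Phi> x = \<Phi> x0} \<le> card Z"
    then have "card L \<le> 3 ^ (m * m) * card Z"
      using x0(2) unfolding c3 by (meson le_trans mult_le_mono2)
    then have "real (card L) \<le> real (3 ^ (m * m) * card Z)" by (simp only: of_nat_le_iff)
    then show ?thesis by simp
  qed
  then have "\<eta> / 2 * ?n ^ m \<le> 3 ^ (m * m) * real (card Z)" using cL by linarith
  then have "card Z \<ge> \<eta> / 2 / 3 ^ (m * m) * ?n ^ m" by (simp add: field_simps)
  moreover have "s x0 < m\<^sup>2 * (1 - \<eta> / 2)" using x0 by (simp add: L_def)
  ultimately show thesis using that[of x0] unfolding s_def Z_def by simp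
qed

definition ramsey_bound :: "nat \<Rightarrow> nat \<Rightarrow> bool" where
  "ramsey_bound t h \<longleftrightarrow> (\<forall>R :: nat \<Rightarrow> nat \<Rightarrow> bool. (\<forall>x y. R x y = R y x) \<longrightarrow>
     (\<exists>A\<subseteq>{..<t}. card A = h \<and>
        ((\<forall>x\<in>A. \<forall>y\<in>A. x \<noteq> y \<longrightarrow> R x y) \<or> (\<forall>x\<in>A. \<forall>y\<in>A. x \<noteq> y \<longrightarrow> \<not> R x y))))"

lemma ramsey_bound_exists: "\<exists>t\<ge>1. ramsey_bound t h"
proof -
  obtain t where t: "t \<ge> 1" "\<And>(V::nat set) E. finite V \<Longrightarrow> card V \<ge> t \<Longrightarrow>
      \<exists>R\<subseteq>V. card R = h \<and> Ramsey.clique R E \<or> card R = h \<and> Ramsey.indep R E"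
    using ramsey2[of h h] by metis
  have "\<exists>A\<subseteq>{..<t}. card A = h \<and> ((\<forall>x\<in>A. \<forall>y\<in>A. x \<noteq> y \<longrightarrow> R x y) \<or> (\<forall>x\<in>A. \<forall>y\<in>A. x \<noteq> y \<longrightarrow> \<not> R x y))"
    if sym: "\<forall>x y. R x y = R y x" for R :: "nat \<Rightarrow> nat \<Rightarrow> bool"
  proof -
    define E where "E = {{x, y} | x y. R x y}"
    have E: "{x, y} \<in> E \<longleftrightarrow> R x y" for x y
      using sym by (auto simp: E_def doubleton_eq_iff)
    obtain A where "A \<subseteq> {..<t}" "card A = h \<and> Ramsey.clique A E \<or> card A = h \<and> Ramsey.indep A E"
      using t(2)[of "{..<t}" E] by auto
    then show ?thesis
      unfolding Ramsey.clique_def Ramsey.indep_def E by blast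
  qed
  then show ?thesis using t(1) unfolding ramsey_bound_def by blast
qed

text \<open>Entries may coincide; tuples with repetitions are discarded only in the final
  count.\<close>

definition compat_tuples :: "'v set \<Rightarrow> ('v \<Rightarrow> 'v \<Rightarrow> ptype) \<Rightarrow> nat \<Rightarrow> (nat \<Rightarrow> nat \<Rightarrow> bool) \<Rightarrow> (nat \<Rightarrow> 'v) set" where
  "compat_tuples V \<tau> h adj =
     {z \<in> PiE {..<h} (\<lambda>_. V). \<forall>u<h. \<forall>v<h. u \<noteq> v \<longrightarrow> pcompat (\<tau> (z u) (z v)) (adj u v)}"

text \<open>The monochromatic sets found by Ramsey's theorem play the role of white and black clusters.\<close>

lemma typed_blow_up_embeds:
  assumes t: "ramsey_bound t h"
    and sym: "\<And>x y. \<tau> x y = \<tau> y x"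
    and emb: "\<And>white. crk_embeds {..<h} adj {..<m} white T"
    and y: "y \<in> typed V \<tau> T (blow_index m t m)"
  shows "\<exists>\<psi>\<in>PiE {..<h} (\<lambda>_. blow_index m t m). inj_on \<psi> {..<h} \<and>
     (\<forall>u<h. \<forall>v<h. u \<noteq> v \<longrightarrow> pcompat (\<tau> (y (\<psi> u)) (y (\<psi> v))) (adj u v))"
proof -
  have J: "(i, s) \<in> blow_index m t m \<longleftrightarrow> i < m \<and> s < t" for i s
    by (auto simp: blow_index_def)
  have "\<exists>A\<subseteq>{..<t}. card A = h \<and> ((\<forall>x\<in>A. \<forall>x'\<in>A. x \<noteq> x' \<longrightarrow> \<tau> (y (i, x)) (y (i, x')) = Black) \<or>
     (\<forall>x\<in>A. \<forall>x'\<in>A. x \<noteq> x' \<longrightarrow> \<tau> (y (i, x)) (y (i, x')) \<noteq> Black))" for i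
    by (rule t[unfolded ramsey_bound_def, rule_format]) (simp add: sym)
  then obtain A where A: "\<And>i. A i \<subseteq> {..<t}" "\<And>i. card (A i) = h"
    "\<And>i. (\<forall>x\<in>A i. \<forall>x'\<in>A i. x \<noteq> x' \<longrightarrow> \<tau> (y (i, x)) (y (i, x')) = Black) \<or>
     (\<forall>x\<in>A i. \<forall>x'\<in>A i. x \<noteq> x' \<longrightarrow> \<tau> (y (i, x)) (y (i, x')) \<noteq> Black)"
    by metis
  \<comment> \<open>Gray pairs inside a part count as not black, which is safe because a gray type
    also admits nonedges.\<close>
  define white where "white i \<longleftrightarrow> \<not> (\<forall>x\<in>A i. \<forall>x'\<in>A i. x \<noteq> x' \<longrightarrow> \<tau> (y (i, x)) (y (i, x')) = Black)" for i
  have "\<exists>e. bij_betw e {..<h} (A i)" for i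
    by (rule finite_same_card_bij) (use A finite_subset[OF A(1)] in auto)
  then obtain e where e: "\<And>i. bij_betw (e i) {..<h} (A i)" by metis
  obtain \<phi> where \<phi>: "\<phi> ` {..<h} \<subseteq> {..<m}"
    "\<forall>u\<in>{..<h}. \<forall>v\<in>{..<h}. u \<noteq> v \<longrightarrow>
        (if \<phi> u = \<phi> v then adj u v \<longleftrightarrow> \<not> white (\<phi> u) else pcompat (T (\<phi> u) (\<phi> v)) (adj u v))"
    using emb[of white] unfolding crk_embeds_def by (elim exE conjE, intro that)
  \<comment> \<open>In whatever cluster \<open>u\<close> lands, it takes the place numbered
    \<open>u\<close> among the \<open>h\<close> places there, so vertices sharing a cluster never
    collide.\<close>
  define \<psi> where "\<psi> = restrict (\<lambda>u. (\<phi> u, e (\<phi> u) u)) {..<h}"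
  have eA: "e i u \<in> A i" if "u < h" for i u using e[of i] that by (auto simp: bij_betw_def)
  have eT: "e i u < t" if "u < h" for i u using eA[OF that] A(1) by blast
  have einj: "e i u \<noteq> e i v" if "u < h" "v < h" "u \<noteq> v" for i u v
    using e[of i] that by (auto simp: bij_betw_def inj_on_def)
  have \<phi>m: "\<phi> u < m" if "u < h" for u using \<phi>(1) that by auto
  show ?thesis
  proof (intro bexI[of _ \<psi>] conjI allI impI)
    show "\<psi> \<in> PiE {..<h} (\<lambda>_. blow_index m t m)"
      unfolding \<psi>_def using \<phi>m eT by (auto simp: J)
    show "inj_on \<psi> {..<h}"
    proof (rule inj_onI)
      fix u v assume uv: "u \<in> {..<h}" "v \<in> {..<h}" "\<psi> u = \<psi> v"
      then have "e (\<phi> u) u = e (\<phi> u) v" by (auto simp: \<psi>_def)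
      then show "u = v" using einj[of u v "\<phi> u"] uv by auto
    qed
    fix u v assume uv: "u < h" "v < h" "u \<noteq> v"
    show "pcompat (\<tau> (y (\<psi> u)) (y (\<psi> v))) (adj u v)"
    proof (cases "\<phi> u = \<phi> v")
      case True
      then have ad: "adj u v \<longleftrightarrow> \<not> white (\<phi> u)" using \<phi>(2) uv by auto
      have el: "e (\<phi> u) u \<in> A (\<phi> u)" "e (\<phi> u) v \<in> A (\<phi> u)" "e (\<phi> u) u \<noteq> e (\<phi> u) v"
        using eA einj uv by auto
      have "\<tau> (y (\<phi> u, e (\<phi> u) u)) (y (\<phi> u, e (\<phi> u) v)) = Black \<longleftrightarrow> \<not> white (\<phi> u)"
        using A(3)[of "\<phi> u"] el unfolding white_def by blast
      then show ?thesis using ad uv True by (auto simp: \<psi>_def pcompat_def)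
    next
      case False
      then have "pcompat (T (\<phi> u) (\<phi> v)) (adj u v)" using \<phi>(2) uv by auto
      moreover have "\<tau> (y (\<phi> u, e (\<phi> u) u)) (y (\<phi> v, e (\<phi> v) v)) = T (\<phi> u) (\<phi> v)"
        by (rule typed_type[OF y]) (use False \<phi>m eT uv in \<open>auto simp: J\<close>)
      ultimately show ?thesis using uv by (simp add: \<psi>_def)
    qed
  qed
qed

text \<open>A tuple in \<open>Y\<close> is determined by its entries at the positions
  \<open>\<psi>\<close> and by the remaining \<open>card J - h\<close> entries.\<close>

lemma card_tuples_via:
  assumes fV: "finite V" and fJ: "finite J" and \<psi>: "\<psi> \<in> PiE {..<h} (\<lambda>_. J)" "inj_on \<psi> {..<h}"
    and Y: "Y \<subseteq> PiE J (\<lambda>_. V)" "\<And>y. y \<in> Y \<Longrightarrow> restrict (y \<circ> \<psi>) {..<h} \<in> Z"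
    and Z: "finite Z"
  shows "card Y \<le> card Z * card V ^ (card J - h)"
proof -
  let ?R = "J - \<psi> ` {..<h}"
  have "card Y \<le> card (Z \<times> PiE ?R (\<lambda>_. V))"
  proof (rule card_inj_on_le[where f = "\<lambda>y. (restrict (y \<circ> \<psi>) {..<h}, restrict y ?R)"])
    show "inj_on (\<lambda>y. (restrict (y \<circ> \<psi>) {..<h}, restrict y ?R)) Y"
    proof (rule inj_onI)
      fix y y' assume y: "y \<in> Y" "y' \<in> Y"
        and eq: "(restrict (y \<circ> \<psi>) {..<h}, restrict y ?R) = (restrict (y' \<circ> \<psi>) {..<h}, restrict y' ?R)"
      have "y p = y' p" if "p \<in> J" for p
      proof (cases "p \<in> \<psi> ` {..<h}")
        case True
        then obtain u where "u < h" "p = \<psi> u" by auto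
        moreover have "restrict (y \<circ> \<psi>) {..<h} u = restrict (y' \<circ> \<psi>) {..<h} u" using eq by simp
        ultimately show ?thesis by simp
      next
        case False
        moreover have "restrict y ?R p = restrict y' ?R p" using eq by simp
        ultimately show ?thesis using that by simp
      qed
      then show "y = y'" using y Y(1) by (intro PiE_ext[of y J "\<lambda>_. V"]) auto
    qed
    show "(\<lambda>y. (restrict (y \<circ> \<psi>) {..<h}, restrict y ?R)) ` Y \<subseteq> Z \<times> PiE ?R (\<lambda>_. V)"
    proof (rule image_subsetI)
      fix y assume y: "y \<in> Y"
      then have "y p \<in> V" if "p \<in> J" for p using Y(1) that by (auto simp: PiE_iff)
      then have "restrict y ?R \<in> PiE ?R (\<lambda>_. V)" by simp
      then show "(restrict (y \<circ> \<psi>) {..<h}, restrict y ?R) \<in> Z \<times> PiE ?R (\<lambda>_. V)"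
        using Y(2)[OF y] by blast
    qed
    show "finite (Z \<times> PiE ?R (\<lambda>_. V))" using Z fJ fV by (simp add: finite_PiE)
  qed
  also have "\<dots> = card Z * card V ^ card ?R" using fJ by (simp add: card_cartesian_product card_PiE)
  also have "card ?R = card J - h"
    using \<psi> fJ by (subst card_Diff_subset) (auto simp: card_image PiE_iff)
  finally show ?thesis .
qed


text \<open>A positive proportion of tuples are blow-ups of one cheap pattern. Each of them contains
  a compatible tuple at positions given by some map, and one map serves at least a fraction
  \<open>1 / M\<close> of them. The point is that \<open>c\<close> is chosen before \<open>V\<close>
  and \<open>\<tau>\<close>.\<close>

lemma many_compat_tuples:
  fixes \<eta> :: real
  assumes sp: "split_pattern K S adj a b" "K \<union> S = {..<h}" and \<eta>: "0 < \<eta>" "\<eta> \<le> 1"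
  shows "\<exists>c::real. c > 0 \<and> (\<forall>(V :: 'v set) \<tau>. finite V \<longrightarrow> V \<noteq> {} \<longrightarrow> (\<forall>x y. \<tau> x y = \<tau> y x) \<longrightarrow>
       (\<Sum>x\<in>V. \<Sum>y\<in>V. pcost a b (\<tau> x y)) < (1 - \<eta>) * (card V)\<^sup>2 \<longrightarrow>
       card (compat_tuples V \<tau> h adj) \<ge> c * card V ^ h)"
proof -
  interpret split_pattern K S adj a b by (rule sp(1))
  \<comment> \<open>With \<open>m\<close> this large, the diagonal entries of at most
    \<open>max a b\<close> each cost at most \<open>m^2 * \<eta> / 2\<close> in total.\<close>
  obtain m :: nat where m: "m > 2 * max a b / \<eta>" using reals_Archimedean2 by blast
  have "2 * max a b / \<eta> \<ge> 2 * 1 / 1"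
    using \<eta> pos by (intro frac_le mult_left_mono) auto
  then have m2: "m \<ge> 2" using m by linarith
  obtain t where t: "t \<ge> 1" "ramsey_bound t h"
    using ramsey_bound_exists by blast
  define d where "d = \<eta> / 2 / 3 ^ (m * m)"
  have d: "d > 0" using \<eta> by (simp add: d_def)
  define J where "J = blow_index m t m"
  have fJ: "finite J" unfolding J_def by (rule finite_blow_index)
  define M where "M = card (PiE {..<h} (\<lambda>_. J))"
  \<comment> \<open>The proportion of blow-ups, divided by the number of possible maps; the added 1
    keeps the denominator positive.\<close>
  define c where "c = d ^ (t ^ m) / (real M + 1)"
  have c0: "c > 0" using d by (simp add: c_def)
  show ?thesis
  proof (intro exI[of _ c] conjI c0 allI impI)
    fix V :: "'v set" and \<tau> :: "'v \<Rightarrow> 'v \<Rightarrow> ptype"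
    assume fV: "finite V" "V \<noteq> {}" and sym0: "\<forall>x y. \<tau> x y = \<tau> y x"
      and cheap: "(\<Sum>x\<in>V. \<Sum>y\<in>V. pcost a b (\<tau> x y)) < (1 - \<eta>) * (card V)\<^sup>2"
    have sym: "\<tau> x y = \<tau> y x" for x y using sym0 by blast
    have n: "card V > 0" using fV by (simp add: card_gt_0_iff)
    obtain x0 where x0: "(\<Sum>i<m. \<Sum>j\<in>{..<m} - {i}. pcost a b (\<tau> (x0 i) (x0 j))) < (real m)\<^sup>2 * (1 - \<eta> / 2)"
      "card {x \<in> PiE {..<m} (\<lambda>_. V). \<forall>i<m. \<forall>j<m. i \<noteq> j \<longrightarrow> \<tau> (x i) (x j) = \<tau> (x0 i) (x0 j)} \<ge> d * card V ^ m"
      unfolding d_def by (rule cheap_pattern[OF fV \<eta> cheap m2])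
    define T where "T i j = \<tau> (x0 i) (x0 j)" for i j
    \<comment> \<open>Ramsey's theorem will dictate the colours of the clusters, so every colouring
      \<open>white\<close> has to be covered; uniform weights are cheap for each of them.\<close>
    have emb: "crk_embeds {..<h} adj {..<m} white T" for white
      unfolding sp(2)[symmetric]
    proof (rule crk_embeds_if_cheap)
      define x where "x i = (if i < m then 1 / real m else 0)" for i
      show "x \<in> prob_simplex {..<m}" using m2 by (auto simp: prob_simplex_def x_def)
      let ?M = "crk_cost a b white T"
      have "quad {..<m} ?M x = (\<Sum>i<m. \<Sum>j<m. ?M i j * (1 / m) * (1 / m))"
        unfolding quad_def by (intro sum.cong refl) (simp add: x_def)
      also have "\<dots> = (\<Sum>i<m. \<Sum>j<m. ?M i j) / m\<^sup>2"
        by (simp add: sum_divide_distrib power2_eq_square)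
      also have "(\<Sum>i<m. \<Sum>j<m. ?M i j) = (\<Sum>i<m. ?M i i + (\<Sum>j\<in>{..<m} - {i}. pcost a b (T i j)))"
      proof (rule sum.cong[OF refl])
        fix i assume i: "i \<in> {..<m}"
        have "(\<Sum>j<m. ?M i j) = ?M i i + (\<Sum>j\<in>{..<m} - {i}. ?M i j)"
          by (rule sum.remove) (use i in auto)
        also have "(\<Sum>j\<in>{..<m} - {i}. ?M i j) = (\<Sum>j\<in>{..<m} - {i}. pcost a b (T i j))"
          by (rule sum.cong) (auto simp: crk_cost_def)
        finally show "(\<Sum>j<m. ?M i j) = ?M i i + (\<Sum>j\<in>{..<m} - {i}. pcost a b (T i j))" .
      qed
      also have "\<dots> = (\<Sum>i<m. ?M i i) + (\<Sum>i<m. \<Sum>j\<in>{..<m} - {i}. pcost a b (T i j))" by (rule sum.distrib)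
      also have "(\<Sum>i<m. ?M i i) \<le> (\<Sum>i<m. real (max a b))"
        by (intro sum_mono) (auto simp: crk_cost_def)
      also have "(\<Sum>i<m. real (max a b)) + (\<Sum>i<m. \<Sum>j\<in>{..<m} - {i}. pcost a b (T i j)) < m * max a b + m\<^sup>2 * (1 - \<eta> / 2)"
        using x0(1) by (simp add: T_def)
      also have "m * max a b + m\<^sup>2 * (1 - \<eta> / 2) \<le> m\<^sup>2"
      proof -
        have "max a b \<le> m * (\<eta> / 2)" using m \<eta> by (simp add: field_simps)
        then have "m * real (max a b) \<le> m * (m * (\<eta> / 2))" by (intro mult_left_mono) auto
        then show ?thesis by (simp add: power2_eq_square algebra_simps)
      qed
      finally show "quad {..<m} ?M x < 1" using m2 by (simp add: divide_less_eq divide_right_mono)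
    qed (auto simp: T_def sym)
    define X where "X = {x \<in> PiE {..<m} (\<lambda>_. V). \<forall>i<m. \<forall>j<m. i \<noteq> j \<longrightarrow> \<tau> (x i) (x j) = T i j}"
    let ?f = "\<lambda>x p. if p \<in> blow_index m t 0 then x (fst p) else undefined"
    have J0: "(i, s) \<in> blow_index m t 0 \<longleftrightarrow> i < m \<and> s = 0" for i s by (auto simp: blow_index_def)
    have "card X \<le> card (typed V \<tau> T (blow_index m t 0))"
    proof (rule card_inj_on_le[where f = ?f])
      show "inj_on ?f X"
      proof (rule inj_onI)
        fix x x' assume x: "x \<in> X" "x' \<in> X" and eq: "?f x = ?f x'"
        have "x i = x' i" if "i < m" for i using fun_cong[OF eq, of "(i, 0)"] that J0 by simp
        then show "x = x'" using x unfolding X_def by (intro PiE_ext[of x "{..<m}" "\<lambda>_. V"]) auto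
      qed
      show "?f ` X \<subseteq> typed V \<tau> T (blow_index m t 0)"
        by (rule image_subsetI, rule typedI) (auto simp: X_def J0 PiE_iff extensional_def)
      show "finite (typed V \<tau> T (blow_index m t 0))" by (rule finite_typed[OF fV(1) finite_blow_index])
    qed
    moreover have "card (blow_index m t 0) = m"
    proof -
      have "blow_index m t 0 = {..<m} \<times> {0}" by (auto simp: blow_index_def)
      then show ?thesis by (simp add: card_cartesian_product)
    qed
    ultimately have "card (typed V \<tau> T (blow_index m t 0)) \<ge> d * card V ^ card (blow_index m t 0)"
      using x0(2) unfolding X_def T_def by simp
    then have Y: "card (typed V \<tau> T J) \<ge> d ^ (t ^ m) * card V ^ card J"
      unfolding J_def by (intro blow_up[where \<tau> = \<tau>, OF fV(1) sym _ t(1)]) (use d in \<open>auto simp: T_def sym\<close>)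
    define Z where "Z = compat_tuples V \<tau> h adj"
    have fZ: "finite Z" unfolding Z_def compat_tuples_def using fV by (simp add: finite_PiE)
    have "\<forall>y\<in>typed V \<tau> T J. \<exists>\<psi>. \<psi> \<in> PiE {..<h} (\<lambda>_. J) \<and> inj_on \<psi> {..<h} \<and>
       (\<forall>u<h. \<forall>v<h. u \<noteq> v \<longrightarrow> pcompat (\<tau> (y (\<psi> u)) (y (\<psi> v))) (adj u v))"
      using typed_blow_up_embeds[where \<tau> = \<tau>, OF t(2) sym emb] unfolding J_def by blast
    then obtain \<Psi> where \<Psi>: "\<forall>y\<in>typed V \<tau> T J. \<Psi> y \<in> PiE {..<h} (\<lambda>_. J) \<and> inj_on (\<Psi> y) {..<h} \<and>
       (\<forall>u<h. \<forall>v<h. u \<noteq> v \<longrightarrow> pcompat (\<tau> (y (\<Psi> y u)) (y (\<Psi> y v))) (adj u v))"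
      by (rule bchoice[THEN exE])
    have "real (card (typed V \<tau> T J)) > 0"
      using Y d n by (smt (verit) of_nat_0_less_iff zero_less_mult_iff zero_less_power)
    then have ne: "typed V \<tau> T J \<noteq> {}" by auto
    have "\<Psi> ` typed V \<tau> T J \<subseteq> PiE {..<h} (\<lambda>_. J)" using \<Psi> by blast
    moreover have "finite (PiE {..<h} (\<lambda>_. J))" using fJ by (simp add: finite_PiE)
    ultimately have "\<exists>y0\<in>typed V \<tau> T J. card (typed V \<tau> T J) \<le> M * card {y \<in> typed V \<tau> T J. \<Psi> y = \<Psi> y0}"
      unfolding M_def using ne by (intro card_le_card_times_fibre finite_typed[OF fV(1) fJ])
    then obtain y0 where y0: "y0 \<in> typed V \<tau> T J"
      "card (typed V \<tau> T J) \<le> M * card {y \<in> typed V \<tau> T J. \<Psi> y = \<Psi> y0}"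
      by blast
    have P0: "\<Psi> y0 \<in> PiE {..<h} (\<lambda>_. J)" "inj_on (\<Psi> y0) {..<h}" using \<Psi> y0(1) by blast+
    have "card {y \<in> typed V \<tau> T J. \<Psi> y = \<Psi> y0} \<le> card Z * card V ^ (card J - h)"
    proof (rule card_tuples_via[OF fV(1) fJ P0 _ _ fZ])
      show "{y \<in> typed V \<tau> T J. \<Psi> y = \<Psi> y0} \<subseteq> PiE J (\<lambda>_. V)" using typed_PiE by blast
      fix y assume "y \<in> {y \<in> typed V \<tau> T J. \<Psi> y = \<Psi> y0}"
      then have y: "y \<in> typed V \<tau> T J" "\<Psi> y = \<Psi> y0" by auto
      have "y (\<Psi> y0 u) \<in> V" if "u < h" for u
        using typed_PiE[OF y(1)] P0(1) that by (auto simp: PiE_iff)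
      moreover have "pcompat (\<tau> (y (\<Psi> y0 u)) (y (\<Psi> y0 v))) (adj u v)" if "u < h" "v < h" "u \<noteq> v" for u v
        using \<Psi> y that by metis
      ultimately show "restrict (y \<circ> \<Psi> y0) {..<h} \<in> Z"
        unfolding Z_def compat_tuples_def by auto
    qed
    then have "card (typed V \<tau> T J) \<le> M * (card Z * card V ^ (card J - h))"
      using y0(2) by (meson le_trans mult_le_mono2)
    then have "real (card (typed V \<tau> T J)) \<le> real (M * (card Z * card V ^ (card J - h)))"
      by (simp only: of_nat_le_iff)
    also have "\<dots> \<le> (real M + 1) * (card Z * real (card V) ^ (card J - h))"
      by (simp add: mult_right_mono)
    finally have "d ^ (t ^ m) * card V ^ card J \<le> (real M + 1) * (card Z * real (card V) ^ (card J - h))"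
      using Y by simp
    moreover have "h \<le> card J"
      using card_inj_on_le[OF P0(2) _ fJ] P0(1) by (auto simp: PiE_iff)
    then have "real (card V) ^ card J = card V ^ h * real (card V) ^ (card J - h)"
      by (simp flip: power_add)
    ultimately have "(d ^ (t ^ m) * card V ^ h) * real (card V) ^ (card J - h) \<le> ((real M + 1) * card Z) * real (card V) ^ (card J - h)"
      by (simp add: mult_ac)
    then have "d ^ (t ^ m) * card V ^ h \<le> (real M + 1) * card Z" using n by (simp add: mult_le_cancel_right)
    then show "c * card V ^ h \<le> card (compat_tuples V \<tau> h adj)"
      unfolding c_def Z_def[symmetric] by (simp add: field_simps)
  qed
qed

section \<open>Induced copies in graphs with cheap partitions\<close>

definition ptype_of :: "real \<Rightarrow> real \<Rightarrow> ptype" where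
  "ptype_of \<delta> u = (if u < \<delta> then White else if u > 1 - \<delta> then Black else Gray)"

text \<open>If the partition is cheap, at least \<open>c * card V ^ h\<close> tuples are compatible,
  and each contributes at least \<open>\<delta> ^ card P\<close> to the count with cell densities.
  The counting lemma transfers half of this to the graph itself, and tuples with repetitions are too
  few to account for it.\<close>

theorem induced_copy_or_expensive:
  fixes \<eta> \<delta> :: real and h :: nat
  assumes sp: "split_pattern K S adj a b" "K \<union> S = {..<h}"
    and \<eta>: "0 < \<eta>" "\<eta> \<le> 1" and \<delta>: "0 < \<delta>" "\<delta> < 1 / 2"
  shows "\<exists>k n0. \<forall>(V :: 'v set) E. finite V \<longrightarrow> n0 \<le> card V \<longrightarrow> (\<forall>x y. E x y = E y x) \<longrightarrow>
     (\<exists>z\<in>PiE {..<h} (\<lambda>_. V). inj_on z {..<h} \<and> (\<forall>u<h. \<forall>v<h. u \<noteq> v \<longrightarrow> E (z u) (z v) = adj u v)) \<or>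
     (\<exists>q. (\<forall>x. q x < k) \<and>
       (\<Sum>x\<in>V. \<Sum>y\<in>V. pcost a b (ptype_of \<delta> (cell_avg V (\<lambda>x y. of_bool (E x y)) q (q x) (q y))))
          \<ge> (1 - \<eta>) * (card V)\<^sup>2)"
proof -
  interpret split_pattern K S adj a b by (rule sp(1))
  have h2: "h \<ge> 2"
  proof -
    have "card (K \<union> S) = card K + card S" using fin disj by (rule card_Un_disjoint)
    then show ?thesis using card_K_ge card_S_ge pos sp(2) by simp
  qed
  define P where "P = {(i, j). i < j \<and> j < h}"
  have fP: "finite P" by (rule finite_subset[of _ "{..<h} \<times> {..<h}"]) (auto simp: P_def)
  obtain c :: real where c: "c > 0" "\<forall>(V :: 'v set) \<tau>. finite V \<longrightarrow> V \<noteq> {} \<longrightarrow> (\<forall>x y. \<tau> x y = \<tau> y x) \<longrightarrow>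
       (\<Sum>x\<in>V. \<Sum>y\<in>V. pcost a b (\<tau> x y)) < (1 - \<eta>) * (card V)\<^sup>2 \<longrightarrow>
       card (compat_tuples V \<tau> h adj) \<ge> c * card V ^ h"
    using many_compat_tuples[where 'v = 'v, OF sp \<eta>] by (elim exE conjE, intro that)
  \<comment> \<open>Half of the guaranteed count; the other half absorbs the counting error.\<close>
  define c' where "c' = c * \<delta> ^ card P / 2"
  have c': "c' > 0" using c \<delta> by (simp add: c'_def)
  define \<epsilon> where "\<epsilon> = c' / (card P + 1)"
  have \<epsilon>: "\<epsilon> > 0" "card P * \<epsilon> \<le> c'" using c' by (auto simp: \<epsilon>_def field_simps)
  obtain k where k: "\<forall>(V :: 'v set) W. finite V \<longrightarrow> (\<forall>x\<in>V. \<forall>y\<in>V. 0 \<le> W x y \<and> W x y \<le> 1) \<longrightarrow>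
     (\<exists>q. (\<forall>x. q x < k) \<and> cut_close V W (\<lambda>x y. cell_avg V W q (q x) (q y)) (\<epsilon> * (card V)\<^sup>2))"
    using weak_regularity[where 'v = 'v, OF \<epsilon>(1)] by (elim exE, intro that)
  \<comment> \<open>Beyond \<open>n0\<close> the tuples with a repeated entry, at most
    \<open>card P * card V ^ (h - 1)\<close>, are fewer than \<open>c' * card V ^ h\<close>.\<close>
  obtain n0 :: nat where n0: "n0 > card P / c'" using reals_Archimedean2 by blast
  show ?thesis
  proof (rule exI[of _ k], rule exI[of _ "max n0 1"], intro allI impI)
    fix V :: "'v set" and E :: "'v \<Rightarrow> 'v \<Rightarrow> bool"
    assume fV: "finite V" and nn: "max n0 1 \<le> card V" and symE: "\<forall>x y. E x y = E y x"
    define W where "W x y = (of_bool (E x y) :: real)" for x y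
    have n1: "card V \<ge> 1" using nn by simp
    have W01: "0 \<le> W x y \<and> W x y \<le> 1" for x y by (simp add: W_def)
    obtain q where q: "\<And>x. q x < k" "cut_close V W (\<lambda>x y. cell_avg V W q (q x) (q y)) (\<epsilon> * (card V)\<^sup>2)"
      using k[rule_format, of V W, OF fV W01] by blast
    define U where "U x y = cell_avg V W q (q x) (q y)" for x y
    define \<tau> where "\<tau> x y = ptype_of \<delta> (U x y)" for x y
    have U01: "0 \<le> U x y" "U x y \<le> 1" for x y
      unfolding U_def using cell_avg_bounds[of V W, OF fV W01] by auto
    have WE: "(\<lambda>x y. of_bool (E x y)) = W" by (intro ext) (simp add: W_def)
    show "(\<exists>z\<in>PiE {..<h} (\<lambda>_. V). inj_on z {..<h} \<and> (\<forall>u<h. \<forall>v<h. u \<noteq> v \<longrightarrow> E (z u) (z v) = adj u v)) \<or>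
     (\<exists>q. (\<forall>x. q x < k) \<and>
       (\<Sum>x\<in>V. \<Sum>y\<in>V. pcost a b (ptype_of \<delta> (cell_avg V (\<lambda>x y. of_bool (E x y)) q (q x) (q y))))
          \<ge> (1 - \<eta>) * (card V)\<^sup>2)"
    proof (cases "(\<Sum>x\<in>V. \<Sum>y\<in>V. pcost a b (\<tau> x y)) \<ge> (1 - \<eta>) * (card V)\<^sup>2")
      case True
      then show ?thesis using q(1) unfolding WE \<tau>_def U_def by blast
    next
      case False
      let ?X = "PiE {..<h} (\<lambda>_. V)"
      define Z where "Z = compat_tuples V \<tau> h adj"
      have fX: "finite ?X" using fV by (simp add: finite_PiE)
      have ZX: "Z \<subseteq> ?X" by (auto simp: Z_def compat_tuples_def)
      have symW: "W x y = W y x" for x y using symE[rule_format, of x y] by (simp add: W_def)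
      have sym\<tau>: "\<tau> x y = \<tau> y x" for x y
        unfolding \<tau>_def U_def cell_avg_sym[of W V q "q x", OF symW] by (rule refl)
      have Vne: "V \<noteq> {}" using n1 by auto
      have cZ: "card Z \<ge> c * card V ^ h"
        unfolding Z_def using c(2)[rule_format, of V \<tau>, OF fV Vne sym\<tau>] False by simp
      define \<kappa> where "\<kappa> e x y = (if adj (fst e) (snd e) then W x y else 1 - W x y)" for e :: "nat \<times> nat" and x y
      define \<kappa>' where "\<kappa>' e x y = (if adj (fst e) (snd e) then U x y else 1 - U x y)" for e :: "nat \<times> nat" and x y
      define SW where "SW = (\<Sum>z\<in>?X. \<Prod>e\<in>P. \<kappa> e (z (fst e)) (z (snd e)))"
      define SU where "SU = (\<Sum>z\<in>?X. \<Prod>e\<in>P. \<kappa>' e (z (fst e)) (z (snd e)))"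
      have \<kappa>01: "0 \<le> \<kappa> e x y \<and> \<kappa> e x y \<le> 1" for e x y using W01 by (simp add: \<kappa>_def)
      have \<kappa>'01: "0 \<le> \<kappa>' e x y \<and> \<kappa>' e x y \<le> 1" for e x y using U01 by (simp add: \<kappa>'_def)
      have "\<bar>SW - SU\<bar> \<le> card P * (card V ^ (h - 2) * (\<epsilon> * (card V)\<^sup>2))"
        unfolding SW_def SU_def
      proof (rule counting_lemma[OF fV fP _ _ \<kappa>01 \<kappa>'01])
        show "P \<subseteq> {(i, j). i < j \<and> j < h}" by (simp add: P_def)
        show "cut_close V (\<kappa> e) (\<kappa>' e) (\<epsilon> * (card V)\<^sup>2)" for e
        proof (cases "adj (fst e) (snd e)")
          case True
          then have eq: "\<kappa> e x y - \<kappa>' e x y = W x y - U x y" for x y by (simp add: \<kappa>_def \<kappa>'_def)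
          show ?thesis using q(2) unfolding cut_close_def eq U_def .
        next
          case False
          have eq: "\<kappa> e x y - \<kappa>' e x y = - (W x y - U x y)" for x y using False by (simp add: \<kappa>_def \<kappa>'_def)
          show ?thesis using q(2) unfolding cut_close_def eq sum_negf abs_minus_cancel U_def .
        qed
      qed
      also have "card P * (card V ^ (h - 2) * (\<epsilon> * (card V)\<^sup>2)) = (card P * \<epsilon>) * (real (card V) ^ (h - 2) * real (card V) ^ 2)"
        by simp
      also have "real (card V) ^ (h - 2) * real (card V) ^ 2 = real (card V) ^ h"
        using h2 by (simp only: power_add[symmetric] le_add_diff_inverse2)
      also have "(card P * \<epsilon>) * real (card V) ^ h \<le> c' * real (card V) ^ h"
        using \<epsilon>(2) by (intro mult_right_mono) auto
      finally have close: "\<bar>SW - SU\<bar> \<le> c' * real (card V) ^ h" .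
      have "2 * c' * real (card V) ^ h = \<delta> ^ card P * (c * real (card V) ^ h)" by (simp add: c'_def)
      also have "\<dots> \<le> \<delta> ^ card P * card Z" using cZ \<delta> by (intro mult_left_mono) auto
      also have "\<dots> = (\<Sum>z\<in>Z. \<delta> ^ card P)" by simp
      also have "\<dots> \<le> (\<Sum>z\<in>Z. \<Prod>e\<in>P. \<kappa>' e (z (fst e)) (z (snd e)))"
      proof (rule sum_mono)
        fix z assume z: "z \<in> Z"
        have "(\<Prod>e\<in>P. \<delta>) \<le> (\<Prod>e\<in>P. \<kappa>' e (z (fst e)) (z (snd e)))"
        proof (rule prod_mono)
          fix e assume "e \<in> P"
          then obtain i j where e: "e = (i, j)" "i < j" "j < h" by (auto simp: P_def)
          then have "pcompat (\<tau> (z i) (z j)) (adj i j)" using z by (auto simp: Z_def compat_tuples_def)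
          then show "0 \<le> \<delta> \<and> \<delta> \<le> \<kappa>' e (z (fst e)) (z (snd e))"
            using \<delta> e by (auto simp: \<kappa>'_def \<tau>_def ptype_of_def pcompat_def split: if_splits)
        qed
        then show "\<delta> ^ card P \<le> (\<Prod>e\<in>P. \<kappa>' e (z (fst e)) (z (snd e)))" by simp
      qed
      also have "\<dots> \<le> SU"
        unfolding SU_def by (rule sum_mono2[OF fX ZX]) (use \<kappa>'01 in \<open>auto intro!: prod_nonneg\<close>)
      finally have SW: "SW \<ge> c' * real (card V) ^ h" using close by linarith
      have "\<exists>z\<in>?X. inj_on z {..<h} \<and> (\<Prod>e\<in>P. \<kappa> e (z (fst e)) (z (snd e))) \<noteq> 0"
      proof (rule ccontr)
        assume neg: "\<not> ?thesis"
        have "SW \<le> (\<Sum>z\<in>?X. \<Sum>e\<in>P. of_bool (z (fst e) = z (snd e)))"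
          unfolding SW_def
        proof (rule sum_mono)
          fix z assume z: "z \<in> ?X"
          show "(\<Prod>e\<in>P. \<kappa> e (z (fst e)) (z (snd e))) \<le> (\<Sum>e\<in>P. of_bool (z (fst e) = z (snd e)))"
          proof (cases "inj_on z {..<h}")
            case True
            then have "(\<Prod>e\<in>P. \<kappa> e (z (fst e)) (z (snd e))) = 0" using neg z by blast
            then show ?thesis by (simp add: sum_nonneg)
          next
            case False
            then obtain i j where "i < h" "j < h" "i \<noteq> j" "z i = z j" by (auto simp: inj_on_def)
            then obtain i j where ij: "i < j" "j < h" "z i = z j" by (metis linorder_neqE_nat)
            have "(\<Prod>e\<in>P. \<kappa> e (z (fst e)) (z (snd e))) \<le> 1" using \<kappa>01 by (intro prod_le_1) auto
            also have "1 = of_bool (z (fst (i, j)) = z (snd (i, j)))" using ij by simp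
            also have "\<dots> \<le> (\<Sum>e\<in>P. of_bool (z (fst e) = z (snd e)) :: real)"
              by (rule member_le_sum) (use ij fP in \<open>auto simp: P_def\<close>)
            finally show ?thesis .
          qed
        qed
        also have "\<dots> = (\<Sum>e\<in>P. \<Sum>z\<in>?X. of_bool (z (fst e) = z (snd e)))" by (rule sum.swap)
        also have "\<dots> = (\<Sum>e\<in>P. card V ^ (h - 2) * real (card V))"
        proof (rule sum.cong[OF refl])
          fix e assume "e \<in> P"
          then obtain i j where e: "e = (i, j)" "i < j" "j < h" by (auto simp: P_def)
          have "(\<Sum>z\<in>?X. of_bool (z i = z j)) = card V ^ (card {..<h} - 2) * (\<Sum>x\<in>V. \<Sum>y\<in>V. of_bool (x = y) :: real)"
            by (rule sum_PiE_pair_eq) (use e in auto)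
          also have "(\<Sum>x\<in>V. \<Sum>y\<in>V. of_bool (x = y) :: real) = card V" using fV by simp
          finally show "(\<Sum>z\<in>?X. of_bool (z (fst e) = z (snd e))) = card V ^ (h - 2) * real (card V)"
            using e by simp
        qed
        also have "\<dots> = card P * (real (card V) ^ (h - 2) * card V)" by simp
        finally have "c' * real (card V) ^ h \<le> card P * (real (card V) ^ (h - 2) * card V)" using SW by linarith
        also have "real (card V) ^ h = (real (card V) ^ (h - 2) * card V) * card V"
        proof -
          have "real (card V) ^ h = real (card V) ^ (h - 2) * real (card V) ^ 2"
            using h2 by (simp only: power_add[symmetric] le_add_diff_inverse2)
          then show ?thesis by (simp add: power2_eq_square mult_ac)
        qed
        finally have "(c' * card V) * (real (card V) ^ (h - 2) * card V) \<le> card P * (real (card V) ^ (h - 2) * card V)"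
          by (simp add: mult_ac)
        moreover have "real (card V) ^ (h - 2) * card V > 0" using n1 by simp
        ultimately have "c' * card V \<le> card P" using mult_le_cancel_right_pos by blast
        moreover have "card P < c' * n0" using n0 c' by (simp add: field_simps)
        moreover have "c' * n0 \<le> c' * card V" using nn c' by simp
        ultimately show False by linarith
      qed
      then obtain z where z: "z \<in> ?X" "inj_on z {..<h}" "(\<Prod>e\<in>P. \<kappa> e (z (fst e)) (z (snd e))) \<noteq> 0" by blast
      have lt: "E (z i) (z j) = adj i j" if "i < j" "j < h" for i j
      proof -
        have "(i, j) \<in> P" using that by (simp add: P_def)
        then have "\<kappa> (i, j) (z i) (z j) \<noteq> 0" using z(3) fP by auto
        then show ?thesis by (auto simp: \<kappa>_def W_def split: if_splits)
      qed
      have "E (z u) (z v) = adj u v" if "u < h" "v < h" "u \<noteq> v" for u v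
        using lt[of u v] lt[of v u] that symE sym by (metis linorder_neqE_nat)
      then show ?thesis using z by blast
    qed
  qed
qed

section \<open>Quasirandom graphs of given density\<close>

lemma sum_mod_shift:
  fixes q :: int and g :: "int \<Rightarrow> real"
  assumes "q > 0"
  shows "(\<Sum>b\<in>{0..<q}. g ((b + s) mod q)) = sum g {0..<q}"
proof -
  have inj: "inj_on (\<lambda>b. (b + s) mod q) {0..<q}"
  proof (rule inj_onI)
    fix b b' assume b: "b \<in> {0..<q}" "b' \<in> {0..<q}" and eq: "(b + s) mod q = (b' + s) mod q"
    then have "b mod q = b' mod q" by (metis add_diff_cancel_right' mod_diff_left_eq)
    then show "b = b'" using b by simp
  qed
  moreover have "(\<lambda>b. (b + s) mod q) ` {0..<q} = {0..<q}"
    by (rule endo_inj_surj[OF _ _ inj]) (use assms in auto)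
  ultimately show ?thesis by (metis (no_types, lifting) sum.reindex_cong)
qed

lemma sum_mod_affine:
  fixes q :: int and g :: "int \<Rightarrow> real"
  assumes "q > 0" "coprime u q"
  shows "(\<Sum>a\<in>{0..<q}. g ((s + a * u) mod q)) = sum g {0..<q}"
proof -
  have inj: "inj_on (\<lambda>a. (s + a * u) mod q) {0..<q}"
  proof (rule inj_onI)
    fix a a' assume a: "a \<in> {0..<q}" "a' \<in> {0..<q}" and eq: "(s + a * u) mod q = (s + a' * u) mod q"
    then have "q dvd (s + a * u) - (s + a' * u)" by (simp add: mod_eq_dvd_iff)
    then have "q dvd (a - a') * u" by (simp add: algebra_simps)
    then have "q dvd a - a'" using assms(2) by (simp add: coprime_commute coprime_dvd_mult_left_iff)
    then have "a mod q = a' mod q" by (simp add: mod_eq_dvd_iff)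
    then show "a = a'" using a by simp
  qed
  moreover have "(\<lambda>a. (s + a * u) mod q) ` {0..<q} = {0..<q}"
    by (rule endo_inj_surj[OF _ _ inj]) (use assms in auto)
  ultimately show ?thesis by (metis (no_types, lifting) sum.reindex_cong)
qed

text \<open>A symmetric form of point-line incidence in the plane over the field with
  \<open>q\<close> elements: for fixed \<open>y\<close>, the points \<open>x\<close> with a given
  residue form a line whose slope is determined by \<open>fst y\<close>.\<close>

definition affine_residue :: "int \<Rightarrow> int \<times> int \<Rightarrow> int \<times> int \<Rightarrow> int" where
  "affine_residue q x y = (snd x + snd y + fst x * fst y) mod q"

abbreviation plane :: "int \<Rightarrow> (int \<times> int) set" where
  "plane q \<equiv> {0..<q} \<times> {0..<q}"

text \<open>For different slopes the residues with respect to \<open>y\<close> and \<open>y'\<close>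
  are independent and uniform in \<open>x\<close>, and \<open>f\<close> has mean 0.\<close>

lemma affine_orthogonal:
  assumes q: "q > 0" "prime q" and f0: "sum f {0..<q} = (0::real)"
    and y: "y \<in> plane q" "y' \<in> plane q" "fst y \<noteq> fst y'"
  shows "(\<Sum>x\<in>plane q. f (affine_residue q x y) * f (affine_residue q x y')) = 0"
proof -
  obtain c d where yc: "y = (c, d)" by force
  obtain c' d' where yc': "y' = (c', d')" by force
  have cop: "coprime (c' - c) q"
  proof -
    have "\<not> q dvd c' - c"
    proof
      assume "q dvd c' - c"
      then have "c' mod q = c mod q" by (simp add: mod_eq_dvd_iff)
      then show False using y yc yc' by simp
    qed
    then show ?thesis using q(2) by (metis coprime_commute prime_imp_coprime)
  qed
  have "(\<Sum>x\<in>plane q. f (affine_residue q x y) * f (affine_residue q x y')) =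
     (\<Sum>a\<in>{0..<q}. \<Sum>b\<in>{0..<q}. f ((b + (d + a * c)) mod q) * f ((b + (d' + a * c')) mod q))"
    by (simp add: sum.cartesian_product affine_residue_def yc yc' case_prod_unfold add.assoc)
  also have "\<dots> = (\<Sum>a\<in>{0..<q}. \<Sum>r\<in>{0..<q}. f r * f ((r + (d' - d) + a * (c' - c)) mod q))"
  proof (rule sum.cong[OF refl])
    fix a
    have "((b + (d + a * c)) mod q + (d' - d) + a * (c' - c)) mod q = (b + (d' + a * c')) mod q" for b
    proof -
      have "((b + (d + a * c)) mod q + ((d' - d) + a * (c' - c))) mod q = (b + (d + a * c) + ((d' - d) + a * (c' - c))) mod q"
        by (rule mod_add_left_eq)
      also have "b + (d + a * c) + ((d' - d) + a * (c' - c)) = b + (d' + a * c')" by (simp add: algebra_simps)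
      finally show ?thesis by (simp add: add.assoc)
    qed
    then show "(\<Sum>b\<in>{0..<q}. f ((b + (d + a * c)) mod q) * f ((b + (d' + a * c')) mod q)) =
       (\<Sum>r\<in>{0..<q}. f r * f ((r + (d' - d) + a * (c' - c)) mod q))"
      using sum_mod_shift[OF q(1), of "\<lambda>r. f r * f ((r + (d' - d) + a * (c' - c)) mod q)" "d + a * c"] by simp
  qed
  also have "\<dots> = (\<Sum>r\<in>{0..<q}. f r * (\<Sum>a\<in>{0..<q}. f ((r + (d' - d) + a * (c' - c)) mod q)))"
    by (subst sum.swap) (simp add: sum_distrib_left)
  also have "\<dots> = 0" by (simp add: sum_mod_affine[OF q(1) cop] f0)
  finally show ?thesis .
qed

text \<open>After Cauchy-Schwarz over \<open>x\<close>, orthogonality leaves only the pairs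
  \<open>y\<close>, \<open>y'\<close> with equal first coordinate, \<open>q^3\<close> out of
  \<open>q^4\<close>. This saves one factor \<open>q\<close> over the trivial bound
  \<open>q^8 * L^4\<close>. The weights will be multiplicities in a blow-up.\<close>

lemma affine_cut:
  fixes \<alpha> \<beta> :: "int \<times> int \<Rightarrow> real"
  assumes q: "q > 0" "prime q" and f0: "sum f {0..<q} = (0::real)" and f1: "\<And>r. \<bar>f r\<bar> \<le> 1"
    and \<alpha>: "\<And>x. x \<in> plane q \<Longrightarrow> 0 \<le> \<alpha> x \<and> \<alpha> x \<le> L" and \<beta>: "\<And>x. x \<in> plane q \<Longrightarrow> 0 \<le> \<beta> x \<and> \<beta> x \<le> L"
  shows "(\<Sum>x\<in>plane q. \<Sum>y\<in>plane q. \<alpha> x * \<beta> y * f (affine_residue q x y))\<^sup>2 \<le> real_of_int q ^ 7 * L ^ 4"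
proof -
  define g where "g x = (\<Sum>y\<in>plane q. \<beta> y * f (affine_residue q x y))" for x
  have cp: "real (card (plane q)) = real_of_int q ^ 2" using q by (simp add: card_cartesian_product power2_eq_square)
  have L: "L \<ge> 0" using \<alpha>[of "(0, 0)"] q by auto
  have "(\<Sum>x\<in>plane q. (\<alpha> x)\<^sup>2) \<le> (\<Sum>x\<in>plane q. L\<^sup>2)" using \<alpha> by (intro sum_mono power_mono) auto
  then have a2: "(\<Sum>x\<in>plane q. (\<alpha> x)\<^sup>2) \<le> real_of_int q ^ 2 * L\<^sup>2" by (simp only: sum_constant cp)
  define C where "C y y' = (\<Sum>x\<in>plane q. f (affine_residue q x y) * f (affine_residue q x y'))" for y y'
  have "(\<Sum>x\<in>plane q. (g x)\<^sup>2) = (\<Sum>x\<in>plane q. \<Sum>y\<in>plane q. \<Sum>y'\<in>plane q.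
      \<beta> y * \<beta> y' * (f (affine_residue q x y) * f (affine_residue q x y')))"
    unfolding g_def power2_eq_square sum_product by (simp only: mult_ac)
  also have "\<dots> = (\<Sum>y\<in>plane q. \<Sum>x\<in>plane q. \<Sum>y'\<in>plane q.
      \<beta> y * \<beta> y' * (f (affine_residue q x y) * f (affine_residue q x y')))" by (rule sum.swap)
  also have "\<dots> = (\<Sum>y\<in>plane q. \<Sum>y'\<in>plane q. \<Sum>x\<in>plane q.
      \<beta> y * \<beta> y' * (f (affine_residue q x y) * f (affine_residue q x y')))"
    by (rule sum.cong[OF refl], rule sum.swap)
  also have "\<dots> = (\<Sum>y\<in>plane q. \<Sum>y'\<in>plane q. \<beta> y * \<beta> y' * C y y')"
    unfolding C_def by (simp only: sum_distrib_left)
  also have "\<dots> \<le> (\<Sum>y\<in>plane q. \<Sum>y'\<in>plane q. if fst y = fst y' then L\<^sup>2 * real_of_int q ^ 2 else 0)"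
  proof (rule sum_mono, rule sum_mono)
    fix y y' assume y: "y \<in> plane q" "y' \<in> plane q"
    have "C y y' \<le> (\<Sum>x\<in>plane q. 1)"
      unfolding C_def
    proof (rule sum_mono)
      fix x
      have "\<bar>f (affine_residue q x y) * f (affine_residue q x y')\<bar> \<le> 1 * 1"
        unfolding abs_mult by (intro mult_mono f1) auto
      then show "f (affine_residue q x y) * f (affine_residue q x y') \<le> 1" by linarith
    qed
    then have C1: "C y y' \<le> real_of_int q ^ 2" by (simp only: sum_constant cp mult_1_right)
    show "\<beta> y * \<beta> y' * C y y' \<le> (if fst y = fst y' then L\<^sup>2 * real_of_int q ^ 2 else 0)"
    proof (cases "fst y = fst y'")
      case True
      have "\<beta> y * \<beta> y' * C y y' \<le> \<beta> y * \<beta> y' * real_of_int q ^ 2"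
        using \<beta> y C1 by (intro mult_left_mono) auto
      also have "\<dots> \<le> (L * L) * real_of_int q ^ 2"
        using \<beta> y L by (intro mult_right_mono mult_mono) auto
      finally show ?thesis using True by (simp add: power2_eq_square)
    next
      case False
      then show ?thesis using affine_orthogonal[OF q f0 y] by (simp add: C_def)
    qed
  qed
  also have "\<dots> = real_of_int q ^ 5 * L\<^sup>2"
  proof -
    have "(\<Sum>y'\<in>plane q. if fst y = fst y' then L\<^sup>2 * real_of_int q ^ 2 else 0) = real_of_int q ^ 3 * L\<^sup>2"
      if "y \<in> plane q" for y
    proof -
      have "(\<Sum>y'\<in>plane q. if fst y = fst y' then L\<^sup>2 * real_of_int q ^ 2 else 0) =
         (\<Sum>y' | y' \<in> plane q \<and> fst y = fst y'. L\<^sup>2 * real_of_int q ^ 2)"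
        by (rule sum.inter_filter[symmetric]) simp
      also have "{y'. y' \<in> plane q \<and> fst y = fst y'} = {fst y} \<times> {0..<q}" using that by auto
      finally show ?thesis using q by (simp add: card_cartesian_product power2_eq_square power3_eq_cube mult_ac)
    qed
    then have "(\<Sum>y\<in>plane q. \<Sum>y'\<in>plane q. if fst y = fst y' then L\<^sup>2 * real_of_int q ^ 2 else 0) =
      (\<Sum>y\<in>plane q. real_of_int q ^ 3 * L\<^sup>2)" by (rule sum.cong[OF refl])
    also have "\<dots> = real_of_int q ^ 2 * (real_of_int q ^ 3 * L\<^sup>2)" by (simp only: sum_constant cp)
    finally show ?thesis by (simp add: power_add[symmetric] mult.assoc[symmetric])
  qed
  finally have g2: "(\<Sum>x\<in>plane q. (g x)\<^sup>2) \<le> real_of_int q ^ 5 * L\<^sup>2" .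
  have "(\<Sum>x\<in>plane q. \<Sum>y\<in>plane q. \<alpha> x * \<beta> y * f (affine_residue q x y)) = (\<Sum>x\<in>plane q. \<alpha> x * g x)"
    unfolding g_def by (simp only: sum_distrib_left mult.assoc)
  then have "(\<Sum>x\<in>plane q. \<Sum>y\<in>plane q. \<alpha> x * \<beta> y * f (affine_residue q x y))\<^sup>2 \<le>
     (\<Sum>x\<in>plane q. (\<alpha> x)\<^sup>2) * (\<Sum>x\<in>plane q. (g x)\<^sup>2)"
    by (simp only: Cauchy_Schwarz_ineq_sum)
  also have "\<dots> \<le> (real_of_int q ^ 2 * L\<^sup>2) * (real_of_int q ^ 5 * L\<^sup>2)"
    using a2 g2 q by (intro mult_mono sum_nonneg) auto
  also have "\<dots> = real_of_int q ^ 7 * L ^ 4" by (simp add: power_add[symmetric] mult_ac)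
  finally show ?thesis .
qed

lemma sum_edges:
  assumes fV: "finite V" and E: "E \<subseteq> nsets V 2"
  shows "(\<Sum>x\<in>V. \<Sum>y\<in>V. of_bool ({x, y} \<in> E) :: real) = 2 * real (card E)"
proof -
  have fE: "finite E" using E fV by (meson finite_imp_finite_nsets finite_subset)
  have one: "(\<Sum>x\<in>V. \<Sum>y\<in>V. of_bool (e = {x, y}) :: real) = 2" if eE: "e \<in> E" for e
  proof -
    obtain u v where e: "e = {u, v}" "u \<in> V" "v \<in> V" "u \<noteq> v" by (rule nsets2_E[OF subsetD[OF E eE]])
    have "(\<Sum>x\<in>V. \<Sum>y\<in>V. of_bool (e = {x, y}) :: real) =
      (\<Sum>x\<in>V. \<Sum>y\<in>V. (if x = u then if y = v then 1 else 0 else 0) + (if x = v then if y = u then 1 else 0 else 0))"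
      using e by (intro sum.cong refl) (auto simp: doubleton_eq_iff)
    also have "\<dots> = (\<Sum>x\<in>V. (if x = u then 1 else 0) + (if x = v then 1 else 0))"
      using e fV by (intro sum.cong refl) (auto simp: sum.distrib)
    also have "\<dots> = 2" using e fV by (simp add: sum.distrib)
    finally show ?thesis .
  qed
  have "(\<Sum>x\<in>V. \<Sum>y\<in>V. of_bool ({x, y} \<in> E) :: real) = (\<Sum>x\<in>V. \<Sum>y\<in>V. \<Sum>e\<in>E. of_bool (e = {x, y}))"
    using fE by (intro sum.cong refl) (simp add: of_bool_def)
  also have "\<dots> = (\<Sum>x\<in>V. \<Sum>e\<in>E. \<Sum>y\<in>V. of_bool (e = {x, y}))" by (rule sum.cong[OF refl], rule sum.swap)
  also have "\<dots> = (\<Sum>e\<in>E. \<Sum>x\<in>V. \<Sum>y\<in>V. of_bool (e = {x, y}))" by (rule sum.swap)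
  also have "\<dots> = (\<Sum>e\<in>E. 2)" by (rule sum.cong[OF refl one])
  finally show ?thesis by simp
qed


text \<open>The two lowest digits in base \<open>q\<close>. They spread the first \<open>n\<close>
  vertices almost evenly over the plane, so one fixed prime serves all large
  \<open>n\<close>.\<close>

definition plane_point :: "nat \<Rightarrow> nat \<Rightarrow> int \<times> int" where
  "plane_point q i = (int (i mod q), int ((i div q) mod q))"

lemma plane_point_in: "q > 0 \<Longrightarrow> plane_point q i \<in> plane (int q)"
  by (simp add: plane_point_def)

lemma card_plane_point_fibre:
  fixes q n :: nat
  assumes q: "q > 0" and A: "A \<subseteq> {..<n}" and n: "n \<ge> q * q"
  shows "real (card {i \<in> A. plane_point q i = x}) \<le> 2 * n / q ^ 2"
proof -
  let ?F = "{i \<in> A. plane_point q i = x}"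
  have "card ?F \<le> card {..n div (q * q)}"
  proof (rule card_inj_on_le[where f = "\<lambda>i. i div (q * q)"])
    show "inj_on (\<lambda>i. i div (q * q)) ?F"
    proof (rule inj_onI)
      fix i j assume ij: "i \<in> ?F" "j \<in> ?F" and eq: "i div (q * q) = j div (q * q)"
      then have "i mod q = j mod q" "(i div q) mod q = (j div q) mod q" by (auto simp: plane_point_def)
      then have "i mod (q * q) = j mod (q * q)" by (simp add: mod_mult2_eq)
      with eq show "i = j" by (metis div_mult_mod_eq)
    qed
    show "(\<lambda>i. i div (q * q)) ` ?F \<subseteq> {..n div (q * q)}"
      using A by (auto intro!: div_le_mono)
  qed auto
  then have "real (card ?F) \<le> real (n div (q * q)) + 1" by simp
  also have "real (n div (q * q)) \<le> real n / real (q * q)" by (rule of_nat_div_le_of_nat)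
  also have "1 \<le> real n / real (q * q)" using n q by (simp add: le_divide_eq flip: of_nat_mult)
  finally show ?thesis by (simp add: power2_eq_square)
qed

text \<open>Grouping the vertices by their points turns the sum into the weighted form of
  \<open>affine_cut\<close>, with weights at most \<open>2 * n / q^2\<close>.\<close>

lemma blow_up_cut:
  assumes q: "prime (int q)" and f0: "sum f {0..<int q} = (0::real)" and f1: "\<And>r. \<bar>f r\<bar> \<le> 1"
    and AB: "A \<subseteq> {..<n}" "B \<subseteq> {..<n}" and n: "n \<ge> q * q"
  shows "(\<Sum>i\<in>A. \<Sum>j\<in>B. f (affine_residue (int q) (plane_point q i) (plane_point q j)))\<^sup>2 \<le> 16 * real n ^ 4 / q"
proof -
  have q0: "q > 0" using prime_gt_0_int[OF q] by simp
  let ?P = "plane (int q)" and ?\<pi> = "plane_point q" and ?F = "\<lambda>x y. f (affine_residue (int q) x y)"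
  have fin: "finite A" "finite B" using AB finite_subset by auto
  define \<alpha> where "\<alpha> x = real (card {i \<in> A. ?\<pi> i = x})" for x
  define \<beta> where "\<beta> x = real (card {i \<in> B. ?\<pi> i = x})" for x
  have im: "?\<pi> ` C \<subseteq> ?P" for C using plane_point_in[OF q0] by blast
  have "(\<Sum>i\<in>A. \<Sum>j\<in>B. ?F (?\<pi> i) (?\<pi> j)) = (\<Sum>x\<in>?P. \<Sum>i | i \<in> A \<and> ?\<pi> i = x. \<Sum>j\<in>B. ?F (?\<pi> i) (?\<pi> j))"
    by (rule sum.group[OF fin(1) _ im, symmetric]) simp
  also have "\<dots> = (\<Sum>x\<in>?P. \<alpha> x * (\<Sum>j\<in>B. ?F x (?\<pi> j)))"
    by (rule sum.cong[OF refl]) (simp add: \<alpha>_def)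
  also have "\<dots> = (\<Sum>x\<in>?P. \<alpha> x * (\<Sum>y\<in>?P. \<beta> y * ?F x y))"
  proof (rule sum.cong[OF refl])
    fix x
    have "(\<Sum>j\<in>B. ?F x (?\<pi> j)) = (\<Sum>y\<in>?P. \<Sum>j | j \<in> B \<and> ?\<pi> j = y. ?F x (?\<pi> j))"
      by (rule sum.group[OF fin(2) _ im, symmetric]) simp
    also have "\<dots> = (\<Sum>y\<in>?P. \<beta> y * ?F x y)"
      by (rule sum.cong[OF refl]) (simp add: \<beta>_def)
    finally show "\<alpha> x * (\<Sum>j\<in>B. ?F x (?\<pi> j)) = \<alpha> x * (\<Sum>y\<in>?P. \<beta> y * ?F x y)" by simp
  qed
  also have "\<dots> = (\<Sum>x\<in>?P. \<Sum>y\<in>?P. \<alpha> x * \<beta> y * ?F x y)"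
    by (simp only: sum_distrib_left mult.assoc)
  finally have eq: "(\<Sum>i\<in>A. \<Sum>j\<in>B. ?F (?\<pi> i) (?\<pi> j)) = (\<Sum>x\<in>?P. \<Sum>y\<in>?P. \<alpha> x * \<beta> y * ?F x y)" .
  have "(\<Sum>x\<in>?P. \<Sum>y\<in>?P. \<alpha> x * \<beta> y * ?F x y)\<^sup>2 \<le> real_of_int (int q) ^ 7 * (2 * n / q ^ 2) ^ 4"
  proof (rule affine_cut[OF _ q f0 f1])
    show "0 \<le> \<alpha> x \<and> \<alpha> x \<le> 2 * n / q ^ 2" for x
      unfolding \<alpha>_def using card_plane_point_fibre[OF q0 AB(1) n] by simp
    show "0 \<le> \<beta> x \<and> \<beta> x \<le> 2 * n / q ^ 2" for x
      unfolding \<beta>_def using card_plane_point_fibre[OF q0 AB(2) n] by simp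
  qed (use q0 in simp)
  also have "\<dots> = 16 * real n ^ 4 / q"
  proof -
    have "real q ^ 8 = real q ^ 7 * real q" by (simp add: power_Suc2[symmetric] del: power_Suc)
    then show ?thesis using q0 by (simp add: power_divide power_mult_distrib flip: power_mult)
  qed
  finally show ?thesis unfolding eq .
qed

lemma choose_two_real: "2 * real (n choose 2) = real n * (real n - 1)"
proof (cases n)
  case (Suc k)
  have "even (n * (n - 1))" by auto
  then have "2 * (n choose 2) = n * (n - 1)" by (simp add: choose_two)
  then have "real (2 * (n choose 2)) = real (n * (n - 1))" by (rule arg_cong)
  then show ?thesis using Suc by (simp add: algebra_simps)
qed simp

text \<open>Joining the pairs with residue below \<open>\<rho>\<close> gives density close to
  \<open>p\<close>. The cut bound on the whole vertex set shows that the edge number is nearly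
  right, so adding or deleting edges to make it exact disturbs every cut sum only a little.\<close>

theorem quasirandom_graph:
  fixes p \<epsilon> :: real
  assumes p: "0 \<le> p" "p \<le> 1" and \<epsilon>: "\<epsilon> > 0"
  shows "\<exists>n0. \<forall>n\<ge>n0. \<exists>E\<subseteq>nsets {..<n} 2. int (card E) = \<lfloor>p * real (n choose 2)\<rfloor> \<and>
     (\<forall>A\<subseteq>{..<n}. \<forall>B\<subseteq>{..<n}. \<bar>\<Sum>x\<in>A. \<Sum>y\<in>B. of_bool ({x, y} \<in> E) - p\<bar> \<le> \<epsilon> * (real n)\<^sup>2)"
proof -
  \<comment> \<open>Of the 8 units, 3 go to the threshold graph and 4 to the correction of its edge
    number.\<close>
  define \<delta> where "\<delta> = \<epsilon> / 8"
  have \<delta>: "\<delta> > 0" using \<epsilon> by (simp add: \<delta>_def)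
  \<comment> \<open>The first term makes the discrepancy at most \<open>\<delta> * n^2\<close>; the
    second makes the rounding of \<open>p\<close> to a multiple of \<open>1 / q\<close> at most
    \<open>\<delta>\<close>.\<close>
  obtain m :: nat where m: "m > max (16 / \<delta>\<^sup>2) (1 / \<delta>)" using reals_Archimedean2 by blast
  obtain q where q: "prime q" "q > m" using bigger_prime by blast
  have q0: "q > 0" and qm: "16 / \<delta>\<^sup>2 < q" "1 / \<delta> < q" using q m by auto
  have pq: "prime (int q)" using q by simp
  have q1: "16 / q \<le> \<delta>\<^sup>2" "1 / q \<le> \<delta>" using qm \<delta> q0 by (auto simp: field_simps)
  define \<rho> where "\<rho> = \<lfloor>p * q\<rfloor>"
  have \<rho>: "0 \<le> \<rho>" "\<rho> \<le> int q" using p q0 by (auto simp: \<rho>_def floor_le_iff mult_left_le_one_le) (smt (verit) mult_left_le_one_le of_nat_0_le_iff)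
  define f where "f r = (of_bool (r < \<rho>) - real_of_int \<rho> / q)" for r :: int
  have f0: "sum f {0..<int q} = 0"
  proof -
    have "(\<Sum>r\<in>{0..<int q}. of_bool (r < \<rho>) :: real) = real (card ({0..<int q} \<inter> {r. r < \<rho>}))" by (simp add: of_bool_def sum.If_cases)
    also have "{0..<int q} \<inter> {r. r < \<rho>} = {0..<\<rho>}" using \<rho> by auto
    finally show ?thesis using \<rho> q0 by (simp add: f_def sum_subtractf)
  qed
  have rq: "0 \<le> real_of_int \<rho> / q" "real_of_int \<rho> / q \<le> 1" using \<rho> q0 by (auto simp: divide_le_eq)
  have f1: "\<bar>f r\<bar> \<le> 1" for r using rq by (auto simp: f_def of_bool_def)
  have rp: "\<bar>real_of_int \<rho> / q - p\<bar> \<le> \<delta>"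
  proof -
    have "\<bar>real_of_int \<rho> - p * q\<bar> \<le> 1" unfolding \<rho>_def by linarith
    then have "\<bar>real_of_int \<rho> - p * q\<bar> / q \<le> 1 / q" by (intro divide_right_mono) auto
    moreover have "real_of_int \<rho> / q - p = (real_of_int \<rho> - p * q) / q" using q0 by (simp add: field_simps)
    then have "\<bar>real_of_int \<rho> / q - p\<bar> = \<bar>real_of_int \<rho> - p * q\<bar> / q" by simp
    ultimately show ?thesis using q1 by linarith
  qed
  obtain n1 :: nat where n1: "n1 > 3 / \<delta>" using reals_Archimedean2 by blast
  show ?thesis
  proof (rule exI[of _ "max (max n1 (q * q)) 1"], intro allI impI)
    fix n assume nn: "max (max n1 (q * q)) 1 \<le> n"
    have n: "n \<ge> q * q" "n \<ge> 1" "3 \<le> \<delta> * n"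
    proof -
      have "3 < \<delta> * n1" using n1 \<delta> by (simp add: field_simps)
      also have "\<dots> \<le> \<delta> * n" using nn \<delta> by simp
      finally show "3 \<le> \<delta> * n" by simp
    qed (use nn in auto)
    have n3: "3 * real n \<le> \<delta> * (real n)\<^sup>2"
      using mult_right_mono[OF n(3), of "real n"] by (simp add: power2_eq_square)
    let ?V = "{..<n}" and ?\<pi> = "plane_point q"
    define adj0 where "adj0 i j \<longleftrightarrow> affine_residue (int q) (?\<pi> i) (?\<pi> j) < \<rho>" for i j
    have sym0: "adj0 i j = adj0 j i" for i j by (simp add: adj0_def affine_residue_def add_ac mult.commute)
    define E0 where "E0 = {{i, j} | i j. i < n \<and> j < n \<and> i \<noteq> j \<and> adj0 i j}"
    have E0: "E0 \<subseteq> nsets ?V 2" by (auto simp: E0_def)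
    have E0_iff: "{i, j} \<in> E0 \<longleftrightarrow> i \<noteq> j \<and> adj0 i j" if "i < n" "j < n" for i j
      using that sym0 by (auto simp: E0_def doubleton_eq_iff)
    have fN: "finite (nsets ?V 2)" by (simp add: finite_imp_finite_nsets)
    have cN: "card (nsets ?V 2) = n choose 2" by (simp add: card_nsets)
    \<comment> \<open>Three errors of at most \<open>\<delta> * n^2\<close> each: the discrepancy of
      the residues, the rounding of \<open>p\<close>, and the diagonal.\<close>
    have cut0: "\<bar>\<Sum>x\<in>A. \<Sum>y\<in>B. of_bool ({x, y} \<in> E0) - p\<bar> \<le> 3 * \<delta> * (real n)\<^sup>2"
      if AB: "A \<subseteq> ?V" "B \<subseteq> ?V" for A B
    proof -
      have fin: "finite A" "finite B" using AB finite_subset by auto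
      have cAB: "card A \<le> n" "card B \<le> n" using AB card_mono[of ?V A] card_mono[of ?V B] by auto
      let ?F = "\<lambda>x y. f (affine_residue (int q) (?\<pi> x) (?\<pi> y))"
      have "of_bool ({x, y} \<in> E0) - p = ?F x y + (real_of_int \<rho> / q - p) - of_bool (x = y \<and> adj0 x y)"
        if "x \<in> A" "y \<in> B" for x y
        using E0_iff[of x y] that AB by (auto simp: f_def adj0_def)
      then have "(\<Sum>x\<in>A. \<Sum>y\<in>B. of_bool ({x, y} \<in> E0) - p) =
        (\<Sum>x\<in>A. \<Sum>y\<in>B. ?F x y + (real_of_int \<rho> / q - p) - (of_bool (x = y \<and> adj0 x y) :: real))"
        by (intro sum.cong refl)
      also have "\<dots> = (\<Sum>x\<in>A. \<Sum>y\<in>B. ?F x y) + card A * (card B * (real_of_int \<rho> / q - p))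
         - (\<Sum>x\<in>A. \<Sum>y\<in>B. (of_bool (x = y \<and> adj0 x y) :: real))"
        by (simp add: sum.distrib sum_subtractf)
      finally have eq: "(\<Sum>x\<in>A. \<Sum>y\<in>B. of_bool ({x, y} \<in> E0) - p) = (\<Sum>x\<in>A. \<Sum>y\<in>B. ?F x y) + card A * (card B * (real_of_int \<rho> / q - p))
         - (\<Sum>x\<in>A. \<Sum>y\<in>B. (of_bool (x = y \<and> adj0 x y) :: real))" .
      have "(\<Sum>x\<in>A. \<Sum>y\<in>B. ?F x y)\<^sup>2 \<le> 16 * real n ^ 4 / q"
        by (rule blow_up_cut[OF pq f0 f1 AB n(1)])
      also have "\<dots> = 16 / q * real n ^ 4" by simp
      also have "\<dots> \<le> \<delta>\<^sup>2 * real n ^ 4" using q1 by (intro mult_right_mono) auto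
      also have "\<dots> = (\<delta> * (real n)\<^sup>2)\<^sup>2" by (simp add: power_mult_distrib flip: power_mult)
      finally have 1: "\<bar>\<Sum>x\<in>A. \<Sum>y\<in>B. ?F x y\<bar> \<le> \<delta> * (real n)\<^sup>2"
        using \<delta> by (intro abs_le_square_iff[THEN iffD2, THEN order.trans[OF _ eq_refl]]) (auto simp: abs_of_nonneg)
      have "\<bar>card A * (card B * (real_of_int \<rho> / q - p))\<bar> = card A * (card B * \<bar>real_of_int \<rho> / q - p\<bar>)" by (simp add: abs_mult)
      also have "\<dots> \<le> n * (n * \<delta>)" using rp cAB by (intro mult_mono) auto
      finally have 2: "\<bar>card A * (card B * (real_of_int \<rho> / q - p))\<bar> \<le> \<delta> * (real n)\<^sup>2" by (simp add: power2_eq_square mult_ac)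
      have "(\<Sum>x\<in>A. \<Sum>y\<in>B. of_bool (x = y \<and> adj0 x y) :: real) \<le> (\<Sum>x\<in>A. \<Sum>y\<in>B. if x = y then 1 else 0)"
        by (intro sum_mono) auto
      also have "\<dots> \<le> (\<Sum>x\<in>A. 1)" using fin by (intro sum_mono) auto
      also have "\<dots> \<le> real n" using cAB by simp
      finally have 3: "(\<Sum>x\<in>A. \<Sum>y\<in>B. of_bool (x = y \<and> adj0 x y) :: real) \<le> \<delta> * (real n)\<^sup>2" using n3 by linarith
      have 4: "(\<Sum>x\<in>A. \<Sum>y\<in>B. of_bool (x = y \<and> adj0 x y) :: real) \<ge> 0" by (intro sum_nonneg) auto
      have "\<bar>X + Y - Z\<bar> \<le> 3 * t" if "\<bar>X\<bar> \<le> t" "\<bar>Y\<bar> \<le> t" "Z \<le> t" "0 \<le> Z" for X Y Z t :: real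
        using that by linarith
      from this[OF 1 2 3 4] show ?thesis unfolding eq by (simp only: mult.assoc)
    qed
    define e where "e = nat \<lfloor>p * real (n choose 2)\<rfloor>"
    have pc: "0 \<le> p * real (n choose 2)" "p * real (n choose 2) \<le> n choose 2" using p by (auto simp: mult_left_le_one_le)
    have e_int: "int e = \<lfloor>p * real (n choose 2)\<rfloor>" using pc by (simp add: e_def)
    have e_le: "e \<le> n choose 2" using pc(2) e_int by linarith
    have e_real: "\<bar>real e - p * real (n choose 2)\<bar> \<le> 1" using e_int by linarith
    have choose: "2 * real (n choose 2) = (real n)\<^sup>2 - real n"
      by (simp add: choose_two_real power2_eq_square algebra_simps)
    have d0: "\<bar>2 * real (card E0) - p * (real n)\<^sup>2\<bar> \<le> 3 * \<delta> * (real n)\<^sup>2"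
    proof -
      have "(\<Sum>x\<in>?V. \<Sum>y\<in>?V. of_bool ({x, y} \<in> E0) - p) = 2 * real (card E0) - p * (real n)\<^sup>2"
        using sum_edges[OF _ E0] by (simp add: sum_subtractf power2_eq_square)
      then show ?thesis using cut0[of ?V ?V] by simp
    qed
    \<comment> \<open>The deviation in \<open>d0\<close> is joined by the diagonal term
      \<open>p * n\<close> and the rounding of the edge number, together at most
      \<open>3 * n\<close>.\<close>
    have diff: "2 * \<bar>real (card E0) - real e\<bar> \<le> 4 * \<delta> * (real n)\<^sup>2"
    proof -
      have "p * (real n)\<^sup>2 - 2 * (p * real (n choose 2)) = p * real n"
      proof -
        have "2 * (p * real (n choose 2)) = p * (2 * real (n choose 2))" by simp
        then show ?thesis unfolding choose by (simp add: right_diff_distrib)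
      qed
      moreover have "p * real n \<le> real n" "0 \<le> p * real n" using p by (auto simp: mult_left_le_one_le)
      moreover have "real n \<ge> 1" using n by simp
      moreover have "2 * \<bar>C - c\<bar> \<le> 4 * t"
        if "P - 2 * Q = pn" "pn \<le> N" "0 \<le> pn" "1 \<le> N" "\<bar>2 * C - P\<bar> \<le> 3 * t" "\<bar>c - Q\<bar> \<le> 1" "3 * N \<le> t"
        for P Q pn N C c t :: real
        using that by (simp add: abs_if split: if_splits)
      ultimately show ?thesis using d0 e_real n3 unfolding mult.assoc by blast
    qed
    obtain E where E: "E \<subseteq> nsets ?V 2" "card E = e" "real (card (sym_diff E E0)) = \<bar>real (card E0) - real e\<bar>"
    proof (cases "e \<le> card E0")
      case True
      then obtain E where E: "E \<subseteq> E0" "card E = e" "finite E" using obtain_subset_with_card_n by metis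
      have "sym_diff E E0 = E0 - E" using E by blast
      then have "card (sym_diff E E0) = card E0 - e" using E by (simp add: card_Diff_subset)
      then show thesis using that[of E] E E0 True by (auto simp: of_nat_diff)
    next
      case False
      then obtain E where E: "E0 \<subseteq> E" "E \<subseteq> nsets ?V 2" "card E = e"
        using exists_subset_between[of E0 e "nsets ?V 2"] E0 fN cN e_le by auto
      have fE0: "finite E0" using E0 fN finite_subset by blast
      have "sym_diff E E0 = E - E0" using E by blast
      then have "card (sym_diff E E0) = e - card E0" using E fE0 by (simp add: card_Diff_subset)
      then show thesis using that[of E] E False by (auto simp: of_nat_diff)
    qed
    have "\<bar>\<Sum>x\<in>A. \<Sum>y\<in>B. of_bool ({x, y} \<in> E) - p\<bar> \<le> \<epsilon> * (real n)\<^sup>2" if AB: "A \<subseteq> ?V" "B \<subseteq> ?V" for A B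
    proof -
      have "(\<Sum>x\<in>A. \<Sum>y\<in>B. of_bool ({x, y} \<in> E) - p) - (\<Sum>x\<in>A. \<Sum>y\<in>B. of_bool ({x, y} \<in> E0) - p) =
        (\<Sum>x\<in>A. \<Sum>y\<in>B. of_bool ({x, y} \<in> E) - of_bool ({x, y} \<in> E0))"
        by (simp add: sum_subtractf)
      also have "\<bar>\<dots>\<bar> \<le> (\<Sum>x\<in>A. \<Sum>y\<in>B. of_bool ({x, y} \<in> sym_diff E E0))"
      proof (rule order.trans[OF sum_abs], rule sum_mono, rule order.trans[OF sum_abs], rule sum_mono)
        fix x y show "\<bar>of_bool ({x, y} \<in> E) - of_bool ({x, y} \<in> E0)\<bar> \<le> (of_bool ({x, y} \<in> sym_diff E E0) :: real)" by auto
      qed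
      also have "\<dots> \<le> (\<Sum>x\<in>?V. \<Sum>y\<in>B. of_bool ({x, y} \<in> sym_diff E E0))"
        by (rule sum_mono2) (use AB in \<open>auto intro!: sum_nonneg\<close>)
      also have "\<dots> \<le> (\<Sum>x\<in>?V. \<Sum>y\<in>?V. of_bool ({x, y} \<in> sym_diff E E0))"
        by (rule sum_mono, rule sum_mono2) (use AB in auto)
      also have "\<dots> = 2 * real (card (sym_diff E E0))" by (rule sum_edges) (use E E0 in auto)
      also have "\<dots> \<le> 4 * \<delta> * (real n)\<^sup>2" using E(3) diff by simp
      finally have "\<bar>(\<Sum>x\<in>A. \<Sum>y\<in>B. of_bool ({x, y} \<in> E) - p) - (\<Sum>x\<in>A. \<Sum>y\<in>B. of_bool ({x, y} \<in> E0) - p)\<bar> \<le> 4 * \<delta> * (real n)\<^sup>2" .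
      moreover have "\<epsilon> * (real n)\<^sup>2 = 8 * (\<delta> * (real n)\<^sup>2)" by (simp add: \<delta>_def)
      moreover have "0 \<le> \<delta> * (real n)\<^sup>2" using \<delta> by simp
      ultimately show ?thesis using cut0[OF AB] by linarith
    qed
    then show "\<exists>E\<subseteq>nsets {..<n} 2. int (card E) = \<lfloor>p * real (n choose 2)\<rfloor> \<and>
     (\<forall>A\<subseteq>{..<n}. \<forall>B\<subseteq>{..<n}. \<bar>\<Sum>x\<in>A. \<Sum>y\<in>B. of_bool ({x, y} \<in> E) - p\<bar> \<le> \<epsilon> * (real n)\<^sup>2)"
      using E(1,2) e_int by (intro exI[of _ E]) auto
  qed
qed

section \<open>The edit distance function\<close>

text \<open>Greedy colouring: each new vertex takes the colour that is rarest among its earlier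
  neighbours, so at most a fraction \<open>1 / r\<close> of the new edges becomes
  monochromatic.\<close>

lemma exists_colouring_few_monochromatic:
  assumes "finite V" "r \<ge> 1"
  shows "\<exists>f. (\<forall>x. f x < r) \<and> r * card {{u, v} | u v. u \<in> V \<and> v \<in> V \<and> {u, v} \<in> E \<and> u \<noteq> v \<and> f u = f v}
     \<le> card (E \<inter> nsets V 2)"
  using assms(1)
proof (induction V)
  case empty
  show ?case using assms(2) by (intro exI[of _ "\<lambda>_. 0"]) auto
next
  case (insert w V)
  let ?mono = "\<lambda>V f. {{u, v} | u v. u \<in> V \<and> v \<in> V \<and> {u, v} \<in> E \<and> u \<noteq> v \<and> f u = (f v :: nat)}"
  obtain f where f: "\<forall>x. f x < r" "r * card (?mono V f) \<le> card (E \<inter> nsets V 2)"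
    using insert.IH by blast
  define N where "N = {u \<in> V. {w, u} \<in> E}"
  define d where "d c = card {u \<in> N. f u = c}" for c
  have fN: "finite N" using insert by (simp add: N_def)
  have sumd: "(\<Sum>c<r. d c) = card N"
  proof -
    have "(\<Sum>c<r. \<Sum>u | u \<in> N \<and> f u = c. 1) = (\<Sum>u\<in>N. 1::nat)"
      by (rule sum.group[OF fN]) (use f in auto)
    then show ?thesis by (simp add: d_def)
  qed
  obtain c where c: "c < r" "r * d c \<le> card N"
  proof (rule ccontr)
    assume "\<not> thesis"
    then have lt: "card N < r * d c" if "c < r" for c using that \<open>\<And>c. c < r \<Longrightarrow> r * d c \<le> card N \<Longrightarrow> thesis\<close> by force
    have "(\<Sum>c<r. card N) < (\<Sum>c<r. r * d c)"
      by (rule sum_strict_mono) (use lt assms(2) in \<open>auto simp: lessThan_empty_iff\<close>)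
    then show False using sumd by (simp add: sum_distrib_left[symmetric])
  qed
  define g where "g = f(w := c)"
  have gV: "g u = f u" if "u \<in> V" for u using insert that by (auto simp: g_def)
  have gw: "g w = c" by (simp add: g_def)
  have "?mono (insert w V) g \<subseteq> ?mono V f \<union> (\<lambda>u. {w, u}) ` {u \<in> N. f u = c}"
  proof
    fix e assume "e \<in> ?mono (insert w V) g"
    then obtain u v where uv: "e = {u, v}" "u \<in> insert w V" "v \<in> insert w V" "{u, v} \<in> E" "u \<noteq> v" "g u = g v" by blast
    consider "u \<in> V" "v \<in> V" | "u = w" "v \<in> V" | "v = w" "u \<in> V" using uv by blast
    then show "e \<in> ?mono V f \<union> (\<lambda>u. {w, u}) ` {u \<in> N. f u = c}"
    proof cases
      case 1
      then have "f u = f v" using gV uv by metis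
      then show ?thesis using uv 1 by blast
    next
      case 2
      then have "v \<in> {u \<in> N. f u = c}" using gV[OF 2(2)] gw uv by (simp add: N_def)
      then show ?thesis using uv 2 by blast
    next
      case 3
      then have "u \<in> {u \<in> N. f u = c}" using gV[OF 3(2)] gw uv by (simp add: N_def insert_commute)
      moreover have "e = {w, u}" using uv 3 by blast
      ultimately show ?thesis by blast
    qed
  qed
  moreover have fm: "finite (?mono V f)"
    by (rule finite_subset[of _ "Pow V"]) (use insert in auto)
  ultimately have "card (?mono (insert w V) g) \<le> card (?mono V f \<union> (\<lambda>u. {w, u}) ` {u \<in> N. f u = c})"
    using fN by (intro card_mono) auto
  also have "\<dots> \<le> card (?mono V f) + card ((\<lambda>u. {w, u}) ` {u \<in> N. f u = c})" by (rule card_Un_le)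
  also have "card ((\<lambda>u. {w, u}) ` {u \<in> N. f u = c}) \<le> d c"
    unfolding d_def by (rule card_image_le) (use fN in auto)
  finally have "card (?mono (insert w V) g) \<le> card (?mono V f) + d c" by simp
  then have "r * card (?mono (insert w V) g) \<le> r * (card (?mono V f) + d c)" by (rule mult_le_mono2)
  also have "\<dots> = r * card (?mono V f) + r * d c" by (rule distrib_left)
  also have "\<dots> \<le> card (E \<inter> nsets V 2) + card N" using f c by (intro add_mono)
  also have "card N = card ((\<lambda>u. {w, u}) ` N)"
    by (rule card_image[symmetric]) (use insert in \<open>auto simp: inj_on_def doubleton_eq_iff N_def\<close>)
  also have "card (E \<inter> nsets V 2) + \<dots> = card ((E \<inter> nsets V 2) \<union> (\<lambda>u. {w, u}) ` N)"
  proof (rule card_Un_disjoint[symmetric])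
    show "finite (E \<inter> nsets V 2)" using insert.hyps(1) by (simp add: finite_imp_finite_nsets)
    show "E \<inter> nsets V 2 \<inter> (\<lambda>u. {w, u}) ` N = {}" using insert.hyps(2) by (auto simp: nsets_def)
  qed (use fN in simp)
  also have "\<dots> \<le> card (E \<inter> nsets (insert w V) 2)"
  proof (rule card_mono)
    show "finite (E \<inter> nsets (insert w V) 2)" using insert.hyps(1) by (simp add: finite_imp_finite_nsets)
    have "nsets V 2 \<subseteq> nsets (insert w V) 2" by (rule nsets_mono) auto
    moreover have "(\<lambda>u. {w, u}) ` N \<subseteq> E \<inter> nsets (insert w V) 2"
      using insert.hyps(2) by (auto simp: N_def)
    ultimately show "(E \<inter> nsets V 2) \<union> (\<lambda>u. {w, u}) ` N \<subseteq> E \<inter> nsets (insert w V) 2" by blast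
  qed
  finally show ?case using f c by (intro exI[of _ g]) (auto simp: g_def)
qed

lemma clique_iff: "Defs.clique G C \<longleftrightarrow> C \<subseteq> verts G \<and> (\<forall>u\<in>C. \<forall>v\<in>C. u \<noteq> v \<longrightarrow> {u, v} \<in> edges G)"
  unfolding Defs.clique_def by (auto simp: nsets_2_eq)

lemma independent_iff: "independent G C \<longleftrightarrow> C \<subseteq> verts G \<and> (\<forall>u\<in>C. \<forall>v\<in>C. u \<noteq> v \<longrightarrow> {u, v} \<notin> edges G)"
  unfolding independent_def by (auto simp: nsets_2_eq)

lemma
  assumes "ugraph G"
  shows clique_number_ge: "Defs.clique G C \<Longrightarrow> card C \<le> clique_number G"
    and clique_number_attained: "\<exists>C. Defs.clique G C \<and> card C = clique_number G"
    and independence_number_ge: "independent G C \<Longrightarrow> card C \<le> independence_number G"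
    and independence_number_attained: "\<exists>C. independent G C \<and> card C = independence_number G"
proof -
  have fin: "finite (card ` {C. Defs.clique G C})" "finite (card ` {C. independent G C})"
    using assms by (auto simp: ugraph_def clique_iff independent_iff intro!: finite_imageI finite_subset[of _ "Pow (verts G)"])
  have "Defs.clique G {}" "independent G {}" by (auto simp: clique_iff independent_iff)
  then have ne: "card ` {C. Defs.clique G C} \<noteq> {}" "card ` {C. independent G C} \<noteq> {}" by auto
  show "Defs.clique G C \<Longrightarrow> card C \<le> clique_number G" "independent G C \<Longrightarrow> card C \<le> independence_number G"
    unfolding clique_number_def independence_number_def using fin by (auto intro: Max_ge)
  show "\<exists>C. Defs.clique G C \<and> card C = clique_number G"
    using Max_in[OF fin(1) ne(1)] unfolding clique_number_def by (metis (mono_tags, lifting) imageE mem_Collect_eq)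
  show "\<exists>C. independent G C \<and> card C = independence_number G"
    using Max_in[OF fin(2) ne(2)] unfolding independence_number_def by (metis (mono_tags, lifting) imageE mem_Collect_eq)
qed

section \<open>Editing into the property, and basic facts on distances\<close>

locale nontrivial_split_graph =
  fixes H :: "'a ugraph" and \<alpha> \<omega> :: nat
  assumes split: "split_graph H" and not_complete: "\<not> complete_graph H" and not_edgeless: "\<not> edgeless_graph H"
    and \<alpha>: "\<alpha> = independence_number H" and \<omega>: "\<omega> = clique_number H"
begin

lemma ugraph_H: "ugraph H" using split by (simp add: split_graph_def)

lemma omega_ge: "\<omega> \<ge> 2"
proof -
  obtain e where e: "e \<in> edges H" using not_edgeless by (auto simp: edgeless_graph_def)
  then have "e \<in> nsets (verts H) 2" using ugraph_H by (auto simp: ugraph_def)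
  then obtain u v where "e = {u, v}" "u \<in> verts H" "v \<in> verts H" "u \<noteq> v" by (rule nsets2_E)
  then have "Defs.clique H {u, v}" "card {u, v} = 2" using e by (auto simp: clique_iff insert_commute)
  then show ?thesis using clique_number_ge[OF ugraph_H] \<omega> by metis
qed

lemma alpha_ge: "\<alpha> \<ge> 2"
proof -
  have "edges H \<subseteq> nsets (verts H) 2" using ugraph_H by (auto simp: ugraph_def)
  then obtain e where e: "e \<in> nsets (verts H) 2" "e \<notin> edges H"
    using not_complete by (auto simp: complete_graph_def)
  from e(1) obtain u v where "e = {u, v}" "u \<in> verts H" "v \<in> verts H" "u \<noteq> v" by (rule nsets2_E)
  then have "independent H {u, v}" "card {u, v} = 2" using e by (auto simp: independent_iff insert_commute)
  then show ?thesis using independence_number_ge[OF ugraph_H] \<alpha> by metis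
qed

text \<open>A copy of \<open>H\<close> would contain a clique of size \<open>\<omega>\<close>, whose
  vertices need different colours.\<close>

lemma Forb_if_partite:
  assumes V: "finite V" and E: "E \<subseteq> nsets V 2" and f: "\<forall>x. f x < \<omega> - 1"
    and neq: "\<And>u v. {u, v} \<in> E \<Longrightarrow> f u \<noteq> f v"
  shows "(V, E) \<in> Forb H"
proof (rule ccontr)
  assume "(V, E) \<notin> Forb H"
  then obtain W where W: "W \<subseteq> V" "graph_iso H (induced_subgraph (V, E) W)"
    using V E by (auto simp: Forb_def ugraph_def)
  then obtain \<phi> where \<phi>: "E \<inter> nsets W 2 = (\<lambda>e. \<phi> ` e) ` edges H"
    by (auto simp: graph_iso_def induced_subgraph_def)
  obtain C where C: "Defs.clique H C" "card C = \<omega>" using clique_number_attained[OF ugraph_H] \<omega> by blast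
  have "\<not> inj_on (\<lambda>u. f (\<phi> u)) C"
  proof
    assume "inj_on (\<lambda>u. f (\<phi> u)) C"
    then have "card C \<le> card {..<\<omega> - 1}" by (rule card_inj_on_le) (use f in auto)
    then show False using C omega_ge by simp
  qed
  then obtain u v where uv: "u \<in> C" "v \<in> C" "u \<noteq> v" "f (\<phi> u) = f (\<phi> v)" by (auto simp: inj_on_def)
  then have "{u, v} \<in> edges H" using C by (auto simp: clique_iff)
  then have "\<phi> ` {u, v} \<in> E" using \<phi> by blast
  then show False using neq[of "\<phi> u" "\<phi> v"] uv by simp
qed

text \<open>The complementary argument with independent sets; injectivity of the isomorphism carries
  nonedges of \<open>H\<close> to nonedges of the copy.\<close>

lemma Forb_if_copartite:
  assumes V: "finite V" and E: "E \<subseteq> nsets V 2" and f: "\<forall>x. f x < \<alpha> - 1"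
    and neq: "\<And>u v. {u, v} \<in> nsets V 2 \<Longrightarrow> {u, v} \<notin> E \<Longrightarrow> f u \<noteq> f v"
  shows "(V, E) \<in> Forb H"
proof (rule ccontr)
  assume "(V, E) \<notin> Forb H"
  then obtain W where W: "W \<subseteq> V" "graph_iso H (induced_subgraph (V, E) W)"
    using V E by (auto simp: Forb_def ugraph_def)
  then obtain \<phi> where \<phi>: "bij_betw \<phi> (verts H) W" "E \<inter> nsets W 2 = (\<lambda>e. \<phi> ` e) ` edges H"
    by (auto simp: graph_iso_def induced_subgraph_def)
  obtain C where C: "independent H C" "card C = \<alpha>" using independence_number_attained[OF ugraph_H] \<alpha> by blast
  have CH: "C \<subseteq> verts H" using C by (simp add: independent_iff)
  have inj: "inj_on \<phi> (verts H)" using \<phi> by (simp add: bij_betw_def)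
  have "\<not> inj_on (\<lambda>u. f (\<phi> u)) C"
  proof
    assume "inj_on (\<lambda>u. f (\<phi> u)) C"
    then have "card C \<le> card {..<\<alpha> - 1}" by (rule card_inj_on_le) (use f in auto)
    then show False using C alpha_ge by simp
  qed
  then obtain u v where uv: "u \<in> C" "v \<in> C" "u \<noteq> v" "f (\<phi> u) = f (\<phi> v)" by (auto simp: inj_on_def)
  have "\<phi> u \<in> W" "\<phi> v \<in> W" "\<phi> u \<noteq> \<phi> v"
    using uv CH \<phi>(1) inj by (auto simp: bij_betw_def dest: inj_onD)
  then have nW: "{\<phi> u, \<phi> v} \<in> nsets W 2" "{\<phi> u, \<phi> v} \<in> nsets V 2" using W by auto
  then have "{\<phi> u, \<phi> v} \<in> E" using neq uv by blast
  then obtain e where e: "e \<in> edges H" "{\<phi> u, \<phi> v} = \<phi> ` e" using \<phi>(2) nW by blast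
  have "e \<subseteq> verts H" using e ugraph_H by (auto simp: ugraph_def nsets_def)
  moreover have "\<phi> ` {u, v} = \<phi> ` e" using e by simp
  ultimately have "e = {u, v}" using inj_on_image_eq_iff[OF inj, of "{u, v}" e] uv CH by auto
  then show False using e uv C by (auto simp: independent_iff)
qed

lemma exists_close_Forb:
  assumes G: "ugraph G" and n: "card (verts G) \<ge> 2"
  shows "\<exists>G'\<in>Forb H. verts G' = verts G \<and>
      graph_dist G G' \<le> card (edges G) / (real \<omega> - 1) / (card (verts G) choose 2)"
    and "\<exists>G'\<in>Forb H. verts G' = verts G \<and>
      graph_dist G G' \<le> (real (card (verts G) choose 2) - card (edges G)) / (real \<alpha> - 1) / (card (verts G) choose 2)"
proof -
  let ?V = "verts G" and ?E = "edges G"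
  have fV: "finite ?V" and EV: "?E \<subseteq> nsets ?V 2" using G by (auto simp: ugraph_def)
  have fN: "finite (nsets ?V 2)" using fV by (rule finite_imp_finite_nsets)
  let ?mono = "\<lambda>E f. {{u, v} | u v. u \<in> ?V \<and> v \<in> ?V \<and> {u, v} \<in> E \<and> u \<noteq> v \<and> f u = (f v :: nat)}"
  obtain f where f: "\<forall>x. f x < \<omega> - 1" "(\<omega> - 1) * card (?mono ?E f) \<le> card (?E \<inter> nsets ?V 2)"
  proof -
    have "\<omega> - 1 \<ge> 1" using omega_ge by simp
    then show thesis using exists_colouring_few_monochromatic[OF fV, of "\<omega> - 1" ?E] that by blast
  qed
  define M where "M = ?mono ?E f"
  have cM: "(\<omega> - 1) * card M \<le> card (?E \<inter> nsets ?V 2)" using f(2) unfolding M_def .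
  have mM: "M \<subseteq> ?E" by (auto simp: M_def)
  have 1: "(?V, ?E - M) \<in> Forb H"
  proof (rule Forb_if_partite[OF fV _ f(1)])
    fix u v assume uv: "{u, v} \<in> ?E - M"
    then have "{u, v} \<in> nsets ?V 2" using EV by blast
    then have "u \<in> ?V" "v \<in> ?V" "u \<noteq> v" unfolding doubleton_in_nsets_2 by blast+
    then show "f u \<noteq> f v" using uv unfolding M_def by blast
  qed (use EV in auto)
  have "sym_diff ?E (?E - M) = M" using mM by blast
  then have "graph_dist G (?V, ?E - M) = card (M) / (card ?V choose 2)"
    unfolding graph_dist_def by simp
  moreover have "real (card (M)) \<le> card ?E / (real \<omega> - 1)"
  proof -
    have "real ((\<omega> - 1) * card (M)) \<le> real (card ?E)" using cM EV by (simp only: Int_absorb2 of_nat_le_iff)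
    then have "(real \<omega> - 1) * card (M) \<le> card ?E" using omega_ge by (simp add: of_nat_diff)
    then show ?thesis using omega_ge by (simp add: pos_le_divide_eq mult.commute)
  qed
  ultimately have "graph_dist G (?V, ?E - M) \<le> card ?E / (real \<omega> - 1) / (card ?V choose 2)"
    by (simp only:) (rule divide_right_mono, simp_all)
  then show "\<exists>G'\<in>Forb H. verts G' = ?V \<and> graph_dist G G' \<le> card ?E / (real \<omega> - 1) / (card ?V choose 2)"
    using 1 by (intro bexI[of _ "(?V, ?E - M)"]) auto
  let ?N = "nsets ?V 2 - ?E"
  obtain g where g: "\<forall>x. g x < \<alpha> - 1" "(\<alpha> - 1) * card (?mono ?N g) \<le> card (?N \<inter> nsets ?V 2)"
  proof -
    have "\<alpha> - 1 \<ge> 1" using alpha_ge by simp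
    then show thesis using exists_colouring_few_monochromatic[OF fV, of "\<alpha> - 1" ?N] that by blast
  qed
  define L where "L = ?mono ?N g"
  have cL: "(\<alpha> - 1) * card L \<le> card (?N \<inter> nsets ?V 2)" using g(2) unfolding L_def .
  have mN: "L \<subseteq> ?N" by (auto simp: L_def)
  have 2: "(?V, ?E \<union> L) \<in> Forb H"
  proof (rule Forb_if_copartite[OF fV _ g(1)])
    show "?E \<union> L \<subseteq> nsets ?V 2" using EV mN by blast
    fix u v assume uv: "{u, v} \<in> nsets ?V 2" "{u, v} \<notin> ?E \<union> L"
    then have "u \<in> ?V" "v \<in> ?V" "u \<noteq> v" unfolding doubleton_in_nsets_2 by blast+
    then show "g u \<noteq> g v" using uv unfolding L_def by blast
  qed
  have "sym_diff ?E (?E \<union> L) = L" using mN by blast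
  then have "graph_dist G (?V, ?E \<union> L) = card (L) / (card ?V choose 2)"
    unfolding graph_dist_def by simp
  moreover have "real (card (L)) \<le> (real (card ?V choose 2) - card ?E) / (real \<alpha> - 1)"
  proof -
    have "card ?N = (card ?V choose 2) - card ?E" using EV fN finite_subset[OF EV fN] by (simp add: card_Diff_subset card_nsets)
    moreover have "card ?E \<le> card ?V choose 2" using card_mono[OF fN EV] by (simp add: card_nsets)
    ultimately have cN: "real (card ?N) = real (card ?V choose 2) - card ?E" by (simp add: of_nat_diff)
    have "?N \<inter> nsets ?V 2 = ?N" by blast
    then have "real ((\<alpha> - 1) * card (L)) \<le> real (card ?N)" using cL by (simp only: of_nat_le_iff)
    then have "(real \<alpha> - 1) * card (L) \<le> card ?N" using alpha_ge by (simp add: of_nat_diff)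
    then show ?thesis using alpha_ge cN by (simp add: pos_le_divide_eq mult.commute)
  qed
  ultimately have "graph_dist G (?V, ?E \<union> L) \<le> (real (card ?V choose 2) - card ?E) / (real \<alpha> - 1) / (card ?V choose 2)"
    by (simp only:) (rule divide_right_mono, simp_all)
  then show "\<exists>G'\<in>Forb H. verts G' = ?V \<and> graph_dist G G' \<le> (real (card ?V choose 2) - card ?E) / (real \<alpha> - 1) / (card ?V choose 2)"
    using 2 by (intro bexI[of _ "(?V, ?E \<union> L)"]) auto
qed

text \<open>The minimum in \<open>property_dist\<close> is taken over finitely many graphs on the
  given vertices, and \<open>exists_close_Forb\<close> shows that there is at least one.\<close>

lemma
  assumes G: "ugraph G" and n: "card (verts G) \<ge> 2"
  shows property_dist_le: "G' \<in> Forb H \<Longrightarrow> verts G' = verts G \<Longrightarrow> property_dist G (Forb H) \<le> graph_dist G G'"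
    and property_dist_attained: "\<exists>G'\<in>Forb H. verts G' = verts G \<and> property_dist G (Forb H) = graph_dist G G'"
proof -
  let ?S = "{G' \<in> Forb H. verts G' = verts G}"
  have "?S \<subseteq> {verts G} \<times> Pow (nsets (verts G) 2)" by (auto simp: Forb_def ugraph_def)
  moreover have "finite ({verts G} \<times> Pow (nsets (verts G) 2))"
    using G by (auto simp: ugraph_def finite_imp_finite_nsets)
  ultimately have fS: "finite ?S" by (rule finite_subset)
  have ne: "?S \<noteq> {}" using exists_close_Forb(1)[OF assms] by blast
  show "G' \<in> Forb H \<Longrightarrow> verts G' = verts G \<Longrightarrow> property_dist G (Forb H) \<le> graph_dist G G'"
    unfolding property_dist_def using fS by (intro Min_le) auto
  have "property_dist G (Forb H) \<in> graph_dist G ` ?S"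
    unfolding property_dist_def using fS ne by (intro Min_in) auto
  then show "\<exists>G'\<in>Forb H. verts G' = verts G \<and> property_dist G (Forb H) = graph_dist G G'" by blast
qed

text \<open>There are infinitely many vertex sets of size \<open>n\<close>, so the finiteness behind
  \<open>Max\<close> must come from the values: all are multiples of
  \<open>1 / (n choose 2)\<close>.\<close>

lemma finite_property_dists:
  assumes "n \<ge> 2"
  shows "finite ((\<lambda>G. property_dist G (Forb H)) ` {G. ugraph G \<and> card (verts G) = n \<and> Q G})"
proof (rule finite_subset)
  show "finite ((\<lambda>i. real i / real (n choose 2)) ` {..n choose 2})" by simp
  show "(\<lambda>G. property_dist G (Forb H)) ` {G. ugraph G \<and> card (verts G) = n \<and> Q G} \<subseteq>
     (\<lambda>i. real i / real (n choose 2)) ` {..n choose 2}"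
  proof clarify
    fix V :: "nat set" and E assume G: "ugraph (V, E)" "n = card (verts (V, E))"
    obtain G' where G': "G' \<in> Forb H" "verts G' = V" "property_dist (V, E) (Forb H) = graph_dist (V, E) G'"
      using property_dist_attained[OF G(1)] G(2) assms by auto
    have "sym_diff E (edges G') \<subseteq> nsets V 2" using G G' by (auto simp: Forb_def ugraph_def)
    then have "card (sym_diff E (edges G')) \<le> card (nsets V 2)"
      using G by (intro card_mono finite_imp_finite_nsets) (auto simp: ugraph_def)
    then have "card (sym_diff E (edges G')) \<le> card V choose 2" by (simp add: card_nsets)
    then show "property_dist (V, E) (Forb H) \<in> (\<lambda>i. real i / real (card (verts (V, E)) choose 2)) ` {..card (verts (V, E)) choose 2}"
      using G' G by (auto simp: graph_dist_def)
  qed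
qed


text \<open>The vertices of \<open>H\<close> are numbered because the counting argument indexes
  tuples by naturals, while \<open>H\<close> may live on any type.\<close>

lemma obtain_pattern:
  obtains h :: nat and lab :: "nat \<Rightarrow> 'a" and K S where "bij_betw lab {..<h} (verts H)" "K \<union> S = {..<h}"
    "split_pattern K S (\<lambda>i j. {lab i, lab j} \<in> edges H) (\<alpha> - 1) (\<omega> - 1)"
proof -
  obtain K0 S0 where KS: "K0 \<union> S0 = verts H" "K0 \<inter> S0 = {}" "Defs.clique H K0" "independent H S0"
    using split by (auto simp: split_graph_def)
  have "finite (verts H)" using ugraph_H by (simp add: ugraph_def)
  then obtain lab where "bij_betw lab {0..<card (verts H)} (verts H)" using ex_bij_betw_nat_finite by blast
  then have lab: "bij_betw lab {..<card (verts H)} (verts H)" by (simp add: atLeast0LessThan)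
  let ?h = "card (verts H)"
  have inj: "inj_on lab {..<?h}" and im: "lab ` {..<?h} = verts H" using lab by (auto simp: bij_betw_def)
  have ne: "lab i \<noteq> lab j" if "i < ?h" "j < ?h" "i \<noteq> j" for i j using inj that by (auto dest: inj_onD)
  define K where "K = {i \<in> {..<?h}. lab i \<in> K0}"
  define S where "S = {i \<in> {..<?h}. lab i \<in> S0}"
  have KSh: "K \<union> S = {..<?h}" using KS(1) im by (auto simp: K_def S_def)
  have pull: "\<exists>C\<subseteq>{..<?h}. lab ` C = X \<and> card C = card X" if "X \<subseteq> verts H" for X
  proof (intro exI[of _ "{i \<in> {..<?h}. lab i \<in> X}"] conjI)
    show eq: "lab ` {i \<in> {..<?h}. lab i \<in> X} = X" using that im by auto
    have "card (lab ` {i \<in> {..<?h}. lab i \<in> X}) = card {i \<in> {..<?h}. lab i \<in> X}"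
      by (rule card_image, rule inj_on_subset[OF inj]) auto
    then show "card {i \<in> {..<?h}. lab i \<in> X} = card X" unfolding eq by simp
  qed auto
  have cardl: "card (lab ` C) = card C" if "C \<subseteq> {..<?h}" for C
    by (rule card_image, rule inj_on_subset[OF inj that])
  have "split_pattern K S (\<lambda>i j. {lab i, lab j} \<in> edges H) (\<alpha> - 1) (\<omega> - 1)"
  proof
    show "finite K" "finite S" by (auto simp: K_def S_def)
    show "K \<inter> S = {}" using KS(2) by (auto simp: K_def S_def)
    show "{lab u, lab v} \<in> edges H \<longleftrightarrow> {lab v, lab u} \<in> edges H" for u v by (simp add: insert_commute)
    show "{lab u, lab v} \<in> edges H" if "u \<in> K" "v \<in> K" "u \<noteq> v" for u v
      using KS(3) that ne unfolding K_def clique_iff by auto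
    show "{lab u, lab v} \<notin> edges H" if "u \<in> S" "v \<in> S" "u \<noteq> v" for u v
      using KS(4) that ne unfolding S_def independent_iff by auto
    show "card C \<le> \<omega> - 1 + 1" if C: "C \<subseteq> K \<union> S" "\<And>u v. u \<in> C \<Longrightarrow> v \<in> C \<Longrightarrow> u \<noteq> v \<Longrightarrow> {lab u, lab v} \<in> edges H" for C
    proof -
      have C': "C \<subseteq> {..<?h}" using C(1) KSh by simp
      have "Defs.clique H (lab ` C)" unfolding clique_iff using C(2) C' im by blast
      from clique_number_ge[OF ugraph_H this] show ?thesis using cardl[OF C'] \<omega> omega_ge by simp
    qed
    show "card C \<le> \<alpha> - 1 + 1" if C: "C \<subseteq> K \<union> S" "\<And>u v. u \<in> C \<Longrightarrow> v \<in> C \<Longrightarrow> u \<noteq> v \<Longrightarrow> {lab u, lab v} \<notin> edges H" for C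
    proof -
      have C': "C \<subseteq> {..<?h}" using C(1) KSh by simp
      have "independent H (lab ` C)" unfolding independent_iff using C(2) C' im by blast
      from independence_number_ge[OF ugraph_H this] show ?thesis using cardl[OF C'] \<alpha> alpha_ge by simp
    qed
    show "\<exists>C\<subseteq>K \<union> S. (\<forall>u\<in>C. \<forall>v\<in>C. u \<noteq> v \<longrightarrow> {lab u, lab v} \<in> edges H) \<and> card C = \<omega> - 1 + 1"
    proof -
      obtain X where X: "Defs.clique H X" "card X = \<omega>" using clique_number_attained[OF ugraph_H] \<omega> by blast
      then obtain C where C: "C \<subseteq> {..<?h}" "lab ` C = X" "card C = card X" using pull[of X] by (auto simp: clique_iff)
      have "{lab u, lab v} \<in> edges H" if "u \<in> C" "v \<in> C" "u \<noteq> v" for u v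
      proof -
        have "lab u \<in> X" "lab v \<in> X" "lab u \<noteq> lab v" using C(1,2) that ne[of u v] by auto
        then show ?thesis using X(1) by (simp add: clique_iff)
      qed
      then show ?thesis using C X(2) omega_ge KSh by (intro exI[of _ C]) auto
    qed
    show "\<exists>C\<subseteq>K \<union> S. (\<forall>u\<in>C. \<forall>v\<in>C. u \<noteq> v \<longrightarrow> {lab u, lab v} \<notin> edges H) \<and> card C = \<alpha> - 1 + 1"
    proof -
      obtain X where X: "independent H X" "card X = \<alpha>" using independence_number_attained[OF ugraph_H] \<alpha> by blast
      then obtain C where C: "C \<subseteq> {..<?h}" "lab ` C = X" "card C = card X" using pull[of X] by (auto simp: independent_iff)
      have "{lab u, lab v} \<notin> edges H" if "u \<in> C" "v \<in> C" "u \<noteq> v" for u v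
      proof -
        have "lab u \<in> X" "lab v \<in> X" "lab u \<noteq> lab v" using C(1,2) that ne[of u v] by auto
        then show ?thesis using X(1) by (simp add: independent_iff)
      qed
      then show ?thesis using C X(2) alpha_ge KSh by (intro exI[of _ C]) auto
    qed
    show "1 \<le> \<alpha> - 1" "1 \<le> \<omega> - 1" using alpha_ge omega_ge by auto
  qed
  then show thesis using that[OF lab KSh] by blast
qed

lemma not_Forb_if_copy:
  assumes lab: "bij_betw lab {..<h} (verts H)" and z: "z ` {..<h} \<subseteq> V" "inj_on z {..<h}"
    and adj: "\<And>u v. u < h \<Longrightarrow> v < h \<Longrightarrow> u \<noteq> v \<Longrightarrow> {z u, z v} \<in> E \<longleftrightarrow> {lab u, lab v} \<in> edges H"
  shows "(V, E) \<notin> Forb H"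
proof -
  define \<phi> where "\<phi> = z \<circ> inv_into {..<h} lab"
  have bij: "bij_betw \<phi> (verts H) (z ` {..<h})"
    unfolding \<phi>_def by (rule bij_betw_trans[OF bij_betw_inv_into[OF lab] inj_on_imp_bij_betw[OF z(2)]])
  have inj: "inj_on lab {..<h}" and im: "lab ` {..<h} = verts H" using lab by (auto simp: bij_betw_def)
  have \<phi>l: "\<phi> (lab u) = z u" if "u < h" for u using inv_into_f_f[OF inj] that by (simp add: \<phi>_def)
  have "E \<inter> nsets (z ` {..<h}) 2 = (\<lambda>e. \<phi> ` e) ` edges H"
  proof (intro equalityI subsetI)
    fix e assume e: "e \<in> E \<inter> nsets (z ` {..<h}) 2"
    then obtain x y where "e = {x, y}" "x \<in> z ` {..<h}" "y \<in> z ` {..<h}" "x \<noteq> y" by (auto elim: nsets2_E)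
    then obtain u v where uv: "u < h" "v < h" "e = {z u, z v}" "u \<noteq> v" by auto
    then have "{lab u, lab v} \<in> edges H" using adj e by blast
    moreover have "e = \<phi> ` {lab u, lab v}" using uv \<phi>l by simp
    ultimately show "e \<in> (\<lambda>e. \<phi> ` e) ` edges H" by blast
  next
    fix e assume "e \<in> (\<lambda>e. \<phi> ` e) ` edges H"
    then obtain e' where e': "e' \<in> edges H" "e = \<phi> ` e'" by blast
    then have "e' \<in> nsets (verts H) 2" using ugraph_H by (auto simp: ugraph_def)
    then obtain x y where xy: "e' = {x, y}" "x \<in> verts H" "y \<in> verts H" "x \<noteq> y" by (rule nsets2_E)
    then have "x \<in> lab ` {..<h}" "y \<in> lab ` {..<h}" using im by simp_all
    then obtain u v where uv': "u < h" "v < h" "x = lab u" "y = lab v" by auto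
    then have uv: "u < h" "v < h" "e' = {lab u, lab v}" "u \<noteq> v" using xy by auto
    then have "e = {z u, z v}" using e' \<phi>l by simp
    moreover have "z u \<noteq> z v" using z(2) uv by (auto dest: inj_onD)
    moreover have "{z u, z v} \<in> E" using adj uv e' by blast
    ultimately show "e \<in> E \<inter> nsets (z ` {..<h}) 2" using uv by auto
  qed
  then have "graph_iso H (induced_subgraph (V, E) (z ` {..<h}))"
    using bij unfolding graph_iso_def induced_subgraph_def by auto
  then show ?thesis using z(1) unfolding Forb_def by auto
qed

section \<open>Lower bound\<close>

definition ed :: "real \<Rightarrow> real" where
  "ed p = min (p / (real \<omega> - 1)) ((1 - p) / (real \<alpha> - 1))"

text \<open>On each pair of cells of the partition of the edited graph, the densities of the two graphs
  differ by at least \<open>p\<close> (white pair) or \<open>1 - p\<close> (black pair), up to the errors.\<close>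

lemma cell_pair_cost:
  assumes p: "0 \<le> p" "p \<le> 1" and \<delta>: "0 < \<delta>"
    and N: "N \<ge> 0" and s: "\<bar>s - p * N\<bar> \<le> r" and s': "s' = N * u" and u: "0 \<le> u" "u \<le> 1"
  shows "ed p * (N * pcost (\<alpha> - 1) (\<omega> - 1) (ptype_of \<delta> u)) - \<delta> * N - r \<le> \<bar>s - s'\<bar>"
proof -
  have ab: "real (\<omega> - 1) = real \<omega> - 1" "real (\<alpha> - 1) = real \<alpha> - 1" "real \<omega> - 1 > 0" "real \<alpha> - 1 > 0"
    using omega_ge alpha_ge by (auto simp: of_nat_diff)
  have "ed p \<le> p / (real \<omega> - 1)" "ed p \<le> (1 - p) / (real \<alpha> - 1)" by (auto simp: ed_def)
  then have e: "ed p * (real \<omega> - 1) \<le> p" "ed p * (real \<alpha> - 1) \<le> 1 - p" using ab by (auto simp: pos_le_divide_eq)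
  have dN: "0 \<le> \<delta> * N" using \<delta> N by simp
  consider "u < \<delta>" | "u \<ge> \<delta>" "u > 1 - \<delta>" | "u \<ge> \<delta>" "u \<le> 1 - \<delta>" by linarith
  then show ?thesis
  proof cases
    case 1
    then have "ptype_of \<delta> u = White" by (simp add: ptype_of_def)
    then have "ed p * (N * pcost (\<alpha> - 1) (\<omega> - 1) (ptype_of \<delta> u)) = N * (ed p * (real \<omega> - 1))"
      using ab by (simp add: pcost_def)
    also have "\<dots> \<le> N * p" using e N by (intro mult_left_mono)
    finally have "ed p * (N * pcost (\<alpha> - 1) (\<omega> - 1) (ptype_of \<delta> u)) \<le> p * N" by (simp add: mult.commute)
    moreover have "s' \<le> \<delta> * N" using 1 N unfolding s' by (subst mult.commute, intro mult_right_mono) auto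
    ultimately show ?thesis using s by linarith
  next
    case 2
    then have "ptype_of \<delta> u = Black" by (simp add: ptype_of_def)
    then have "ed p * (N * pcost (\<alpha> - 1) (\<omega> - 1) (ptype_of \<delta> u)) = N * (ed p * (real \<alpha> - 1))"
      using ab by (simp add: pcost_def)
    also have "\<dots> \<le> N * (1 - p)" using e N by (intro mult_left_mono)
    finally have "ed p * (N * pcost (\<alpha> - 1) (\<omega> - 1) (ptype_of \<delta> u)) \<le> N - p * N" by (simp add: algebra_simps)
    moreover have "(1 - \<delta>) * N \<le> s'" using 2 N unfolding s' by (subst (2) mult.commute, intro mult_right_mono) auto
    then have "N - \<delta> * N \<le> s'" by (simp add: algebra_simps)
    ultimately show ?thesis using s by linarith
  next
    case 3
    then have "ptype_of \<delta> u = Gray" by (simp add: ptype_of_def)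
    then show ?thesis using dN s by (simp add: pcost_def)
  qed
qed


lemma ed_bounds:
  assumes "0 \<le> p" "p \<le> 1"
  shows "0 \<le> ed p" "ed p \<le> 1"
proof -
  have "real \<omega> - 1 \<ge> 1" "real \<alpha> - 1 \<ge> 1" using omega_ge alpha_ge by linarith+
  then show "0 \<le> ed p" "ed p \<le> 1" using assms by (auto simp: ed_def min_le_iff_disj pos_divide_le_eq)
qed

text \<open>Since \<open>E'\<close> has no induced copy of \<open>H\<close>, it has an expensive
  partition into at most \<open>k\<close> cells. Summing \<open>cell_pair_cost\<close> over all
  pairs of these cells bounds the number of changes. Edges are counted as ordered pairs, hence the
  factor 2.\<close>

lemma far_from_Forb:
  assumes p: "0 \<le> p" "p \<le> 1" and \<eta>: "\<eta> > 0"
  shows "\<exists>n0 \<epsilon>. \<epsilon> > 0 \<and> (\<forall>n\<ge>n0. \<forall>E E'. E \<subseteq> nsets {..<n} 2 \<longrightarrow> ({..<n}, E') \<in> Forb H \<longrightarrow>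
     (\<forall>A\<subseteq>{..<n}. \<forall>B\<subseteq>{..<n}. \<bar>\<Sum>x\<in>A. \<Sum>y\<in>B. of_bool ({x, y} \<in> E) - p\<bar> \<le> \<epsilon> * (real n)\<^sup>2) \<longrightarrow>
     2 * real (card (sym_diff E E')) \<ge> (ed p - \<eta>) * (real n)\<^sup>2)"
proof -
  obtain h :: nat and lab :: "nat \<Rightarrow> 'a" and K S where lab: "bij_betw lab {..<h} (verts H)" and KS: "K \<union> S = {..<h}"
    and sp: "split_pattern K S (\<lambda>i j. {lab i, lab j} \<in> edges H) (\<alpha> - 1) (\<omega> - 1)"
    by (rule obtain_pattern)
  \<comment> \<open>One third of \<open>\<eta>\<close> each goes to the loss in the cost bound, the
    threshold of the types, and the discrepancy of \<open>E\<close>.\<close>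
  define \<eta>' where "\<eta>' = min 1 (\<eta> / 3)"
  define \<delta> where "\<delta> = min (1 / 4) (\<eta> / 3)"
  have \<eta>': "0 < \<eta>'" "\<eta>' \<le> 1" "\<eta>' \<le> \<eta> / 3" and \<delta>: "0 < \<delta>" "\<delta> < 1 / 2" "\<delta> \<le> \<eta> / 3"
    using \<eta> by (auto simp: \<eta>'_def \<delta>_def min_def)
  obtain k n0 where kn: "\<forall>(V :: nat set) E. finite V \<longrightarrow> n0 \<le> card V \<longrightarrow> (\<forall>x y. E x y = E y x) \<longrightarrow>
     (\<exists>z\<in>PiE {..<h} (\<lambda>_. V). inj_on z {..<h} \<and> (\<forall>u<h. \<forall>v<h. u \<noteq> v \<longrightarrow> E (z u) (z v) = ({lab u, lab v} \<in> edges H))) \<or>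
     (\<exists>q. (\<forall>x. q x < k) \<and>
       (\<Sum>x\<in>V. \<Sum>y\<in>V. pcost (\<alpha> - 1) (\<omega> - 1) (ptype_of \<delta> (cell_avg V (\<lambda>x y. of_bool (E x y)) q (q x) (q y))))
          \<ge> (1 - \<eta>') * (card V)\<^sup>2)"
    using induced_copy_or_expensive[OF sp KS \<eta>'(1,2) \<delta>(1,2), where 'v = nat] by (elim exE, intro that)
  \<comment> \<open>Each of the at most \<open>k^2\<close> pairs of cells contributes a discrepancy
    of \<open>\<epsilon> * n^2\<close>, so \<open>\<epsilon>\<close> is chosen after
    \<open>k\<close>; the added 1 covers \<open>k = 0\<close>.\<close>
  define \<epsilon> where "\<epsilon> = \<eta> / (3 * ((real k)\<^sup>2 + 1))"
  have k1: "(real k)\<^sup>2 + 1 > 0" by (simp add: add_nonneg_pos)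
  have \<epsilon>: "\<epsilon> > 0" using \<eta> k1 by (simp add: \<epsilon>_def)
  have k\<epsilon>: "(real k)\<^sup>2 * \<epsilon> \<le> \<eta> / 3"
  proof -
    have "D * (\<eta> / (3 * D)) = \<eta> / 3" if "D > 0" for D using that by simp
    from this[OF k1] have "((real k)\<^sup>2 + 1) * \<epsilon> = \<eta> / 3" unfolding \<epsilon>_def .
    then show ?thesis using \<epsilon> by (simp add: distrib_right)
  qed
  show ?thesis
  proof (rule exI[of _ n0], rule exI[of _ \<epsilon>], intro conjI \<epsilon> allI impI)
    fix n E E'
    assume n: "n0 \<le> n" and E: "E \<subseteq> nsets {..<n} 2" and F: "({..<n}, E') \<in> Forb H"
      and qr: "\<forall>A\<subseteq>{..<n}. \<forall>B\<subseteq>{..<n}. \<bar>\<Sum>x\<in>A. \<Sum>y\<in>B. of_bool ({x, y} \<in> E) - p\<bar> \<le> \<epsilon> * (real n)\<^sup>2"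
    let ?V = "{..<n}"
    have E': "E' \<subseteq> nsets ?V 2" using F by (auto simp: Forb_def ugraph_def)
    define W' where "W' x y = (of_bool ({x, y} \<in> E') :: real)" for x y
    define W where "W x y = (of_bool ({x, y} \<in> E) :: real)" for x y
    have symE': "\<forall>x y. ({x, y} \<in> E') = ({y, x} \<in> E')" by (simp add: insert_commute)
    have nocopy: "\<not> (\<exists>z\<in>PiE {..<h} (\<lambda>_. ?V). inj_on z {..<h} \<and> (\<forall>u<h. \<forall>v<h. u \<noteq> v \<longrightarrow> ({z u, z v} \<in> E') = ({lab u, lab v} \<in> edges H)))"
    proof
      assume "\<exists>z\<in>PiE {..<h} (\<lambda>_. ?V). inj_on z {..<h} \<and> (\<forall>u<h. \<forall>v<h. u \<noteq> v \<longrightarrow> ({z u, z v} \<in> E') = ({lab u, lab v} \<in> edges H))"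
      then obtain z where z: "z \<in> PiE {..<h} (\<lambda>_. ?V)" "inj_on z {..<h}"
        "\<forall>u<h. \<forall>v<h. u \<noteq> v \<longrightarrow> ({z u, z v} \<in> E') = ({lab u, lab v} \<in> edges H)" by blast
      have "(?V, E') \<notin> Forb H"
        by (rule not_Forb_if_copy[OF lab _ z(2)]) (use z in \<open>auto simp: PiE_iff\<close>)
      then show False using F by simp
    qed
    obtain q where q: "\<forall>x. q x < k"
      "(\<Sum>x\<in>?V. \<Sum>y\<in>?V. pcost (\<alpha> - 1) (\<omega> - 1) (ptype_of \<delta> (cell_avg ?V W' q (q x) (q y)))) \<ge> (1 - \<eta>') * (card ?V)\<^sup>2"
      using kn[rule_format, of ?V "\<lambda>x y. {x, y} \<in> E'"] n symE' nocopy unfolding W'_def by auto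
    define U where "U = cell_avg ?V W' q"
    define P where "P c d = pcost (\<alpha> - 1) (\<omega> - 1) (ptype_of \<delta> (U c d))" for c d
    let ?C = "q ` ?V" and ?c = "cell ?V q"
    have cellV: "?c c \<subseteq> ?V" for c by (auto simp: cell_def)
    have W'01: "0 \<le> W' x y \<and> W' x y \<le> 1" for x y by (simp add: W'_def)
    have U01: "0 \<le> U c d" "U c d \<le> 1" for c d
      unfolding U_def using cell_avg_bounds[of ?V W', OF _ W'01] by auto
    define r where "r = \<epsilon> * (real n)\<^sup>2"
    have r0: "r \<ge> 0" using \<epsilon> by (simp add: r_def)
    have pair: "ed p * (\<Sum>x\<in>?c c. \<Sum>y\<in>?c d. P (q x) (q y)) - \<delta> * (\<Sum>x\<in>?c c. \<Sum>y\<in>?c d. 1) - r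
       \<le> (\<Sum>x\<in>?c c. \<Sum>y\<in>?c d. \<bar>W x y - W' x y\<bar>)" if cd: "c \<in> ?C" "d \<in> ?C" for c d
    proof -
      define N where "N = real (card (?c c) * card (?c d))"
      have sP: "(\<Sum>x\<in>?c c. \<Sum>y\<in>?c d. P (q x) (q y)) = N * P c d"
      proof -
        have "(\<Sum>x\<in>?c c. \<Sum>y\<in>?c d. P (q x) (q y)) = (\<Sum>x\<in>?c c. \<Sum>y\<in>?c d. P c d)"
          by (intro sum.cong refl) (auto simp: cell_def)
        then show ?thesis by (simp add: N_def)
      qed
      have s1: "(\<Sum>x\<in>?c c. \<Sum>y\<in>?c d. 1) = N" by (simp add: N_def)
      have s': "(\<Sum>x\<in>?c c. \<Sum>y\<in>?c d. W' x y) = N * U c d"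
        unfolding N_def U_def using cell_avg_block[OF _ cd, of W'] by simp
      have "(\<Sum>x\<in>?c c. \<Sum>y\<in>?c d. of_bool ({x, y} \<in> E) - p) = (\<Sum>x\<in>?c c. \<Sum>y\<in>?c d. W x y) - p * N"
        by (simp add: sum_subtractf W_def N_def)
      then have s: "\<bar>(\<Sum>x\<in>?c c. \<Sum>y\<in>?c d. W x y) - p * N\<bar> \<le> r"
        using qr[rule_format, of "?c c" "?c d", OF cellV cellV] by (simp add: r_def)
      have "ed p * (N * P c d) - \<delta> * N - r \<le> \<bar>(\<Sum>x\<in>?c c. \<Sum>y\<in>?c d. W x y) - (\<Sum>x\<in>?c c. \<Sum>y\<in>?c d. W' x y)\<bar>"
        unfolding P_def by (rule cell_pair_cost[OF p \<delta>(1) _ s s' U01]) (simp add: N_def)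
      also have "\<dots> = \<bar>\<Sum>x\<in>?c c. \<Sum>y\<in>?c d. W x y - W' x y\<bar>" by (simp add: sum_subtractf)
      also have "\<dots> \<le> (\<Sum>x\<in>?c c. \<bar>\<Sum>y\<in>?c d. W x y - W' x y\<bar>)" by (rule sum_abs)
      also have "\<dots> \<le> (\<Sum>x\<in>?c c. \<Sum>y\<in>?c d. \<bar>W x y - W' x y\<bar>)" by (intro sum_mono sum_abs)
      finally show ?thesis unfolding sP s1 .
    qed
    have cC: "real (card ?C) \<le> real k"
    proof -
      have "card ?C \<le> card {..<k}" using q(1) by (intro card_mono) auto
      then show ?thesis by simp
    qed
    have sums: "(\<Sum>x\<in>?V. \<Sum>y\<in>?V. F x y) = (\<Sum>c\<in>?C. \<Sum>d\<in>?C. \<Sum>x\<in>?c c. \<Sum>y\<in>?c d. F x y)" for F :: "nat \<Rightarrow> nat \<Rightarrow> real"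
      by (rule sum_cells) simp
    have "ed p * (\<Sum>x\<in>?V. \<Sum>y\<in>?V. P (q x) (q y)) - \<delta> * (\<Sum>x\<in>?V. \<Sum>y\<in>?V. 1) - (\<Sum>c\<in>?C. \<Sum>d\<in>?C. r)
      = (\<Sum>c\<in>?C. \<Sum>d\<in>?C. ed p * (\<Sum>x\<in>?c c. \<Sum>y\<in>?c d. P (q x) (q y)) - \<delta> * (\<Sum>x\<in>?c c. \<Sum>y\<in>?c d. 1) - r)"
      unfolding sums by (simp only: sum_subtractf sum_distrib_left)
    also have "\<dots> \<le> (\<Sum>c\<in>?C. \<Sum>d\<in>?C. \<Sum>x\<in>?c c. \<Sum>y\<in>?c d. \<bar>W x y - W' x y\<bar>)"
      by (intro sum_mono pair)
    also have "\<dots> = (\<Sum>x\<in>?V. \<Sum>y\<in>?V. \<bar>W x y - W' x y\<bar>)" by (rule sums[symmetric])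
    also have "\<dots> = (\<Sum>x\<in>?V. \<Sum>y\<in>?V. of_bool ({x, y} \<in> sym_diff E E'))"
      by (intro sum.cong refl) (auto simp: W_def W'_def)
    also have "\<dots> = 2 * real (card (sym_diff E E'))" by (rule sum_edges) (use E E' in auto)
    finally have main: "ed p * (\<Sum>x\<in>?V. \<Sum>y\<in>?V. P (q x) (q y)) - \<delta> * (\<Sum>x\<in>?V. \<Sum>y\<in>?V. 1) - (\<Sum>c\<in>?C. \<Sum>d\<in>?C. r)
      \<le> 2 * real (card (sym_diff E E'))" .
    have "(1 - \<eta>') * (real n)\<^sup>2 \<le> (\<Sum>x\<in>?V. \<Sum>y\<in>?V. P (q x) (q y))"
      using q(2) by (simp add: P_def U_def)
    then have "ed p * ((1 - \<eta>') * (real n)\<^sup>2) \<le> ed p * (\<Sum>x\<in>?V. \<Sum>y\<in>?V. P (q x) (q y))"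
      using ed_bounds[OF p] by (intro mult_left_mono) auto
    moreover have "ed p * ((1 - \<eta>') * (real n)\<^sup>2) \<ge> (ed p - \<eta> / 3) * (real n)\<^sup>2"
    proof -
      have "ed p * \<eta>' \<le> 1 * (\<eta> / 3)" using ed_bounds[OF p] \<eta>' by (intro mult_mono) auto
      then have "(ed p - \<eta> / 3) * (real n)\<^sup>2 \<le> (ed p - ed p * \<eta>') * (real n)\<^sup>2" by (intro mult_right_mono) auto
      then show ?thesis by (simp add: algebra_simps)
    qed
    moreover have "\<delta> * (\<Sum>x\<in>?V. \<Sum>y\<in>?V. 1) \<le> \<eta> / 3 * (real n)\<^sup>2"
      using mult_right_mono[OF \<delta>(3), of "(real n)\<^sup>2"] by (simp add: power2_eq_square)
    moreover have "(\<Sum>c\<in>?C. \<Sum>d\<in>?C. r) \<le> \<eta> / 3 * (real n)\<^sup>2"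
    proof -
      have "(\<Sum>c\<in>?C. \<Sum>d\<in>?C. r) = real (card ?C) * real (card ?C) * r" by simp
      also have "\<dots> \<le> real k * real k * r" using cC r0 by (intro mult_right_mono mult_mono) auto
      also have "\<dots> = ((real k)\<^sup>2 * \<epsilon>) * (real n)\<^sup>2" by (simp add: r_def power2_eq_square)
      also have "\<dots> \<le> \<eta> / 3 * (real n)\<^sup>2" using k\<epsilon> by (intro mult_right_mono) auto
      finally show ?thesis .
    qed
    moreover have "(ed p - \<eta> / 3) * (real n)\<^sup>2 - \<eta> / 3 * (real n)\<^sup>2 - \<eta> / 3 * (real n)\<^sup>2 = (ed p - \<eta>) * (real n)\<^sup>2"
      by (simp add: algebra_simps)
    ultimately show "2 * real (card (sym_diff E E')) \<ge> (ed p - \<eta>) * (real n)\<^sup>2" using main by linarith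
  qed
qed

lemma max_edit_dist_lower:
  assumes p: "0 \<le> p" "p \<le> 1" and \<eta>: "\<eta> > 0"
  shows "eventually (\<lambda>n. ed p - \<eta> \<le> max_edit_dist (Forb H) p n) sequentially"
proof -
  obtain n0 \<epsilon> where n0: "\<epsilon> > 0" "\<forall>n\<ge>n0. \<forall>E E'. E \<subseteq> nsets {..<n} 2 \<longrightarrow> ({..<n}, E') \<in> Forb H \<longrightarrow>
     (\<forall>A\<subseteq>{..<n}. \<forall>B\<subseteq>{..<n}. \<bar>\<Sum>x\<in>A. \<Sum>y\<in>B. of_bool ({x, y} \<in> E) - p\<bar> \<le> \<epsilon> * (real n)\<^sup>2) \<longrightarrow>
     2 * real (card (sym_diff E E')) \<ge> (ed p - \<eta>) * (real n)\<^sup>2"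
    using far_from_Forb[OF p \<eta>] by (elim exE conjE, intro that)
  obtain n1 where n1: "\<forall>n\<ge>n1. \<exists>E\<subseteq>nsets {..<n} 2. int (card E) = \<lfloor>p * real (n choose 2)\<rfloor> \<and>
     (\<forall>A\<subseteq>{..<n}. \<forall>B\<subseteq>{..<n}. \<bar>\<Sum>x\<in>A. \<Sum>y\<in>B. of_bool ({x, y} \<in> E) - p\<bar> \<le> \<epsilon> * (real n)\<^sup>2)"
    using quasirandom_graph[OF p n0(1)] by (elim exE, intro that)
  have "ed p - \<eta> \<le> max_edit_dist (Forb H) p n" if n: "n \<ge> max (max n0 n1) 2" for n
  proof -
    obtain E where E: "E \<subseteq> nsets {..<n} 2" "int (card E) = \<lfloor>p * real (n choose 2)\<rfloor>"
      "\<forall>A\<subseteq>{..<n}. \<forall>B\<subseteq>{..<n}. \<bar>\<Sum>x\<in>A. \<Sum>y\<in>B. of_bool ({x, y} \<in> E) - p\<bar> \<le> \<epsilon> * (real n)\<^sup>2"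
      using n1[rule_format, of n] n by auto
    have G: "ugraph ({..<n}, E)" "card (verts ({..<n}, E)) = n" using E by (auto simp: ugraph_def)
    obtain G' where G': "G' \<in> Forb H" "verts G' = {..<n}" "property_dist ({..<n}, E) (Forb H) = graph_dist ({..<n}, E) G'"
      using property_dist_attained[OF G(1)] n G(2) by auto
    have F: "({..<n}, edges G') \<in> Forb H" using G' by (metis prod.collapse)
    have far: "2 * real (card (sym_diff E (edges G'))) \<ge> (ed p - \<eta>) * (real n)\<^sup>2"
      using n0(2)[rule_format, of n E "edges G'"] n E F by auto
    have C: "real (n choose 2) > 0" using n by simp
    have "ed p - \<eta> \<le> graph_dist ({..<n}, E) G'"
    \<comment> \<open>Passing from \<open>n^2\<close> to the smaller \<open>n * (n - 1)\<close> is
      only valid for a nonnegative factor; otherwise the bound is trivial.\<close>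
    proof (cases "ed p - \<eta> \<ge> 0")
      case True
      have "(ed p - \<eta>) * (2 * real (n choose 2)) \<le> (ed p - \<eta>) * (real n)\<^sup>2"
        using True unfolding choose_two_real by (intro mult_left_mono) (auto simp: power2_eq_square algebra_simps)
      then have "(ed p - \<eta>) * real (n choose 2) \<le> real (card (sym_diff E (edges G')))" using far by simp
      then show ?thesis using C by (simp add: graph_dist_def pos_le_divide_eq)
    next
      case False
      have "graph_dist ({..<n}, E) G' \<ge> 0" by (simp add: graph_dist_def)
      then show ?thesis using False by linarith
    qed
    also have "\<dots> \<le> max_edit_dist (Forb H) p n"
      unfolding max_edit_dist_def G'(3)[symmetric]
    proof (rule Max_ge)
      show "finite ((\<lambda>G. property_dist G (Forb H)) ` {G. ugraph G \<and> card (verts G) = n \<and> int (card (edges G)) = \<lfloor>p * real (n choose 2)\<rfloor>})"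
        by (rule finite_property_dists) (use n in simp)
      show "property_dist ({..<n}, E) (Forb H) \<in> (\<lambda>G. property_dist G (Forb H)) ` {G. ugraph G \<and> card (verts G) = n \<and> int (card (edges G)) = \<lfloor>p * real (n choose 2)\<rfloor>}"
        using G E by (intro imageI) simp
    qed
    finally show ?thesis .
  qed
  then show ?thesis unfolding eventually_sequentially by blast
qed

section \<open>Upper bound and limit\<close>

text \<open>The term \<open>1 / (n choose 2)\<close> comes from rounding the edge number down, which
  leaves less than one extra nonedge in the bound with \<open>\<alpha>\<close>.\<close>

lemma max_edit_dist_upper:
  assumes p: "0 \<le> p" "p \<le> 1" and n: "n \<ge> 2"
  shows "max_edit_dist (Forb H) p n \<le> ed p + 1 / real (n choose 2)"
proof -
  let ?S = "{G :: nat ugraph. ugraph G \<and> card (verts G) = n \<and> int (card (edges G)) = \<lfloor>p * real (n choose 2)\<rfloor>}"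
  define C where "C = real (n choose 2)"
  have C: "C > 0" using n by (simp add: C_def)
  \<comment> \<open>\<open>Max\<close> is only meaningful on a nonempty set, so a graph with the
    prescribed edge number has to be exhibited.\<close>
  have "?S \<noteq> {}"
  proof -
    have "nat \<lfloor>p * C\<rfloor> \<le> card (nsets {..<n} 2)"
    proof -
      have "p * C \<le> C" using p C by (simp add: mult_left_le_one_le)
      then show ?thesis by (simp add: card_nsets C_def) linarith
    qed
    then obtain E where E: "E \<subseteq> nsets {..<n} 2" "card E = nat \<lfloor>p * C\<rfloor>"
      using obtain_subset_with_card_n by metis
    have "\<lfloor>p * C\<rfloor> \<ge> 0" using p C by simp
    then have "({..<n}, E) \<in> ?S" using E by (simp add: ugraph_def C_def)
    then show ?thesis by blast
  qed
  moreover have "finite ((\<lambda>G. property_dist G (Forb H)) ` ?S)" by (rule finite_property_dists[OF n])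
  moreover have "property_dist G (Forb H) \<le> ed p + 1 / C" if "G \<in> ?S" for G
  proof -
    have G: "ugraph G" "card (verts G) = n" "int (card (edges G)) = \<lfloor>p * C\<rfloor>" using that by (auto simp: C_def)
    have ab: "real \<omega> - 1 > 0" "real \<alpha> - 1 \<ge> 1" using omega_ge alpha_ge by linarith+
    have n': "card (verts G) \<ge> 2" using G n by simp
    have e: "real (card (edges G)) \<le> p * C" "p * C - 1 \<le> card (edges G)" using G(3) by linarith+
    have 1: "property_dist G (Forb H) \<le> p / (real \<omega> - 1)"
    proof -
      obtain G' where G': "G' \<in> Forb H" "verts G' = verts G" "graph_dist G G' \<le> card (edges G) / (real \<omega> - 1) / C"
        using exists_close_Forb(1)[OF G(1) n'] unfolding G(2) C_def by blast
      have "property_dist G (Forb H) \<le> graph_dist G G'" by (rule property_dist_le[OF G(1) n' G'(1,2)])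
      also note G'(3)
      also have "card (edges G) / (real \<omega> - 1) / C \<le> p * C / (real \<omega> - 1) / C"
        using e ab C by (intro divide_right_mono) auto
      also have "\<dots> = p / (real \<omega> - 1)" using C by simp
      finally show ?thesis .
    qed
    have 2: "property_dist G (Forb H) \<le> (1 - p) / (real \<alpha> - 1) + 1 / C"
    proof -
      obtain G' where G': "G' \<in> Forb H" "verts G' = verts G" "graph_dist G G' \<le> (C - card (edges G)) / (real \<alpha> - 1) / C"
        using exists_close_Forb(2)[OF G(1) n'] unfolding G(2) C_def by blast
      have "property_dist G (Forb H) \<le> graph_dist G G'" by (rule property_dist_le[OF G(1) n' G'(1,2)])
      also note G'(3)
      also have "(C - card (edges G)) / (real \<alpha> - 1) / C \<le> ((1 - p) * C + 1) / (real \<alpha> - 1) / C"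
        using e ab C by (intro divide_right_mono) (auto simp: algebra_simps)
      also have "\<dots> = (1 - p) / (real \<alpha> - 1) + 1 / C / (real \<alpha> - 1)" using C by (simp add: add_divide_distrib mult.commute)
      also have "1 / C / (real \<alpha> - 1) \<le> 1 / C" using C ab by (simp add: divide_le_eq mult_left_le)
      finally show ?thesis by simp
    qed
    have "0 \<le> 1 / C" using C by simp
    with 1 2 show ?thesis unfolding ed_def min_def by (split if_split) linarith
  qed
  ultimately show ?thesis
    unfolding max_edit_dist_def C_def[symmetric] by (subst Max_le_iff) (auto simp: C_def)
qed

lemma max_edit_dist_tendsto:
  assumes p: "0 \<le> p" "p \<le> 1"
  shows "max_edit_dist (Forb H) p \<longlonglongrightarrow> ed p"
proof (rule tendstoI)
  fix \<eta> :: real assume \<eta>: "\<eta> > 0"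
  obtain m :: nat where m: "m > 1 / \<eta>" using reals_Archimedean2 by blast
  have "eventually (\<lambda>n. max_edit_dist (Forb H) p n < ed p + \<eta>) sequentially"
    unfolding eventually_sequentially
  proof (intro exI[of _ "max m 3"] allI impI)
    fix n assume n: "max m 3 \<le> n"
    have "real n \<le> real (n choose 2)"
    proof -
      have "real n * 2 \<le> real n * (real n - 1)" using n by (intro mult_left_mono) auto
      then show ?thesis using choose_two_real[of n] by linarith
    qed
    then have "1 / \<eta> < real (n choose 2)" using m n by linarith
    then have "1 / real (n choose 2) < \<eta>"
    proof -
      have "real (n choose 2) > 0" using n by simp
      moreover have "1 < real (n choose 2) * \<eta>" using \<open>1 / \<eta> < real (n choose 2)\<close> \<eta> by (simp add: pos_divide_less_eq)
      ultimately show ?thesis by (simp add: pos_divide_less_eq mult.commute)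
    qed
    then show "max_edit_dist (Forb H) p n < ed p + \<eta>" using max_edit_dist_upper[OF p, of n] n by simp
  qed
  moreover have "eventually (\<lambda>n. ed p - \<eta> / 2 \<le> max_edit_dist (Forb H) p n) sequentially"
    by (rule max_edit_dist_lower[OF p]) (use \<eta> in simp)
  ultimately show "eventually (\<lambda>n. dist (max_edit_dist (Forb H) p n) (ed p) < \<eta>) sequentially"
    by eventually_elim (use \<eta> in \<open>simp add: dist_real_def abs_less_iff\<close>)
qed

end

theorem theorem1:
  fixes H :: "'a ugraph" and \<alpha> \<omega> :: nat
  assumes "split_graph H"
    and "\<not> complete_graph H"
    and "\<not> edgeless_graph H"
    and "\<alpha> = independence_number H"
    and "\<omega> = clique_number H"
  shows "\<forall>p\<in>{0..1::real}.
    convergent (max_edit_dist (Forb H) p) \<and>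
    edit_distance_function (Forb H) p = min (p / (real \<omega> - 1)) ((1 - p) / (real \<alpha> - 1))"
proof
  interpret nontrivial_split_graph H \<alpha> \<omega> using assms by unfold_locales
  fix p :: real assume "p \<in> {0..1}"
  then have "max_edit_dist (Forb H) p \<longlonglongrightarrow> ed p" by (intro max_edit_dist_tendsto) auto
  then show "convergent (max_edit_dist (Forb H) p) \<and>
    edit_distance_function (Forb H) p = min (p / (real \<omega> - 1)) ((1 - p) / (real \<alpha> - 1))"
    unfolding edit_distance_function_def ed_def[symmetric] by (auto simp: convergent_def limI)
qed

end
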